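(* Suppose the Markov chain $\Xi$ on $\mathbb X\subseteq\mathbb R$ satisfies $(\mathrm T^{\mathrm{bal}}_{\alpha,c})$ and $(\mathrm D'_{\gamma,b})$, and let $q>0$. Then for all $a$ sufficiently large and all $x$ with $|x|>a$: (i) if $\gamma>\alpha-1$, then $\mathbb E_x[\tau_a^q]<\infty$ for $q<1-\frac1\alpha$ and $=\infty$ for $q>1-\frac1\alpha$; (ii) if $\gamma=\alpha-1$ and $b+c\pi\cot(\frac{\pi\alpha}2)<0$, then $\mathbb E_x[\tau_a^q]<\infty$ for $q<\nu^\star/\alpha$ and $=\infty$ for $q>\nu^\star/\alpha$, where $\nu^\star\in(0,\alpha)$ is the unique solution of $$\frac bc=(\nu^\star-1)\frac{\Gamma(1-\alpha)\Gamma(\alpha-\nu^\star)}{\Gamma(2-\nu^\star)}+\Gamma(\nu^\star)\left(\frac{(1-\alpha+\nu^\star)\Gamma(1-\alpha)}{\Gamma(2-\alpha+\nu^\star)}-\frac{\Gamma(\alpha-\nu^\star)}{\Gamma(\alpha)}\right);$$ (iii) if $\gamma<\alpha-1$ and $b<0$, then $\mathbb E_x[\tau_a^q]<\infty$ for $q<\frac{\alpha}{\gamma+1}$ and $=\infty$ for $q\ge\frac{\alpha}{\gamma+1}$.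
   Context: $\Xi=(\xi_n)_{n\ge0}$ is a time-homogeneous Markov chain on an infinite, unbounded, measurable $\mathbb X\subseteq\mathbb R$. $\mathbb P_x,\mathbb E_x$ refer to the chain started at $x$; $\theta:=\xi_1-\xi_0$; $y_+:=y\mathbf 1\{y\ge0\}$, $y_-:=-y\mathbf 1\{y<0\}$; $\mu(x):=\mathbb E_x[\theta]$; $\tau_a:=\min\{n\ge0:|\xi_n|\le a\}$; $\Gamma$ is the gamma function. $(\mathrm T^{\mathrm{bal}}_{\alpha,c})$: there exist $\alpha\in(1,2)$, $c>0$, $x_0\in\mathbb R_+$ such that, as $y\to\infty$, each of $\sup_{x\ge x_0}|y^\alpha\mathbb P_x[\theta_+>y]-c|$, $\sup_{x\ge x_0}|y^\alpha\mathbb P_x[\theta_->y]-c|$, $\sup_{x\le-x_0}|y^\alpha\mathbb P_x[\theta_+>y]-c|$, $\sup_{x\le-x_0}|y^\alpha\mathbb P_x[\theta_->y]-c|$ tends to $0$. $(\mathrm D'_{\gamma,b})$: there exist $\gamma\ge0$, $b\in\mathbb R$ with $\lim_{x\to+\infty}x^\gamma\mu(x)=\lim_{x\to-\infty}(-|x|^\gamma\mu(x))=b$. *)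

theory Defs
  imports "HOL-Probability.Probability"
begin

text \<open>Finite-dimensional distributions of a time-homogeneous Markov chain with
  transition kernel K started at x:
  cyl K A n x = P_x[xi_0 in A 0, ..., xi_n in A n].\<close>
primrec cyl :: "(real \<Rightarrow> real measure) \<Rightarrow> (nat \<Rightarrow> real set) \<Rightarrow> nat \<Rightarrow> real \<Rightarrow> ennreal" where
  "cyl K A 0 x = indicator (A 0) x"
| "cyl K A (Suc n) x = indicator (A 0) x * (\<integral>\<^sup>+ y. cyl K (\<lambda>i. A (Suc i)) n y \<partial>K x)"

definition markov_chain_from ::
  "'w measure \<Rightarrow> (nat \<Rightarrow> 'w \<Rightarrow> real) \<Rightarrow> (real \<Rightarrow> real measure) \<Rightarrow> real \<Rightarrow> bool" where
  "markov_chain_from M \<xi> K x \<longleftrightarrow>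
     prob_space M \<and> (\<forall>n. \<xi> n \<in> borel_measurable M) \<and>
     (\<forall>n A. (\<forall>i. A i \<in> sets borel) \<longrightarrow>
        emeasure M {\<omega> \<in> space M. \<forall>i\<le>n. \<xi> i \<omega> \<in> A i} = cyl K A n x)"

definition theta :: "(nat \<Rightarrow> 'w \<Rightarrow> real) \<Rightarrow> 'w \<Rightarrow> real" where
  "theta \<xi> \<omega> = \<xi> 1 \<omega> - \<xi> 0 \<omega>"

definition pospart :: "real \<Rightarrow> real" where
  "pospart y = (if y \<ge> 0 then y else 0)"

definition negpart :: "real \<Rightarrow> real" where
  "negpart y = (if y < 0 then - y else 0)"

definition drift :: "(real \<Rightarrow> 'w measure) \<Rightarrow> (nat \<Rightarrow> 'w \<Rightarrow> real) \<Rightarrow> real \<Rightarrow> real" where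
  "drift P \<xi> x = (\<integral>\<omega>. theta \<xi> \<omega> \<partial>P x)"

text \<open>Condition (T^bal_{alpha,c}); x ranges over the state space X.
  "sup_{x} |...| tends to 0 as y \<rightarrow> \<infinity>" is written as uniform convergence.\<close>
definition Tbal ::
  "real set \<Rightarrow> (real \<Rightarrow> 'w measure) \<Rightarrow> (nat \<Rightarrow> 'w \<Rightarrow> real) \<Rightarrow> real \<Rightarrow> real \<Rightarrow> bool" where
  "Tbal X P \<xi> \<alpha> c \<longleftrightarrow> 1 < \<alpha> \<and> \<alpha> < 2 \<and> 0 < c \<and>
     (\<exists>x0\<ge>0. \<forall>\<epsilon>>0. \<exists>Y. \<forall>y\<ge>Y. \<forall>x\<in>X. \<bar>x\<bar> \<ge> x0 \<longrightarrow>
        \<bar>y powr \<alpha> * measure (P x) {\<omega> \<in> space (P x). pospart (theta \<xi> \<omega>) > y} - c\<bar> \<le> \<epsilon> \<and>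
        \<bar>y powr \<alpha> * measure (P x) {\<omega> \<in> space (P x). negpart (theta \<xi> \<omega>) > y} - c\<bar> \<le> \<epsilon>)"

definition Dprime ::
  "real set \<Rightarrow> (real \<Rightarrow> 'w measure) \<Rightarrow> (nat \<Rightarrow> 'w \<Rightarrow> real) \<Rightarrow> real \<Rightarrow> real \<Rightarrow> bool" where
  "Dprime X P \<xi> \<gamma> b \<longleftrightarrow> 0 \<le> \<gamma> \<and>
     ((\<lambda>x. x powr \<gamma> * drift P \<xi> x) \<longlongrightarrow> b) (at_top \<sqinter> principal X) \<and>
     ((\<lambda>x. - (\<bar>x\<bar> powr \<gamma> * drift P \<xi> x)) \<longlongrightarrow> b) (at_bot \<sqinter> principal X)"

definition hit_time :: "real \<Rightarrow> (nat \<Rightarrow> 'w \<Rightarrow> real) \<Rightarrow> 'w \<Rightarrow> enat" where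
  "hit_time a \<xi> \<omega> = (if \<exists>n. \<bar>\<xi> n \<omega>\<bar> \<le> a then enat (LEAST n. \<bar>\<xi> n \<omega>\<bar> \<le> a) else \<infinity>)"

definition tau_moment :: "(real \<Rightarrow> 'w measure) \<Rightarrow> (nat \<Rightarrow> 'w \<Rightarrow> real) \<Rightarrow> real \<Rightarrow> real \<Rightarrow> real \<Rightarrow> ennreal" where
  "tau_moment P \<xi> a q x =
     (\<integral>\<^sup>+ \<omega>. (case hit_time a \<xi> \<omega> of enat n \<Rightarrow> ennreal (real n powr q) | \<infinity> \<Rightarrow> \<infinity>) \<partial>P x)"

definition nu_eq :: "real \<Rightarrow> real \<Rightarrow> real \<Rightarrow> real \<Rightarrow> bool" where
  "nu_eq \<alpha> b c \<nu> \<longleftrightarrow>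
     b / c = (\<nu> - 1) * Gamma (1 - \<alpha>) * Gamma (\<alpha> - \<nu>) / Gamma (2 - \<nu>)
       + Gamma \<nu> * ((1 - \<alpha> + \<nu>) * Gamma (1 - \<alpha>) / Gamma (2 - \<alpha> + \<nu>)
                     - Gamma (\<alpha> - \<nu>) / Gamma \<alpha>)"

end

theory Submission
  imports Defs "HOL-Real_Asymp.Real_Asymp"
begin

text \<open>Everything is read off from the functions \<open>\<bar>x\<bar> powr \<nu>\<close> with \<open>0 < \<nu> < \<alpha>\<close>. Integrating the increment of
  such a function against the tails of a jump shows that its mean one-step change from \<open>x\<close> is
  asymptotically \<open>\<kappa> \<nu> * \<bar>x\<bar> powr (\<nu> - \<beta>)\<close>, where \<open>\<beta>\<close> is the minimum of \<open>\<alpha>\<close> and \<open>\<gamma> + 1\<close>, and where \<open>\<kappa> \<nu>\<close> combines the drift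
  with a difference of regularised Beta integrals, that is with the right-hand side of the equation for
  \<open>\<nu>\<close>. The survival probabilities \<open>P\<^sub>x(\<tau>\<^sub>a > n)\<close> satisfy a one-step recursion, so super- and subsolutions
  of that recursion bound them. If \<open>\<kappa> \<nu> < 0\<close>, the function
  \<open>(\<bar>x\<bar> / y) powr \<nu> + (1 - \<epsilon> * y powr (- \<beta>)) ^ n * \<bar>x\<bar> powr \<nu>\<close> is a supersolution, and \<open>y\<close> slightly below
  \<open>n powr (1 / \<beta>)\<close> gives a decay almost as fast as \<open>n powr (- \<nu> / \<beta>)\<close>. If \<open>\<kappa> \<nu> > 0\<close>, a difference of two powers is a
  subsolution, whence a lower bound of order \<open>n powr (- \<nu> / \<beta>)\<close>; with a dominant drift towards the
  origin, a single jump over distance \<open>n powr (1 / \<beta>)\<close> already survives for a time of order \<open>n\<close>.\<close>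

section \<open>Regularised Beta integrals\<close>

text \<open>The limiting tail \<open>s powr (- \<alpha>)\<close> is not integrable at 0, so the
  derivative of \<open>\<bar>1 + s\<bar> powr \<nu> / \<nu>\<close> cannot be integrated against it
  as it stands. Subtracting 1 from the derivative takes the linear term out of the increment. What
  remains is of order s near 0, hence integrable because \<alpha> < 2, and at infinity \<nu> <
  \<alpha> suffices. The removed term is the drift, whose order depends on \<gamma> and not on the
  tails, so it is carried along separately until the regimes are distinguished. The comparison for
  survival needs no stopping theorem. A supersolution may violate the recursion wherever it is at
  least 1, a subsolution wherever it already lies below the survival probability. This confines
  every estimate to a bounded range of \<open>\<bar>x\<bar>\<close>, where powers can be compared.
  The lower bounds have two stages: reach distance of order \<open>n powr (1 / \<beta>)\<close>,
  then avoid the origin up to time n with probability at least 1/2. The second stage holds whatever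
  the sign of \<open>\<kappa>\<close>.\<close>

lemma has_integral_regularised_Beta_01:
  fixes \<alpha> \<nu> :: real
  assumes "1 < \<alpha>" "\<alpha> < 2" "0 < \<nu>"
  shows "((\<lambda>s. ((1 - s) powr (\<nu> - 1) - 1) * s powr (- \<alpha>)) has_integral
     (1 / (\<alpha> - 1) + (1 - \<nu> / (\<alpha> - 1)) * Beta (2 - \<alpha>) \<nu>)) {0..1}"
proof -
  \<comment> \<open>F comes from integrating by parts. Its derivative is the wanted integrand minus
    k times a Beta integrand, and it is continuous up to 0 because the bracket is of order s there
    while \<alpha> < 2.\<close>
  define F where "F s = ((1 - s) powr \<nu> - 1) * s powr (1 - \<alpha>) / (1 - \<alpha>)" for s :: real
  define k where "k = 1 - \<nu> / (\<alpha> - 1)"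
  define g where "g s = ((1 - s) powr (\<nu> - 1) - 1) * s powr (- \<alpha>) 
      - k * (s powr (2 - \<alpha> - 1) * (1 - s) powr (\<nu> - 1))" for s :: real
  have 1: "(g has_integral F 1 - F 0) {0..1}"
  proof (rule fundamental_theorem_of_calculus_interior)
    have "(F \<longlongrightarrow> F 0) (at_right 0)"
      unfolding F_def using assms by simp real_asymp
    moreover have "continuous (at s within {0..1}) F" if "s \<in> {0<..1}" for s
      unfolding F_def continuous_within using that assms
      by (intro tendsto_divide tendsto_mult tendsto_diff tendsto_powr' tendsto_const tendsto_ident_at)
         (auto simp: eventually_at_filter)
    ultimately show "continuous_on {0..1} F"
      by (auto simp: continuous_on_eq_continuous_within continuous_within at_within_Icc_at_right less_eq_real_def)
  next
    fix s :: real assume s: "s \<in> {0<..<1}"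
    have p: "(1 - s) powr \<nu> = (1 - s) powr (\<nu> - 1) * (1 - s)" "s powr (1 - \<alpha>) = s * s powr (-\<alpha>)"
      using s by (simp_all add: powr_mult_base powr_diff powr_minus field_simps)
    have "(F has_real_derivative (- (\<nu> * (1 - s) powr (\<nu> - 1)) * s powr (1 - \<alpha>) + 
        ((1 - s) powr \<nu> - 1) * ((1 - \<alpha>) * s powr (1 - \<alpha> - 1))) / (1 - \<alpha>)) (at s)"
      unfolding F_def using s assms by (auto intro!: derivative_eq_intros)
    also have "(- (\<nu> * (1 - s) powr (\<nu> - 1)) * s powr (1 - \<alpha>) + 
        ((1 - s) powr \<nu> - 1) * ((1 - \<alpha>) * s powr (1 - \<alpha> - 1))) / (1 - \<alpha>) = g s"
      unfolding g_def k_def using assms by (simp add: p field_simps)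
    finally show "(F has_vector_derivative g s) (at s)"
      by (simp add: has_real_derivative_iff_has_vector_derivative)
  qed simp
  have 2: "((\<lambda>s. k * (s powr (2 - \<alpha> - 1) * (1 - s) powr (\<nu> - 1))) has_integral k * Beta (2 - \<alpha>) \<nu>) {0..1}"
    using has_integral_mult_right[OF has_integral_Beta_real[of "2 - \<alpha>" \<nu>], of k] assms by simp
  from has_integral_add[OF 1 2] have "((\<lambda>s. ((1 - s) powr (\<nu> - 1) - 1) * s powr (- \<alpha>)) has_integral
     (F 1 - F 0 + k * Beta (2 - \<alpha>) \<nu>)) {0..1}"
    by (simp add: g_def)
  moreover have "F 1 - F 0 = 1 / (\<alpha> - 1)"
    using assms by (simp add: F_def field_simps)
  ultimately show ?thesis by (simp add: k_def)
qed

text \<open>The substitution \<open>s = t / (1 - t)\<close> turns the integral into one over the unit interval.\<close>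
lemma has_integral_regularised_Beta_infinite:
  fixes \<alpha> \<nu> :: real
  assumes "1 < \<alpha>" "\<alpha> < 2" "0 < \<nu>" "\<nu> < \<alpha>"
  shows "((\<lambda>t. ((1 - t) powr (1 - \<nu>) - 1) * (t / (1 - t)) powr (- \<alpha>) / (1 - t)^2) has_integral
     ((\<nu> - 1) / (\<alpha> - 1) * Beta (2 - \<alpha>) (\<alpha> - \<nu>))) {0<..<1}"
proof -
  \<comment> \<open>This is \<open>((1 + t) powr (\<nu> - 1) - 1) * t powr (1 - \<alpha>) / (1 -
    \<alpha>)\<close>, the primitive of an integration by parts, at t = s / (1 - s). It vanishes at
    both ends, so only the Beta term survives.\<close>
  define F where "F s = ((1 - s) powr (\<alpha> - \<nu>) - (1 - s) powr (\<alpha> - 1)) * s powr (1 - \<alpha>) / (1 - \<alpha>)" for s :: real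
  define k where "k = (\<nu> - 1) / (\<alpha> - 1)"
  define g where "g s = ((1 - s) powr (1 - \<nu>) - 1) * (s / (1 - s)) powr (- \<alpha>) / (1 - s)^2
      - k * (s powr (2 - \<alpha> - 1) * (1 - s) powr (\<alpha> - \<nu> - 1))" for s :: real
  have 1: "(g has_integral F 1 - F 0) {0..1}"
  proof (rule fundamental_theorem_of_calculus_interior)
    have "(F \<longlongrightarrow> F 0) (at_right 0)"
      unfolding F_def using assms by simp real_asymp
    moreover have "continuous (at s within {0..1}) F" if "s \<in> {0<..1}" for s
      unfolding F_def continuous_within using that assms
      by (intro tendsto_divide tendsto_mult tendsto_diff tendsto_powr' tendsto_const tendsto_ident_at)
         (auto simp: eventually_at_filter)
    ultimately show "continuous_on {0..1} F"
      by (auto simp: continuous_on_eq_continuous_within continuous_within at_within_Icc_at_right less_eq_real_def)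
  next
    fix s :: real assume s: "s \<in> {0<..<1}"
    define u where "u = 1 - s"
    have u: "u > 0" "u < 1" "s = 1 - u" using s by (auto simp: u_def)
    have p: "u powr (\<alpha> - \<nu>) = u powr (1 - \<nu>) * (u powr \<alpha> / u)" "u powr (\<alpha> - 1) = u powr \<alpha> / u"
       "u powr (\<alpha> - \<nu> - 1) = u powr (1 - \<nu>) * (u powr \<alpha> / u^2)"  "u powr (\<alpha> - 1 - 1) = u powr \<alpha> / u^2"
       "s powr (1 - \<alpha>) = s * s powr (-\<alpha>)" "(s / u) powr (- \<alpha>) = s powr (- \<alpha>) * u powr \<alpha>"
       "s powr (1 - \<alpha> - 1) = s powr (-\<alpha>)" "s powr (2 - \<alpha> - 1) = s * s powr (-\<alpha>)"
      using s u(1) by (simp_all add: powr_diff powr_minus powr_divide field_simps power2_eq_square)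
        (simp_all add: powr_add)
    have "(F has_real_derivative ((- ((\<alpha> - \<nu>) * (1 - s) powr (\<alpha> - \<nu> - 1)) + (\<alpha> - 1) * (1 - s) powr (\<alpha> - 1 - 1)) * s powr (1 - \<alpha>) + 
        ((1 - s) powr (\<alpha> - \<nu>) - (1 - s) powr (\<alpha> - 1)) * ((1 - \<alpha>) * s powr (1 - \<alpha> - 1))) / (1 - \<alpha>)) (at s)"
      unfolding F_def using s assms by (auto intro!: derivative_eq_intros)
    also have "((- ((\<alpha> - \<nu>) * (1 - s) powr (\<alpha> - \<nu> - 1)) + (\<alpha> - 1) * (1 - s) powr (\<alpha> - 1 - 1)) * s powr (1 - \<alpha>) + 
        ((1 - s) powr (\<alpha> - \<nu>) - (1 - s) powr (\<alpha> - 1)) * ((1 - \<alpha>) * s powr (1 - \<alpha> - 1))) / (1 - \<alpha>) = g s"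
    proof -
      \<comment> \<open>Once the three powers are opaque, a rational identity in u remains.\<close>
      define w U V where "w = s powr (- \<alpha>)" and "U = u powr \<alpha>" and "V = u powr (1 - \<nu>)"
      show ?thesis
        unfolding g_def k_def u_def[symmetric] p unfolding w_def[symmetric] U_def[symmetric] V_def[symmetric]
        using assms u(1) unfolding u(3) by (simp add: power2_eq_square divide_simps) (simp add: algebra_simps)
    qed
    finally show "(F has_vector_derivative g s) (at s)"
      by (simp add: has_real_derivative_iff_has_vector_derivative)
  qed simp
  have 2: "((\<lambda>s. k * (s powr (2 - \<alpha> - 1) * (1 - s) powr (\<alpha> - \<nu> - 1))) has_integral k * Beta (2 - \<alpha>) (\<alpha> - \<nu>)) {0..1}"
    using has_integral_mult_right[OF has_integral_Beta_real[of "2 - \<alpha>" "\<alpha> - \<nu>"], of k] assms by simp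
  from has_integral_add[OF 1 2] have "((\<lambda>t. ((1 - t) powr (1 - \<nu>) - 1) * (t / (1 - t)) powr (- \<alpha>) / (1 - t)^2) has_integral
     (F 1 - F 0 + k * Beta (2 - \<alpha>) (\<alpha> - \<nu>))) {0..1}"
    by (simp add: g_def)
  moreover have "F 1 - F 0 = 0"
    using assms by (simp add: F_def)
  ultimately show ?thesis by (simp add: k_def has_integral_Icc_iff_Ioo)
qed

text \<open>The fundamental theorem yields gauge integrability only; a constant sign upgrades it to
  the Lebesgue integrability that Fubini and dominated convergence require.\<close>

lemma absolutely_integrable_onI_sign:
  fixes f :: "real \<Rightarrow> real"
  assumes "f integrable_on S" "(\<forall>x\<in>S. 0 \<le> f x) \<or> (\<forall>x\<in>S. f x \<le> 0)"
  shows "f absolutely_integrable_on S"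
  using assms(2)
proof
  assume "\<forall>x\<in>S. f x \<le> 0"
  then have "(\<lambda>x. - f x) absolutely_integrable_on S"
    using assms(1) by (intro nonnegative_absolutely_integrable_1 integrable_neg) auto
  then have "(\<lambda>x. - (- f x)) absolutely_integrable_on S"
    unfolding absolutely_integrable_on_def by (auto dest: integrable_neg)
  then show ?thesis by simp
qed (use assms(1) in \<open>auto intro: nonnegative_absolutely_integrable_1\<close>)

lemma absolutely_integrable_forward_kernel:
  fixes \<alpha> \<nu> :: real
  assumes "1 < \<alpha>" "\<alpha> < 2" "0 < \<nu>" "\<nu> < \<alpha>"
  defines "f \<equiv> \<lambda>s. ((1 + s) powr (\<nu> - 1) - 1) * s powr (- \<alpha>)"
  shows "f absolutely_integrable_on {0<..} \<and>
     integral {0<..} f = (\<nu> - 1) / (\<alpha> - 1) * Beta (2 - \<alpha>) (\<alpha> - \<nu>)"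
proof -
  define g where "g t = t / (1 - t)" for t :: real
  define g' where "g' t = 1 / (1 - t)^2" for t :: real
  have img: "g ` {0<..<1} = {0<..}"
  proof (intro equalityI subsetI)
    fix s :: real assume "s \<in> {0<..}"
    then show "s \<in> g ` {0<..<1}"
      by (intro image_eqI[of _ _ "s / (1 + s)"]) (auto simp: g_def field_simps)
  qed (auto simp: g_def)
  have eq: "\<bar>g' t\<bar> * f (g t) = ((1 - t) powr (1 - \<nu>) - 1) * (t / (1 - t)) powr (- \<alpha>) / (1 - t)^2"
    if "t \<in> {0<..<1}" for t
  proof -
    have "1 + t / (1 - t) = inverse (1 - t)"
      using that by (simp add: field_simps)
    moreover have "inverse (1 - t) powr (\<nu> - 1) = (1 - t) powr (1 - \<nu>)"
      using that powr_minus[of "inverse (1 - t)" "1 - \<nu>"] by (simp add: inverse_powr)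
    ultimately show ?thesis
      by (simp add: g_def g'_def f_def)
  qed
  have I: "((\<lambda>t. \<bar>g' t\<bar> * f (g t)) has_integral
     ((\<nu> - 1) / (\<alpha> - 1) * Beta (2 - \<alpha>) (\<alpha> - \<nu>))) {0<..<1}"
    using has_integral_regularised_Beta_infinite[OF assms(1-4)] eq
    by (subst has_integral_cong[OF eq]) auto
  \<comment> \<open>The sign is constant but depends on whether \<nu> is at least 1.\<close>
  have sgn: "(\<forall>s>0. f s \<ge> 0) \<or> (\<forall>s>0. f s \<le> 0)"
  proof (cases "\<nu> \<ge> 1")
    case True
    then show ?thesis by (auto simp: f_def ge_one_powr_ge_zero)
  next
    case False
    have "(1 + s) powr (\<nu> - 1) \<le> 1" if "s > 0" for s
      using powr_mono[of "\<nu> - 1" 0 "1 + s"] that False by simp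
    then show ?thesis by (auto simp: f_def mult_nonpos_nonneg)
  qed
  have "(\<lambda>t. \<bar>g' t\<bar> * f (g t)) absolutely_integrable_on {0<..<1}"
  proof (rule absolutely_integrable_onI_sign)
    have "g t > 0" if "t \<in> {0<..<1}" for t using that by (simp add: g_def)
    then show "(\<forall>t\<in>{0<..<1}. 0 \<le> \<bar>g' t\<bar> * f (g t)) \<or> (\<forall>t\<in>{0<..<1}. \<bar>g' t\<bar> * f (g t) \<le> 0)"
      using sgn by (auto intro!: mult_nonneg_nonneg mult_nonneg_nonpos)
  qed (use I in auto)
  moreover have "(g has_field_derivative g' t) (at t within {0<..<1})" if "t \<in> {0<..<1}" for t
    unfolding g_def g'_def using that
    by (auto intro!: derivative_eq_intros simp: field_simps power2_eq_square)
  moreover have "inj_on g {0<..<1}"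
    by (auto simp: inj_on_def g_def field_simps)
  ultimately show ?thesis
    using has_absolute_integral_change_of_variables_1'[of "{0<..<1}" g g' f] integral_unique[OF I] img
    by auto
qed

text \<open>The range is split at s = 1, where a backward jump crosses the origin. Below 1 the
  integral is \<open>has_integral_regularised_Beta_01\<close>; above 1 the power part is a Beta
  integral after inversion, and the constant part contributes \<open>- 1 / (\<alpha> - 1)\<close>,
  which cancels the same term from below 1.\<close>

lemma absolutely_integrable_backward_kernel:
  fixes \<alpha> \<nu> :: real
  assumes "1 < \<alpha>" "\<alpha> < 2" "0 < \<nu>" "\<nu> < \<alpha>"
  defines "f \<equiv> \<lambda>s. (sgn (1 - s) * \<bar>1 - s\<bar> powr (\<nu> - 1) - 1) * s powr (- \<alpha>)"
  shows "f absolutely_integrable_on {0<..} \<and>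
     integral {0<..} f = (1 - \<nu> / (\<alpha> - 1)) * Beta (2 - \<alpha>) \<nu> - Beta (\<alpha> - \<nu>) \<nu>"
proof -
  define h where "h s = ((1 - s) powr (\<nu> - 1) - 1) * s powr (- \<alpha>)" for s :: real
  have I1: "(f has_integral (1 / (\<alpha> - 1) + (1 - \<nu> / (\<alpha> - 1)) * Beta (2 - \<alpha>) \<nu>)) {0<..<1}"
    using has_integral_regularised_Beta_01[OF assms(1-3)] unfolding has_integral_Icc_iff_Ioo
    by (rule has_integral_eq[rotated]) (auto simp: f_def)
  have A1: "f absolutely_integrable_on {0<..<1}"
  proof (rule absolutely_integrable_onI_sign)
    show "(\<forall>s\<in>{0<..<1}. 0 \<le> f s) \<or> (\<forall>s\<in>{0<..<1}. f s \<le> 0)"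
    proof (cases "\<nu> \<ge> 1")
      case True
      have "(1 - s) powr (\<nu> - 1) \<le> 1" if "s \<in> {0<..<1}" for s
        using True that by (intro powr_le1) auto
      then show ?thesis by (auto simp: f_def mult_nonpos_nonneg)
    next
      case False
      have "(1 - s) powr (\<nu> - 1) \<ge> 1" if "s \<in> {0<..<1}" for s
        using False that powr_mono'[of "\<nu> - 1" 0 "1 - s"] by simp
      then show ?thesis by (auto simp: f_def)
    qed
  qed (use I1 in auto)

  define g where "g t = 1 / t" for t :: real
  define g' where "g' t = - 1 / t^2" for t :: real
  \<comment> \<open>The substitution s = 1 / t maps the half-line beyond 1 onto the unit interval
    and p to the integrand of \<open>Beta (\<alpha> - \<nu>) \<nu>\<close>.\<close>
  define p where "p s = (s - 1) powr (\<nu> - 1) * s powr (- \<alpha>)" for s :: real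
  have img: "g ` {0<..<1} = {1<..}"
  proof (intro equalityI subsetI)
    fix s :: real assume "s \<in> {1<..}"
    then show "s \<in> g ` {0<..<1}"
      by (intro image_eqI[of _ _ "1 / s"]) (auto simp: g_def field_simps)
  qed (auto simp: g_def)
  have eq: "\<bar>g' t\<bar> * p (g t) = t powr (\<alpha> - \<nu> - 1) * (1 - t) powr (\<nu> - 1)"
    if "t \<in> {0<..<1}" for t
  proof -
    have "1 / t - 1 = (1 - t) / t"
      using that by (simp add: field_simps)
    then show ?thesis
      using that by (simp add: g_def g'_def p_def powr_divide powr_minus powr_diff field_simps power2_eq_square)
        (simp add: powr_add algebra_simps)
  qed
  have I: "((\<lambda>t. \<bar>g' t\<bar> * p (g t)) has_integral Beta (\<alpha> - \<nu>) \<nu>) {0<..<1}"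
    using has_integral_Beta_real[of "\<alpha> - \<nu>" \<nu>] assms unfolding has_integral_Icc_iff_Ioo
    by (subst has_integral_cong[OF eq]) auto
  have "(\<lambda>t. \<bar>g' t\<bar> * p (g t)) absolutely_integrable_on {0<..<1}"
    using I by (intro nonnegative_absolutely_integrable_1) (auto simp: p_def)
  moreover have "(g has_field_derivative g' t) (at t within {0<..<1})" if "t \<in> {0<..<1}" for t
    unfolding g_def g'_def using that
    by (auto intro!: derivative_eq_intros simp: field_simps power2_eq_square)
  moreover have "inj_on g {0<..<1}"
    by (auto simp: inj_on_def g_def field_simps)
  ultimately have p: "p absolutely_integrable_on {1<..} \<and> integral {1<..} p = Beta (\<alpha> - \<nu>) \<nu>"
    using has_absolute_integral_change_of_variables_1'[of "{0<..<1}" g g' p] integral_unique[OF I] img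
    by auto
  have "((\<lambda>s. s powr (- \<alpha>)) has_integral 1 / (\<alpha> - 1)) {1..}"
    using has_integral_powr_to_inf[of "- \<alpha>" 1] assms(1) minus_divide_right[of 1 "1 - \<alpha>"] by simp
  then have q: "((\<lambda>s. s powr (- \<alpha>)) has_integral 1 / (\<alpha> - 1)) {1<..}"
    by (rule has_integral_spike_set_eq[THEN iffD1, rotated 2])
       (auto intro: negligible_subset[of "{1}"])
  have "((\<lambda>s. - p s - s powr (- \<alpha>)) has_integral (- Beta (\<alpha> - \<nu>) \<nu> - 1 / (\<alpha> - 1))) {1<..}"
    using p q by (intro has_integral_diff has_integral_neg)
      (auto simp: absolutely_integrable_on_def has_integral_integral)
  then have I2: "(f has_integral (- Beta (\<alpha> - \<nu>) \<nu> - 1 / (\<alpha> - 1))) {1<..}"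
    by (rule has_integral_eq[rotated]) (auto simp: f_def p_def field_simps)
  have "f s \<le> 0" if "s \<in> {1<..}" for s
  proof -
    have "0 \<le> (s - 1) powr (\<nu> - 1)" by simp
    then have "- ((s - 1) powr (\<nu> - 1)) - 1 \<le> 0" by linarith
    then show ?thesis using that by (auto simp: f_def intro!: mult_nonpos_nonneg)
  qed
  then have A2: "f absolutely_integrable_on {1<..}"
    using I2 by (intro absolutely_integrable_onI_sign) auto
  have A: "f absolutely_integrable_on ({0<..<1} \<union> {1<..})"
    by (rule absolutely_integrable_Un[OF A1 A2]) 
  have I: "(f has_integral (1 - \<nu> / (\<alpha> - 1)) * Beta (2 - \<alpha>) \<nu> - Beta (\<alpha> - \<nu>) \<nu>) ({0<..<1} \<union> {1<..})"
  proof -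
    have "{0<..<1} \<inter> {1<..} = ({} :: real set)" by auto
    then show ?thesis using has_integral_Un[OF I1 I2] by simp
  qed
  have n: "negligible {s \<in> ({0<..<1} \<union> {1<..}) - {0<..}. f s \<noteq> 0}"
          "negligible {s \<in> {0<..} - ({0<..<1} \<union> {1<..}). f s \<noteq> 0}"
    by (auto intro: negligible_subset[of "{1::real}"])
  show ?thesis
    using absolutely_integrable_spike_set[OF A n] has_integral_spike_set_eq[OF n] I
    by (auto intro: integral_unique)
qed

lemma absolutely_integrable_on_imp_lborel:
  fixes f :: "real \<Rightarrow> real"
  assumes "f absolutely_integrable_on S" "f \<in> borel_measurable borel" "S \<in> sets borel"
  shows "set_integrable lborel S f" "(LINT x:S|lborel. f x) = integral S f"
proof -
  show *: "set_integrable lborel S f"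
    using assms integrable_completion[of "\<lambda>x. indicator S x *\<^sub>R f x" lborel]
    by (simp add: set_integrable_def)
  show "(LINT x:S|lborel. f x) = integral S f"
    using set_borel_integral_eq_integral(2)[OF *] .
qed

section \<open>The right-hand side of the exponent equation: kernel integral, closed form, sign and
  end points\<close>

definition nu_rhs :: "real \<Rightarrow> real \<Rightarrow> real" where
  "nu_rhs \<alpha> \<nu> = (\<nu> - 1) * Gamma (1 - \<alpha>) * Gamma (\<alpha> - \<nu>) / Gamma (2 - \<nu>)
       + Gamma \<nu> * ((1 - \<alpha> + \<nu>) * Gamma (1 - \<alpha>) / Gamma (2 - \<alpha> + \<nu>)
                     - Gamma (\<alpha> - \<nu>) / Gamma \<alpha>)"

lemma pos_notin_nonpos_Ints: "0 < x \<Longrightarrow> x \<notin> \<int>\<^sub>\<le>\<^sub>0" for x :: real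
  by (auto elim!: nonpos_Ints_cases)

lemma Gamma_two_minus:
  fixes \<alpha> :: real
  assumes "1 < \<alpha>" "\<alpha> < 2"
  shows "Gamma (2 - \<alpha>) = (1 - \<alpha>) * Gamma (1 - \<alpha>)"
proof -
  have "1 - \<alpha> \<notin> \<int>\<^sub>\<le>\<^sub>0"
  proof
    assume "1 - \<alpha> \<in> \<int>\<^sub>\<le>\<^sub>0"
    then obtain n where "1 - \<alpha> = of_int n" by (auto elim!: nonpos_Ints_cases)
    with assms have "-1 < n" "n < 0" by linarith+
    then show False by simp
  qed
  then show ?thesis using Gamma_plus1[of "1 - \<alpha>"] by (simp add: algebra_simps)
qed

text \<open>Here the equation for the critical exponent meets the jump integrals: the left-hand side
  is the forward integral minus the backward one, and \<open>Gamma_two_minus\<close> brings its Beta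
  functions to the form with \<open>Gamma (1 - \<alpha>)\<close>.\<close>

lemma nu_rhs_Beta:
  assumes "1 < \<alpha>" "\<alpha> < 2" "0 < \<nu>" "\<nu> < \<alpha>"
  shows "(\<nu> - 1) / (\<alpha> - 1) * Beta (2 - \<alpha>) (\<alpha> - \<nu>)
    - ((1 - \<nu> / (\<alpha> - 1)) * Beta (2 - \<alpha>) \<nu> - Beta (\<alpha> - \<nu>) \<nu>) = - nu_rhs \<alpha> \<nu>"
proof -
  have "Gamma (2 - \<nu>) > 0" "Gamma (2 - \<alpha> + \<nu>) > 0" "Gamma \<alpha> > 0"
    using assms by (auto intro!: Gamma_real_pos)
  then show ?thesis
    using assms by (simp add: Beta_def nu_rhs_def Gamma_two_minus divide_simps) (simp add: algebra_simps)
qed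

lemma sin_half_pos_cos_half_neg:
  fixes \<alpha> :: real
  assumes "1 < \<alpha>" "\<alpha> < 2"
  shows "sin (pi * \<alpha> / 2) > 0" "cos (pi * \<alpha> / 2) < 0"
proof -
  have *: "sin A > 0 \<and> cos A < 0" if "pi / 2 < A" "A < pi" for A :: real
    using that sin_gt_zero[of A] cos_gt_zero_pi[of "pi - A"] pi_gt_zero by auto
  have "pi / 2 < pi * \<alpha> / 2" "pi * \<alpha> / 2 < pi"
    using assms by simp_all
  from *[OF this] show "sin (pi * \<alpha> / 2) > 0" "cos (pi * \<alpha> / 2) < 0"
    by auto
qed

text \<open>The reflection formula turns the Gamma quotients into sines, and sum-to-product rules
  collapse the three sines into one product. In this form the zero at \<alpha> - 1 and the behaviour
  at 0 and at \<alpha> can be read off.\<close>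

lemma nu_rhs_trig:
  assumes "1 < \<alpha>" "\<alpha> < 2" "0 < \<nu>" "\<nu> < \<alpha>"
  shows "nu_rhs \<alpha> \<nu> =
    - 2 * Gamma \<nu> * Gamma (\<alpha> - \<nu>) * cos (pi * (\<alpha> - \<nu>) / 2) * sin (pi * \<nu> / 2) / (Gamma \<alpha> * sin (pi * \<alpha> / 2))"
proof -
  have refl: "rGamma z * rGamma (1 - z) = sin (pi * z) / pi" for z :: real
  proof -
    have "complex_of_real (rGamma z * rGamma (1 - z)) = complex_of_real (sin (pi * z) / pi)"
      using rGamma_reflection_complex[of "complex_of_real z"]
      by (simp add: rGamma_complex_of_real[symmetric] sin_of_real[symmetric])
    then show ?thesis by (simp only: of_real_eq_iff)
  qed
  have pos: "Gamma \<nu> > 0" "Gamma (\<alpha> - \<nu>) > 0" "Gamma \<alpha> > 0"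
    using assms by (auto intro!: Gamma_real_pos)
  have r: "rGamma z = inverse (Gamma z)" for z :: real
    by (rule rGamma_inverse_Gamma)
  \<comment> \<open>The entire function \<open>rGamma\<close> also covers \<nu> = 1, where
    \<open>Gamma (1 - \<nu>)\<close> has a pole.\<close>
  have "(\<nu> - 1) / Gamma (2 - \<nu>) = - ((1 - \<nu>) * rGamma (2 - \<nu>))"
    unfolding r by (simp add: divide_inverse algebra_simps)
  also have "\<dots> = - rGamma (1 - \<nu>)"
    using rGamma_plus1[of "1 - \<nu>"] by simp
  also have "rGamma (1 - \<nu>) = Gamma \<nu> * (rGamma \<nu> * rGamma (1 - \<nu>))"
    using pos by (simp add: r[of \<nu>])
  finally have a: "(\<nu> - 1) / Gamma (2 - \<nu>) = - Gamma \<nu> * sin (pi * \<nu>) / pi"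
    unfolding refl by simp
  have "(1 - \<alpha> + \<nu>) / Gamma (2 - \<alpha> + \<nu>) = (1 - \<alpha> + \<nu>) * rGamma (1 - \<alpha> + \<nu> + 1)"
    unfolding r by (simp add: divide_inverse algebra_simps)
  also have "\<dots> = rGamma (1 - (\<alpha> - \<nu>))"
    using rGamma_plus1[of "1 - \<alpha> + \<nu>"] by (simp add: algebra_simps)
  also have "\<dots> = Gamma (\<alpha> - \<nu>) * (rGamma (\<alpha> - \<nu>) * rGamma (1 - (\<alpha> - \<nu>)))"
    using pos by (simp add: r[of "\<alpha> - \<nu>"])
  finally have b: "(1 - \<alpha> + \<nu>) / Gamma (2 - \<alpha> + \<nu>) = Gamma (\<alpha> - \<nu>) * sin (pi * (\<alpha> - \<nu>)) / pi"
    unfolding refl by simp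
  define A where "A = pi * \<alpha> / 2"
  define N where "N = pi * \<nu> / 2"
  have sA: "sin A > 0" "cos A < 0"
    unfolding A_def using sin_half_pos_cos_half_neg[OF assms(1,2)] by auto
  have sa: "sin (pi * \<alpha>) = 2 * sin A * cos A" "sin (pi * \<nu>) = 2 * sin N * cos N"
     "sin (pi * (\<alpha> - \<nu>)) = 2 * sin (A - N) * cos (A - N)"
    using sin_double[of A] sin_double[of N] sin_double[of "A - N"] by (simp_all add: A_def N_def algebra_simps)
  have "Gamma (1 - \<alpha>) \<noteq> 0"
    using Gamma_two_minus[OF assms(1,2)] Gamma_real_pos[of "2 - \<alpha>"] assms by auto
  then have c: "Gamma (1 - \<alpha>) = pi / (2 * sin A * cos A * Gamma \<alpha>)"
    using refl[of \<alpha>] pos sA by (simp add: r sa field_simps)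
  have "nu_rhs \<alpha> \<nu> = Gamma (1 - \<alpha>) * Gamma (\<alpha> - \<nu>) * ((\<nu> - 1) / Gamma (2 - \<nu>))
     + Gamma \<nu> * (Gamma (1 - \<alpha>) * ((1 - \<alpha> + \<nu>) / Gamma (2 - \<alpha> + \<nu>)) - Gamma (\<alpha> - \<nu>) / Gamma \<alpha>)"
    by (simp add: nu_rhs_def mult.commute mult.left_commute)
  also have "\<dots> = Gamma \<nu> * Gamma (\<alpha> - \<nu>) / (Gamma \<alpha> * (sin A * cos A)) *
      (sin (A - N) * cos (A - N) - sin N * cos N - sin A * cos A)"
    unfolding a b c sa using pos sA by (simp add: divide_simps) (simp add: algebra_simps)
  \<comment> \<open>Two uses of the difference formula for sines produce a factor
    \<open>cos A\<close>, which cancels the one in the denominator.\<close>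
  also have "sin (A - N) * cos (A - N) - sin N * cos N - sin A * cos A = - 2 * cos A * cos (A - N) * sin N"
  proof -
    have *: "(2 * (A - N) - 2 * N) / 2 = A - 2 * N" "(2 * (A - N) + 2 * N) / 2 = A"
      by (simp_all add: field_simps)
    have "sin (2 * (A - N)) - sin (2 * N) = 2 * (sin (A - 2 * N) * cos A)"
      unfolding sin_diff_sin * by (simp only: mult.assoc)
    then have "sin (A - N) * cos (A - N) - sin N * cos N = sin (A - 2 * N) * cos A"
      unfolding sin_double by linarith
    then have "sin (A - N) * cos (A - N) - sin N * cos N - sin A * cos A = (sin (A - 2 * N) - sin A) * cos A"
      by (simp add: left_diff_distrib)
    also have "sin (A - 2 * N) - sin A = - (2 * sin N * cos (A - N))"
    proof -
      have *: "(A - 2 * N - A) / 2 = - N" "(A - 2 * N + A) / 2 = A - N"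
        by (simp_all add: field_simps)
      show ?thesis unfolding sin_diff_sin * by simp
    qed
    finally show ?thesis by simp
  qed
  finally have *: "nu_rhs \<alpha> \<nu> = Gamma \<nu> * Gamma (\<alpha> - \<nu>) / (Gamma \<alpha> * (sin A * cos A)) *
      (- 2 * cos A * cos (A - N) * sin N)" .
  have e: "pi * (\<alpha> - \<nu>) / 2 = A - N" "pi * \<nu> / 2 = N" "pi * \<alpha> / 2 = A"
    by (simp_all add: A_def N_def right_diff_distrib diff_divide_distrib)
  have "cos A \<noteq> 0" using sA by simp
  then show ?thesis
    unfolding * e by simp
qed

text \<open>The derivative in s of \<open>((1 + s) powr \<nu> - 1) / \<nu> - s\<close>: the change
  of the power under an outward jump of relative size s, without its linear part.\<close>

definition forward_kernel :: "real \<Rightarrow> real \<Rightarrow> real" where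
  "forward_kernel \<nu> s = (1 + s) powr (\<nu> - 1) - 1"

text \<open>The derivative in s of \<open>(1 - \<bar>1 - s\<bar> powr \<nu>) / \<nu> - s\<close>.
  The sign flips at s = 1, because a longer backward jump overshoots the origin and increases the
  distance again.\<close>

definition backward_kernel :: "real \<Rightarrow> real \<Rightarrow> real" where
  "backward_kernel \<nu> s = sgn (1 - s) * \<bar>1 - s\<bar> powr (\<nu> - 1) - 1"

lemma measurable_kernels [measurable]:
  "forward_kernel \<nu> \<in> borel_measurable borel" "backward_kernel \<nu> \<in> borel_measurable borel"
  unfolding forward_kernel_def[abs_def] backward_kernel_def[abs_def] by measurable

lemma kernel_integrals:
  assumes "1 < \<alpha>" "\<alpha> < 2" "0 < \<nu>" "\<nu> < \<alpha>"
  shows "set_integrable lborel {0<..} (\<lambda>s. forward_kernel \<nu> s * s powr (- \<alpha>))"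
    "set_integrable lborel {0<..} (\<lambda>s. backward_kernel \<nu> s * s powr (- \<alpha>))"
    "(LINT s:{0<..}|lborel. forward_kernel \<nu> s * s powr (- \<alpha>))
      - (LINT s:{0<..}|lborel. backward_kernel \<nu> s * s powr (- \<alpha>)) = - nu_rhs \<alpha> \<nu>"
proof -
  note f = absolutely_integrable_forward_kernel[OF assms, folded forward_kernel_def]
  note b = absolutely_integrable_backward_kernel[OF assms, folded backward_kernel_def]
  show "set_integrable lborel {0<..} (\<lambda>s. forward_kernel \<nu> s * s powr (- \<alpha>))"
    using f by (intro absolutely_integrable_on_imp_lborel) auto
  show "set_integrable lborel {0<..} (\<lambda>s. backward_kernel \<nu> s * s powr (- \<alpha>))"
    using b by (intro absolutely_integrable_on_imp_lborel) auto
  show "(LINT s:{0<..}|lborel. forward_kernel \<nu> s * s powr (- \<alpha>))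
      - (LINT s:{0<..}|lborel. backward_kernel \<nu> s * s powr (- \<alpha>)) = - nu_rhs \<alpha> \<nu>"
    using f b nu_rhs_Beta[OF assms] by (simp add: absolutely_integrable_on_imp_lborel(2))
qed

text \<open>The sign is opposite to that of the cosine in \<open>nu_rhs_trig\<close>, whose argument
  passes \<open>pi / 2\<close> at \<nu> = \<alpha> - 1. With negligible drift this makes \<alpha> -
  1 the critical exponent, hence the moment threshold 1 - 1/\<alpha>.\<close>

lemma nu_rhs_sign:
  assumes "1 < \<alpha>" "\<alpha> < 2" "0 < \<nu>" "\<nu> < \<alpha>"
  shows "\<nu> < \<alpha> - 1 \<Longrightarrow> nu_rhs \<alpha> \<nu> > 0" "\<nu> > \<alpha> - 1 \<Longrightarrow> nu_rhs \<alpha> \<nu> < 0"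
proof -
  have pos: "Gamma \<nu> > 0" "Gamma (\<alpha> - \<nu>) > 0" "Gamma \<alpha> > 0"
    using assms by (auto intro!: Gamma_real_pos)
  have "pi * \<nu> / 2 < pi" using assms by simp
  then have sin: "sin (pi * \<alpha> / 2) > 0" "sin (pi * \<nu> / 2) > 0"
    using assms sin_gt_zero[of "pi * \<nu> / 2"] sin_half_pos_cos_half_neg by simp_all
  define k where "k = 2 * Gamma \<nu> * Gamma (\<alpha> - \<nu>) * sin (pi * \<nu> / 2) / (Gamma \<alpha> * sin (pi * \<alpha> / 2))"
  have k: "k > 0"
    unfolding k_def by (intro divide_pos_pos mult_pos_pos pos sin) simp
  have eq: "nu_rhs \<alpha> \<nu> = - (k * cos (pi * (\<alpha> - \<nu>) / 2))"
    unfolding nu_rhs_trig[OF assms] k_def by simp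
  show "nu_rhs \<alpha> \<nu> > 0" if "\<nu> < \<alpha> - 1"
    using sin_half_pos_cos_half_neg(2)[of "\<alpha> - \<nu>"] that assms k by (simp add: eq mult_pos_neg)
  show "nu_rhs \<alpha> \<nu> < 0" if "\<nu> > \<alpha> - 1"
  proof -
    have "0 < pi * (\<alpha> - \<nu>) / 2" "pi * (\<alpha> - \<nu>) / 2 < pi / 2"
      using that assms by simp_all
    then have "cos (pi * (\<alpha> - \<nu>) / 2) > 0"
      using pi_gt_zero by (intro cos_gt_zero_pi) linarith+
    then show ?thesis using k by (simp add: eq)
  qed
qed

lemma continuous_on_nu_rhs:
  assumes "1 < \<alpha>" "\<alpha> < 2"
  shows "continuous_on {0<..<\<alpha>} (nu_rhs \<alpha>)"
proof -
  have "Gamma \<alpha> \<noteq> 0" using assms by (metis Gamma_real_pos less_irrefl less_trans zero_less_one)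
  then have "continuous_on {0<..<\<alpha>} (\<lambda>\<nu>. - 2 * Gamma \<nu> * Gamma (\<alpha> - \<nu>) * cos (pi * (\<alpha> - \<nu>) / 2)
      * sin (pi * \<nu> / 2) / (Gamma \<alpha> * sin (pi * \<alpha> / 2)))"
    using sin_half_pos_cos_half_neg[OF assms]
    by (intro continuous_intros continuous_on_compose2[OF continuous_on_Gamma[of "{0<..}"]])
       (auto elim!: nonpos_Ints_cases)
  then show ?thesis
    by (rule continuous_on_cong[THEN iffD1, rotated 2]) (use nu_rhs_trig[OF assms] in auto)
qed

text \<open>The pole of \<open>Gamma \<nu>\<close> at 0 cancels against the zero of the sine. The
  limit explains the cotangent in the hypothesis of the critical regime: that hypothesis says that
  \<open>b - c * nu_rhs \<alpha> \<nu>\<close> is negative for small \<nu>.\<close>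

lemma tendsto_nu_rhs_0:
  assumes "1 < \<alpha>" "\<alpha> < 2"
  shows "(nu_rhs \<alpha> \<longlongrightarrow> - (pi * cot (pi * \<alpha> / 2))) (at_right 0)"
proof -
  have pos: "Gamma \<alpha> \<noteq> 0" using assms by (metis Gamma_real_pos less_irrefl less_trans zero_less_one)
  have G: "isCont Gamma x" if "x > 0" for x :: real
    using that by (intro isCont_Gamma[OF continuous_ident]) (auto elim!: nonpos_Ints_cases)
  have lim: "((\<lambda>\<nu>::real. Gamma (1 + \<nu>)) \<longlongrightarrow> Gamma 1) (at_right 0)" "((\<lambda>\<nu>. Gamma (\<alpha> - \<nu>)) \<longlongrightarrow> Gamma \<alpha>) (at_right 0)"
  proof -
    have "((\<lambda>\<nu>::real. 1 + \<nu>) \<longlongrightarrow> 1) (at_right 0)" "((\<lambda>\<nu>. \<alpha> - \<nu>) \<longlongrightarrow> \<alpha>) (at_right 0)"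
      using tendsto_add[OF tendsto_const[of "1::real"] tendsto_ident_at[of "0::real" "{0<..}"]]
        tendsto_diff[OF tendsto_const[of \<alpha>] tendsto_ident_at[of "0::real" "{0<..}"]] by simp_all
    from isCont_tendsto_compose[OF G this(1)] isCont_tendsto_compose[OF G this(2)]
    show "((\<lambda>\<nu>::real. Gamma (1 + \<nu>)) \<longlongrightarrow> Gamma 1) (at_right 0)"
      "((\<lambda>\<nu>. Gamma (\<alpha> - \<nu>)) \<longlongrightarrow> Gamma \<alpha>) (at_right 0)"
      using assms by simp_all
  qed
  have "((\<lambda>\<nu>. - 2 * (Gamma (1 + \<nu>) * (sin (pi * \<nu> / 2) / \<nu>)) * Gamma (\<alpha> - \<nu>) * cos (pi * (\<alpha> - \<nu>) / 2)
      / (Gamma \<alpha> * sin (pi * \<alpha> / 2))) \<longlongrightarrow>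
      - 2 * (Gamma 1 * (pi / 2)) * Gamma \<alpha> * cos (pi * (\<alpha> - 0) / 2) / (Gamma \<alpha> * sin (pi * \<alpha> / 2))) (at_right 0)"
  proof -
    have "((\<lambda>\<nu>. sin (pi * \<nu> / 2) / \<nu>) \<longlongrightarrow> pi / 2) (at_right 0)"
      by real_asymp
    note L = tendsto_mult[OF tendsto_mult[OF tendsto_const[of "-2"] tendsto_mult[OF lim(1) this]] lim(2)]
    have C: "((\<lambda>\<nu>. cos (pi * (\<alpha> - \<nu>) / 2)) \<longlongrightarrow> cos (pi * (\<alpha> - 0) / 2)) (at_right 0)"
      by (intro tendsto_intros) auto
    have "Gamma \<alpha> * sin (pi * \<alpha> / 2) \<noteq> 0"
      using pos sin_half_pos_cos_half_neg[OF assms] by simp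
    from tendsto_divide[OF tendsto_mult[OF L C] tendsto_const this] show ?thesis
      by simp
  qed
  moreover have "- 2 * (Gamma 1 * (pi / 2)) * Gamma \<alpha> * cos (pi * (\<alpha> - 0) / 2) / (Gamma \<alpha> * sin (pi * \<alpha> / 2))
      = - (pi * cot (pi * \<alpha> / 2))"
    using pos by (simp add: cot_def)
  moreover have "eventually (\<lambda>\<nu>. - 2 * (Gamma (1 + \<nu>) * (sin (pi * \<nu> / 2) / \<nu>)) * Gamma (\<alpha> - \<nu>) * cos (pi * (\<alpha> - \<nu>) / 2)
      / (Gamma \<alpha> * sin (pi * \<alpha> / 2)) = nu_rhs \<alpha> \<nu>) (at_right 0)"
  proof (rule eventually_at_rightI[of 0 1])
    fix \<nu> :: real assume n: "\<nu> \<in> {0<..<1}"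
    then have "Gamma (1 + \<nu>) = \<nu> * Gamma \<nu>"
      using Gamma_plus1[of \<nu>] pos_notin_nonpos_Ints[of \<nu>] by (simp add: add.commute)
    then show "- 2 * (Gamma (1 + \<nu>) * (sin (pi * \<nu> / 2) / \<nu>)) * Gamma (\<alpha> - \<nu>) * cos (pi * (\<alpha> - \<nu>) / 2)
      / (Gamma \<alpha> * sin (pi * \<alpha> / 2)) = nu_rhs \<alpha> \<nu>"
      using n assms by (simp add: nu_rhs_trig)
  qed auto
  ultimately show ?thesis
    by (simp add: filterlim_cong[OF refl refl] Lim_transform_eventually)
qed

text \<open>The pole of \<open>Gamma (\<alpha> - \<nu>)\<close> dominates: the other factors,
  together with \<open>Gamma (1 + (\<alpha> - \<nu>))\<close>, tend to -2.\<close>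

lemma filterlim_nu_rhs_at_left:
  assumes "1 < \<alpha>" "\<alpha> < 2"
  shows "filterlim (nu_rhs \<alpha>) at_bot (at_left \<alpha>)"
proof -
  have pos: "Gamma \<alpha> \<noteq> 0" using assms by (metis Gamma_real_pos less_irrefl less_trans zero_less_one)
  have G: "isCont Gamma x" if "x > 0" for x :: real
    using that by (intro isCont_Gamma[OF continuous_ident]) (auto elim!: nonpos_Ints_cases)
  have "((\<lambda>\<nu>. - 2 * Gamma (1 + (\<alpha> - \<nu>)) * Gamma \<nu> * cos (pi * (\<alpha> - \<nu>) / 2) * sin (pi * \<nu> / 2)
      / (Gamma \<alpha> * sin (pi * \<alpha> / 2))) \<longlongrightarrow>
      - 2 * Gamma (1 + (\<alpha> - \<alpha>)) * Gamma \<alpha> * cos (pi * (\<alpha> - \<alpha>) / 2) * sin (pi * \<alpha> / 2)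
      / (Gamma \<alpha> * sin (pi * \<alpha> / 2))) (at_left \<alpha>)"
    proof -
    have 1: "((\<lambda>\<nu>. Gamma (1 + (\<alpha> - \<nu>))) \<longlongrightarrow> Gamma (1 + (\<alpha> - \<alpha>))) (at_left \<alpha>)"
      by (rule isCont_tendsto_compose[OF G]) (simp, intro tendsto_intros)
    have 2: "(Gamma \<longlongrightarrow> Gamma \<alpha>) (at_left \<alpha>)"
      by (rule isCont_tendsto_compose[OF G]) (use assms in simp, intro tendsto_intros)
    have 3: "((\<lambda>\<nu>. cos (pi * (\<alpha> - \<nu>) / 2)) \<longlongrightarrow> cos (pi * (\<alpha> - \<alpha>) / 2)) (at_left \<alpha>)"
      by (intro tendsto_intros) simp
    have 4: "((\<lambda>\<nu>. sin (pi * \<nu> / 2)) \<longlongrightarrow> sin (pi * \<alpha> / 2)) (at_left \<alpha>)"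
      by (intro tendsto_intros) simp
    have 5: "Gamma \<alpha> * sin (pi * \<alpha> / 2) \<noteq> 0"
      using pos sin_half_pos_cos_half_neg[OF assms] by simp
    show ?thesis
      by (rule tendsto_divide[OF tendsto_mult[OF tendsto_mult[OF tendsto_mult[OF tendsto_mult[OF
            tendsto_const 1] 2] 3] 4] tendsto_const 5])
  qed
  then have T1: "((\<lambda>\<nu>. - 2 * Gamma (1 + (\<alpha> - \<nu>)) * Gamma \<nu> * cos (pi * (\<alpha> - \<nu>) / 2) * sin (pi * \<nu> / 2)
      / (Gamma \<alpha> * sin (pi * \<alpha> / 2))) \<longlongrightarrow> -2) (at_left \<alpha>)"
    using pos sin_half_pos_cos_half_neg[OF assms] by simp
  have T2: "filterlim (\<lambda>\<nu>. 1 / (\<alpha> - \<nu>)) at_top (at_left \<alpha>)"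
    by real_asymp
  have "filterlim (\<lambda>\<nu>. (- 2 * Gamma (1 + (\<alpha> - \<nu>)) * Gamma \<nu> * cos (pi * (\<alpha> - \<nu>) / 2) * sin (pi * \<nu> / 2)
      / (Gamma \<alpha> * sin (pi * \<alpha> / 2))) * (1 / (\<alpha> - \<nu>))) at_bot (at_left \<alpha>)"
    by (rule filterlim_tendsto_neg_mult_at_bot[OF T1 _ T2]) simp
  moreover have "eventually (\<lambda>\<nu>. (- 2 * Gamma (1 + (\<alpha> - \<nu>)) * Gamma \<nu> * cos (pi * (\<alpha> - \<nu>) / 2) * sin (pi * \<nu> / 2)
      / (Gamma \<alpha> * sin (pi * \<alpha> / 2))) * (1 / (\<alpha> - \<nu>)) = nu_rhs \<alpha> \<nu>) (at_left \<alpha>)"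
  proof (rule eventually_at_leftI[of 0])
    fix \<nu> :: real assume n: "\<nu> \<in> {0<..<\<alpha>}"
    then have "\<alpha> - \<nu> \<notin> \<int>\<^sub>\<le>\<^sub>0"
      by (intro pos_notin_nonpos_Ints) auto
    then have "Gamma (1 + (\<alpha> - \<nu>)) = (\<alpha> - \<nu>) * Gamma (\<alpha> - \<nu>)"
      using Gamma_plus1[of "\<alpha> - \<nu>"] by (simp add: add.commute)
    then show "(- 2 * Gamma (1 + (\<alpha> - \<nu>)) * Gamma \<nu> * cos (pi * (\<alpha> - \<nu>) / 2) * sin (pi * \<nu> / 2)
      / (Gamma \<alpha> * sin (pi * \<alpha> / 2))) * (1 / (\<alpha> - \<nu>)) = nu_rhs \<alpha> \<nu>"
      using n assms by (simp add: nu_rhs_trig)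
  qed (use assms in auto)
  ultimately show ?thesis
    by (rule filterlim_cong[OF refl refl, THEN iffD1, rotated])
qed

section \<open>Moments of a jump in terms of its tails\<close>

text \<open>Fubini on the region 0 < s < T. As k may be signed, joint integrability is obtained from
  the integrals of the norms.\<close>

lemma layer_cake_integral:
  fixes T :: "'a \<Rightarrow> real" and k :: "real \<Rightarrow> real"
  assumes "prob_space N" and [measurable]: "T \<in> borel_measurable N" "k \<in> borel_measurable borel"
    and int: "set_integrable lborel {0<..} (\<lambda>s. k s * measure N {\<omega> \<in> space N. T \<omega> > s})"
  shows "integrable N (\<lambda>\<omega>. LINT s:{0<..<T \<omega>}|lborel. k s)"
    "(\<integral>\<omega>. (LINT s:{0<..<T \<omega>}|lborel. k s) \<partial>N) =
       (LINT s:{0<..}|lborel. k s * measure N {\<omega> \<in> space N. T \<omega> > s})"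
proof -
  interpret prob_space N by fact
  interpret P: pair_sigma_finite lborel N by unfold_locales
  define f where "f s \<omega> = (if 0 < s \<and> s < T \<omega> then k s else 0)" for s \<omega>
  have [measurable]: "case_prod f \<in> borel_measurable (lborel \<Otimes>\<^sub>M N)"
    unfolding f_def by measurable
  have [simp]: "{\<omega> \<in> space N. s < T \<omega>} \<in> sets N" for s
    by measurable
  have f_alt: "f s \<omega> = indicator {0<..} s * k s * indicator {\<omega> \<in> space N. T \<omega> > s} \<omega>" if "\<omega> \<in> space N" for s \<omega>
    using that by (auto simp: f_def indicator_def)
  have I: "integrable N (f s)" for s
    by (subst Bochner_Integration.integrable_cong[OF refl f_alt])
      (auto intro!: integrable_mult_right integrable_real_indicator simp: less_top[symmetric])
  have A: "(\<integral>\<omega>. f s \<omega> \<partial>N) = indicator {0<..} s * (k s * measure N {\<omega> \<in> space N. T \<omega> > s})"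
    and B: "(\<integral>\<omega>. norm (f s \<omega>) \<partial>N) = norm (indicator {0<..} s * (k s * measure N {\<omega> \<in> space N. T \<omega> > s}))" for s
  proof -
    show "(\<integral>\<omega>. f s \<omega> \<partial>N) = indicator {0<..} s * (k s * measure N {\<omega> \<in> space N. T \<omega> > s})"
      by (subst Bochner_Integration.integral_cong[OF refl f_alt]) (auto simp: mult_ac)
    have "(\<integral>\<omega>. norm (f s \<omega>) \<partial>N) = (\<integral>\<omega>. norm (indicator {0<..} s * k s) * indicator {\<omega> \<in> space N. T \<omega> > s} \<omega> \<partial>N)"
      by (rule Bochner_Integration.integral_cong) (auto simp: f_alt abs_mult)
    then show "(\<integral>\<omega>. norm (f s \<omega>) \<partial>N) = norm (indicator {0<..} s * (k s * measure N {\<omega> \<in> space N. T \<omega> > s}))"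
      by (simp add: abs_mult)
  qed
  have F: "integrable (lborel \<Otimes>\<^sub>M N) (case_prod f)"
  proof (rule P.Fubini_integrable)
    show "integrable lborel (\<lambda>s. \<integral>\<omega>. norm (case (s, \<omega>) of (s, \<omega>) \<Rightarrow> f s \<omega>) \<partial>N)"
      using int unfolding set_integrable_def by (simp add: B[simplified] del: abs_mult)
  qed (use I in auto)
  have eq: "(\<integral>s. f s \<omega> \<partial>lborel) = (LINT s:{0<..<T \<omega>}|lborel. k s)" for \<omega>
    unfolding set_lebesgue_integral_def f_def
    by (rule Bochner_Integration.integral_cong) (auto simp: indicator_def)
  show "integrable N (\<lambda>\<omega>. LINT s:{0<..<T \<omega>}|lborel. k s)"
    using P.integrable_snd[OF F] by (simp add: eq)
  show "(\<integral>\<omega>. (LINT s:{0<..<T \<omega>}|lborel. k s) \<partial>N) =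
       (LINT s:{0<..}|lborel. k s * measure N {\<omega> \<in> space N. T \<omega> > s})"
    using P.Fubini_integral[OF F] by (simp add: eq A set_lebesgue_integral_def)
qed

lemma forward_kernel_integral:
  assumes "0 < \<nu>" "0 \<le> t"
  shows "(LINT s:{0<..<t}|lborel. forward_kernel \<nu> s) = ((1 + t) powr \<nu> - 1) / \<nu> - t"
proof -
  have I: "(forward_kernel \<nu> has_integral (((1 + t) powr \<nu> / \<nu> - t) - ((1 + 0) powr \<nu> / \<nu> - 0))) {0..t}"
    unfolding forward_kernel_def[abs_def] using assms
    by (intro fundamental_theorem_of_calculus)
      (auto intro!: derivative_eq_intros simp flip: has_real_derivative_iff_has_vector_derivative)
  then have I: "(forward_kernel \<nu> has_integral (((1 + t) powr \<nu> - 1) / \<nu> - t)) {0<..<t}"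
    by (simp add: has_integral_Icc_iff_Ioo diff_divide_distrib algebra_simps)
  have "continuous_on {0..t} (forward_kernel \<nu>)"
    unfolding forward_kernel_def[abs_def] using assms by (intro continuous_intros) auto
  then have "set_integrable lborel {0..t} (forward_kernel \<nu>)"
    by (rule borel_integrable_atLeastAtMost')
  then have "set_integrable lborel {0<..<t} (forward_kernel \<nu>)"
    by (rule set_integrable_subset) auto
  from set_borel_integral_eq_integral(2)[OF this] show ?thesis
    using integral_unique[OF I] by simp
qed

text \<open>For \<nu> < 1 the kernel is singular at 1, where it also changes sign. The primitive F
  is continuous there and gives the value; integrability has to be shown separately.\<close>

lemma backward_kernel_integral:
  assumes "0 < \<nu>" "0 \<le> t"
  shows "(LINT s:{0<..<t}|lborel. backward_kernel \<nu> s) = (1 - \<bar>1 - t\<bar> powr \<nu>) / \<nu> - t"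
proof -
  define F where "F s = - (\<bar>1 - s\<bar> powr \<nu> / \<nu>)" for s :: real
  have cont: "continuous_on A F" for A
    unfolding F_def using assms by (intro continuous_intros continuous_on_powr') auto
  have der: "(F has_vector_derivative (sgn (1 - s) * \<bar>1 - s\<bar> powr (\<nu> - 1))) (at s)" if "s \<noteq> 1" for s
  proof -
    have "(F has_real_derivative sgn (1 - s) * \<bar>1 - s\<bar> powr (\<nu> - 1)) (at s)"
    proof (cases "s < 1")
      case True
      have "((\<lambda>s. - ((1 - s) powr \<nu> / \<nu>)) has_real_derivative (1 - s) powr (\<nu> - 1)) (at s)"
        using True assms by (auto intro!: derivative_eq_intros)
      then have "(F has_real_derivative (1 - s) powr (\<nu> - 1)) (at s)"
        by (rule has_field_derivative_transform_within_open[where S = "{..<1}"])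
          (use True in \<open>auto simp: F_def\<close>)
      then show ?thesis using True by simp
    next
      case False
      have "((\<lambda>s. - ((s - 1) powr \<nu> / \<nu>)) has_real_derivative - ((s - 1) powr (\<nu> - 1))) (at s)"
        using False that assms by (auto intro!: derivative_eq_intros)
      then have "(F has_real_derivative - ((s - 1) powr (\<nu> - 1))) (at s)"
        by (rule has_field_derivative_transform_within_open[where S = "{1<..}"])
          (use False that in \<open>auto simp: F_def\<close>)
      then show ?thesis using False that by simp
    qed
    then show ?thesis by (simp add: has_real_derivative_iff_has_vector_derivative)
  qed
  \<comment> \<open>A continuous primitive of the absolute value of the singular part, which
    therefore is Lebesgue integrable.\<close>
  define G where "G s = (max 0 (s - 1)) powr \<nu> / \<nu> - (max 0 (1 - s)) powr \<nu> / \<nu>" for s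
  have "continuous_on {0..t} G"
    unfolding G_def using assms by (intro continuous_intros continuous_on_powr') auto
  have "((\<lambda>s. \<bar>1 - s\<bar> powr (\<nu> - 1)) has_integral (G t - G 0)) {0..t}"
  proof (rule fundamental_theorem_of_calculus_interior_strong[of "{1}"])
    fix s assume s: "s \<in> {0<..<t} - {1}"
    show "(G has_vector_derivative \<bar>1 - s\<bar> powr (\<nu> - 1)) (at s)"
    proof (cases "s < 1")
      case True
      have "(G has_vector_derivative sgn (1 - s) * \<bar>1 - s\<bar> powr (\<nu> - 1)) (at s)"
        by (rule has_vector_derivative_transform_within_open[OF der, where S = "{..<1}"])
          (use True in \<open>auto simp: F_def G_def\<close>)
      then show ?thesis using True by simp
    next
      case False
      then have "s > 1" using s by auto
      then have "(G has_vector_derivative - (sgn (1 - s) * \<bar>1 - s\<bar> powr (\<nu> - 1))) (at s)"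
        by (intro has_vector_derivative_transform_within_open[OF has_vector_derivative_minus[OF der], where S = "{1<..}"])
          (auto simp: F_def G_def)
      then show ?thesis using \<open>s > 1\<close> by simp
    qed
  qed (use assms \<open>continuous_on {0..t} G\<close> in auto)
  then have "(\<lambda>s. \<bar>1 - s\<bar> powr (\<nu> - 1)) absolutely_integrable_on {0..t}"
    by (intro nonnegative_absolutely_integrable_1) auto
  then have "set_integrable lborel {0..t} (\<lambda>s. \<bar>1 - s\<bar> powr (\<nu> - 1))"
    by (rule absolutely_integrable_on_imp_lborel) auto
  then have "set_integrable lborel {0..t} (\<lambda>s. sgn (1 - s) * \<bar>1 - s\<bar> powr (\<nu> - 1))"
    unfolding set_integrable_def
    by (rule Bochner_Integration.integrable_bound) (auto simp: abs_mult sgn_if indicator_def)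
  moreover have "set_integrable lborel {0..t} (\<lambda>s. 1 :: real)"
    by (intro borel_integrable_atLeastAtMost') auto
  ultimately have "set_integrable lborel {0..t} (backward_kernel \<nu>)"
    unfolding backward_kernel_def[abs_def] by (rule set_integral_diff)
  then have S: "set_integrable lborel {0<..<t} (backward_kernel \<nu>)"
    by (rule set_integrable_subset) auto
  have "((\<lambda>s. sgn (1 - s) * \<bar>1 - s\<bar> powr (\<nu> - 1)) has_integral F t - F 0) {0..t}"
    by (rule fundamental_theorem_of_calculus_interior_strong[of "{1}"]) (use assms der cont in auto)
  moreover have "((\<lambda>s. 1 :: real) has_integral t) {0..t}"
    using has_integral_const_real[of "1::real" 0 t] assms by simp
  ultimately have "(backward_kernel \<nu> has_integral F t - F 0 - t) {0..t}"
    unfolding backward_kernel_def[abs_def] by (rule has_integral_diff)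
  then have "(backward_kernel \<nu> has_integral F t - F 0 - t) {0<..<t}"
    by (simp add: has_integral_Icc_iff_Ioo)
  from integral_unique[OF this] show ?thesis
    using set_borel_integral_eq_integral(2)[OF S] by (simp add: F_def diff_divide_distrib)
qed

text \<open>An increment of the power is its linear part plus \<nu> times a kernel integral up to
  the jump size, so taking means turns the jump law into its two tails.\<close>

lemma moment_expansion:
  fixes T :: "'a \<Rightarrow> real"
  assumes "prob_space N" and T [measurable]: "T \<in> borel_measurable N" and "0 < \<nu>" and "integrable N T"
    and f: "set_integrable lborel {0<..} (\<lambda>s. forward_kernel \<nu> s * measure N {\<omega> \<in> space N. T \<omega> > s})"
    and b: "set_integrable lborel {0<..} (\<lambda>s. backward_kernel \<nu> s * measure N {\<omega> \<in> space N. - T \<omega> > s})"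
  shows "integrable N (\<lambda>\<omega>. \<bar>1 + T \<omega>\<bar> powr \<nu>)"
    "(\<integral>\<omega>. \<bar>1 + T \<omega>\<bar> powr \<nu> \<partial>N) - 1 - \<nu> * (\<integral>\<omega>. T \<omega> \<partial>N) =
       \<nu> * ((LINT s:{0<..}|lborel. forward_kernel \<nu> s * measure N {\<omega> \<in> space N. T \<omega> > s}) -
            (LINT s:{0<..}|lborel. backward_kernel \<nu> s * measure N {\<omega> \<in> space N. - T \<omega> > s}))"
proof -
  interpret prob_space N by fact
  define A where "A \<omega> = (LINT s:{0<..<T \<omega>}|lborel. forward_kernel \<nu> s)" for \<omega>
  define B where "B \<omega> = (LINT s:{0<..<- T \<omega>}|lborel. backward_kernel \<nu> s)" for \<omega>
  \<comment> \<open>At each point at least one of the intervals behind A and B is empty, according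
    to the sign of the jump.\<close>
  have eq: "\<bar>1 + T \<omega>\<bar> powr \<nu> = 1 + \<nu> * T \<omega> + \<nu> * A \<omega> - \<nu> * B \<omega>" for \<omega>
  proof (cases "T \<omega> \<ge> 0")
    case True
    then have "{0<..<- T \<omega>} = {}" by auto
    then have "B \<omega> = 0" by (simp add: B_def set_lebesgue_integral_def)
    moreover have "A \<omega> = ((1 + T \<omega>) powr \<nu> - 1) / \<nu> - T \<omega>"
      unfolding A_def by (rule forward_kernel_integral[OF \<open>0 < \<nu>\<close> True])
    ultimately show ?thesis using True \<open>0 < \<nu>\<close> by (simp add: field_simps)
  next
    case False
    then have "{0<..<T \<omega>} = {}" by auto
    then have "A \<omega> = 0" by (simp add: A_def set_lebesgue_integral_def)
    moreover have "B \<omega> = (1 - \<bar>1 + T \<omega>\<bar> powr \<nu>) / \<nu> + T \<omega>"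
      unfolding B_def using backward_kernel_integral[OF \<open>0 < \<nu>\<close>, of "- T \<omega>"] False by simp
    ultimately show ?thesis using \<open>0 < \<nu>\<close> by (simp add: field_simps)
  qed
  have [measurable]: "(\<lambda>\<omega>. - T \<omega>) \<in> borel_measurable N" by measurable
  note F = layer_cake_integral[OF \<open>prob_space N\<close> T _ f, folded A_def, simplified]
  note G = layer_cake_integral[OF \<open>prob_space N\<close> _ _ b, folded B_def, simplified]
  show "integrable N (\<lambda>\<omega>. \<bar>1 + T \<omega>\<bar> powr \<nu>)"
    unfolding eq using F(1) G(1) \<open>integrable N T\<close> by simp
  show "(\<integral>\<omega>. \<bar>1 + T \<omega>\<bar> powr \<nu> \<partial>N) - 1 - \<nu> * (\<integral>\<omega>. T \<omega> \<partial>N) =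
       \<nu> * ((LINT s:{0<..}|lborel. forward_kernel \<nu> s * measure N {\<omega> \<in> space N. T \<omega> > s}) -
            (LINT s:{0<..}|lborel. backward_kernel \<nu> s * measure N {\<omega> \<in> space N. - T \<omega> > s}))"
    unfolding eq using F G \<open>integrable N T\<close> by (simp add: prob_space right_diff_distrib)
qed

lemma set_integrable_min_powr:
  fixes \<alpha> C :: real
  assumes "1 < \<alpha>" "0 \<le> C"
  shows "set_integrable lborel {0<..} (\<lambda>s. min 1 (C * s powr (- \<alpha>)))"
proof -
  have "((\<lambda>s. s powr (- \<alpha>)) has_integral - (1 powr (- \<alpha> + 1)) / (- \<alpha> + 1)) {1..}"
    using assms by (intro has_integral_powr_to_inf) auto
  then have "(\<lambda>s. s powr (- \<alpha>)) absolutely_integrable_on {1..}"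
    by (intro nonnegative_absolutely_integrable_1) auto
  then have "set_integrable lborel {1..} (\<lambda>s. s powr (- \<alpha>))"
    by (rule absolutely_integrable_on_imp_lborel) auto
  then have "integrable lborel (\<lambda>s. indicator {0..1} s + C * (indicator {1..} s * s powr (- \<alpha>)))"
    unfolding set_integrable_def by (intro Bochner_Integration.integrable_add integrable_mult_right) auto
  then show ?thesis
    unfolding set_integrable_def
  proof (rule Bochner_Integration.integrable_bound)
    have "norm (indicator {0<..} s *\<^sub>R min 1 (C * s powr (- \<alpha>)))
        \<le> norm (indicator {0..1} s + C * (indicator {1..} s * s powr (- \<alpha>)))" for s :: real
    proof -
      have "0 \<le> C * s powr (- \<alpha>)" using assms by simp
      then show ?thesis by (cases "s \<le> 1"; cases "s < 1") (auto simp: indicator_def)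
    qed
    then show "AE s in lborel. norm (indicator {0<..} s *\<^sub>R min 1 (C * s powr (- \<alpha>)))
        \<le> norm (indicator {0..1} s + C * (indicator {1..} s * s powr (- \<alpha>)))"
      by auto
  qed measurable
qed

section \<open>Asymptotics of one step from a distant starting point\<close>

definition to_infinity_in :: "real set \<Rightarrow> real filter" where
  "to_infinity_in X = inf at_infinity (principal X)"

lemma eventually_to_infinity_in:
  "eventually Q (to_infinity_in X) \<longleftrightarrow> (\<exists>a. \<forall>x\<in>X. \<bar>x\<bar> > a \<longrightarrow> Q x)"
proof -
  have "eventually Q (to_infinity_in X) \<longleftrightarrow> (\<exists>a. \<forall>x. \<bar>x\<bar> \<ge> a \<longrightarrow> x \<in> X \<longrightarrow> Q x)"
    by (simp add: to_infinity_in_def eventually_inf_principal eventually_at_infinity)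
  also have "\<dots> \<longleftrightarrow> (\<exists>a. \<forall>x\<in>X. \<bar>x\<bar> > a \<longrightarrow> Q x)"
    by (meson dual_order.strict_trans1 gt_ex less_le_trans less_imp_le linorder_not_le)
  finally show ?thesis .
qed

text \<open>Dominated convergence is a statement about sequences; this reduces limits along the
  state space to it, with all terms already beyond a given radius a.\<close>

lemma tendsto_to_infinity_in_sequentially:
  fixes f :: "real \<Rightarrow> real"
  assumes "\<And>x. (\<And>n. x n \<in> X) \<Longrightarrow> (\<And>n. \<bar>x n\<bar> > a) \<Longrightarrow> filterlim (\<lambda>n. \<bar>x n\<bar>) at_top sequentially
    \<Longrightarrow> (\<lambda>n. f (x n)) \<longlonglongrightarrow> l"
  shows "(f \<longlongrightarrow> l) (to_infinity_in X)"
proof (rule ccontr)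
  assume "\<not> ?thesis"
  then obtain e where e: "e > 0" and "\<not> eventually (\<lambda>x. dist (f x) l < e) (to_infinity_in X)"
    unfolding tendsto_iff by blast
  then have "\<forall>n. \<exists>x\<in>X. \<bar>x\<bar> > max a (real n) \<and> \<not> dist (f x) l < e"
    unfolding eventually_to_infinity_in by metis
  then obtain x where x: "\<And>n. x n \<in> X" "\<And>n. \<bar>x n\<bar> > max a (real n)" "\<And>n. \<not> dist (f (x n)) l < e"
    by metis
  have "filterlim (\<lambda>n. \<bar>x n\<bar>) at_top sequentially"
    by (rule filterlim_at_top_mono[OF filterlim_real_sequentially]) (use x(2) in \<open>auto intro!: always_eventually less_imp_le\<close>)
  with assms[of x] x(1,2) have "(\<lambda>n. f (x n)) \<longlonglongrightarrow> l" by auto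
  with e x(3) show False
    unfolding tendsto_iff by (auto dest!: spec[of _ e] simp: eventually_sequentially)
qed

text \<open>Only the one-step law enters the analysis; \<open>Tbal_imp_heavy_tailed_kernel\<close>
  supplies this locale from the process itself.\<close>

locale heavy_tailed_kernel =
  fixes X :: "real set" and K :: "real \<Rightarrow> real measure" and \<alpha> c x0 :: real
  assumes K: "K \<in> measurable borel (prob_algebra borel)"
    and \<alpha>: "1 < \<alpha>" "\<alpha> < 2" and c: "0 < c"
    and tail: "\<And>\<epsilon>. 0 < \<epsilon> \<Longrightarrow> \<exists>Y. \<forall>y\<ge>Y. \<forall>x\<in>X. \<bar>x\<bar> \<ge> x0 \<longrightarrow>
        \<bar>y powr \<alpha> * measure (K x) {z. z - x > y} - c\<bar> \<le> \<epsilon> \<and>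
        \<bar>y powr \<alpha> * measure (K x) {z. x - z > y} - c\<bar> \<le> \<epsilon>"
begin

lemma prob_space_K: "prob_space (K x)" and sets_K [measurable_cong, simp]: "sets (K x) = sets borel"
  using measurable_space[OF K, of x] by (auto simp: space_prob_algebra)

lemma space_K [simp]: "space (K x) = UNIV"
  using sets_eq_imp_space_eq[OF sets_K] by simp

definition drift_K :: "real \<Rightarrow> real" where
  "drift_K x = (\<integral>z. z - x \<partial>K x)"

text \<open>Dividing by x makes the quantity scale free: \<open>moment_ratio \<nu> x - 1\<close> is
  the relative mean change of \<open>(\<bar>x\<bar> / y) powr \<nu>\<close> for every scale y >
  0.\<close>

definition moment_ratio :: "real \<Rightarrow> real \<Rightarrow> real" where
  "moment_ratio \<nu> x = (\<integral>z. \<bar>z / x\<bar> powr \<nu> \<partial>K x)"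

lemma measurable_tail:
  fixes T :: "real \<Rightarrow> real"
  assumes [measurable]: "T \<in> borel_measurable borel"
  shows "(\<lambda>s. measure (K x) {z. s < T z}) \<in> borel_measurable borel"
proof -
  interpret prob_space "K x" by (rule prob_space_K)
  have "mono (\<lambda>s. - measure (K x) {z. s < T z})"
    by (intro monoI) (auto intro!: finite_measure_mono)
  from borel_measurable_mono[OF this] show ?thesis by (subst (asm) borel_measurable_uminus_eq)
qed

text \<open>A dominating function must cover all y > 0, while \<open>tail\<close> speaks of large y
  only. For the remaining y a probability is at most 1 and \<open>y powr \<alpha>\<close> is
  bounded.\<close>

lemma tail_bound:
  obtains C where "C > 0" "\<And>x y. x \<in> X \<Longrightarrow> \<bar>x\<bar> \<ge> x0 \<Longrightarrow> y > 0 \<Longrightarrow>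
        y powr \<alpha> * measure (K x) {z. z - x > y} \<le> C \<and> y powr \<alpha> * measure (K x) {z. x - z > y} \<le> C"
proof -
  obtain Y where Y: "\<forall>y\<ge>Y. \<forall>x\<in>X. \<bar>x\<bar> \<ge> x0 \<longrightarrow>
        \<bar>y powr \<alpha> * measure (K x) {z. z - x > y} - c\<bar> \<le> 1 \<and>
        \<bar>y powr \<alpha> * measure (K x) {z. x - z > y} - c\<bar> \<le> 1"
    using tail[of 1] by auto
  have small: "y powr \<alpha> * measure (K x) S \<le> \<bar>Y\<bar> powr \<alpha>" if "0 < y" "y < Y" for x y S
  proof -
    interpret prob_space "K x" by (rule prob_space_K)
    have "y powr \<alpha> * measure (K x) S \<le> \<bar>Y\<bar> powr \<alpha> * 1"
      using that \<alpha> by (intro mult_mono powr_mono2) auto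
    then show ?thesis by simp
  qed
  have "c + 1 + \<bar>Y\<bar> powr \<alpha> > 0"
    using c by (intro add_pos_nonneg) auto
  moreover have "y powr \<alpha> * measure (K x) {z. z - x > y} \<le> c + 1 + \<bar>Y\<bar> powr \<alpha> \<and>
      y powr \<alpha> * measure (K x) {z. x - z > y} \<le> c + 1 + \<bar>Y\<bar> powr \<alpha>"
    if "x \<in> X" "\<bar>x\<bar> \<ge> x0" "y > 0" for x y
  proof (cases "y \<ge> Y")
    case True
    then have "\<bar>y powr \<alpha> * measure (K x) {z. z - x > y} - c\<bar> \<le> 1 \<and>
        \<bar>y powr \<alpha> * measure (K x) {z. x - z > y} - c\<bar> \<le> 1"
      using Y that by blast
    moreover have "0 \<le> \<bar>Y\<bar> powr \<alpha>" by simp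
    ultimately show ?thesis by linarith
  next
    case False
    then show ?thesis
      using small[of y] that c by (intro conjI) (force intro: order_trans)+
  qed
  ultimately show ?thesis using that by blast
qed

text \<open>The rescaled increment \<open>z / x - 1\<close> treats positive and negative starting points alike: its
  positive part is the increment away from the origin.\<close>

lemma tail_rescaled:
  fixes x s :: real
  assumes "x \<noteq> 0"
  shows "{z. z / x - 1 > s} = (if x > 0 then {z. z - x > \<bar>x\<bar> * s} else {z. x - z > \<bar>x\<bar> * s})"
    and "{z. - (z / x - 1) > s} = (if x > 0 then {z. x - z > \<bar>x\<bar> * s} else {z. z - x > \<bar>x\<bar> * s})"
proof -
  have *: "z / x - 1 = (z - x) / x" for z using assms by (simp add: diff_divide_distrib)
  show "{z. z / x - 1 > s} = (if x > 0 then {z. z - x > \<bar>x\<bar> * s} else {z. x - z > \<bar>x\<bar> * s})"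
    "{z. - (z / x - 1) > s} = (if x > 0 then {z. x - z > \<bar>x\<bar> * s} else {z. z - x > \<bar>x\<bar> * s})"
    unfolding * minus_divide_left using assms
    by (auto simp: pos_less_divide_eq neg_less_divide_eq algebra_simps)
qed

text \<open>A relative jump s from \<open>x n\<close> is an absolute jump of size
  \<open>\<bar>x n\<bar> * s\<close>. Threshold and starting point thus move together, which is
  where the uniformity in x of \<open>tail\<close> is used.\<close>

lemma rescaled_tail_limit:
  assumes x: "\<And>n. x n \<in> X" "\<And>n. \<bar>x n\<bar> > max 0 x0" "filterlim (\<lambda>n. \<bar>x n\<bar>) at_top sequentially" and "s > 0"
  shows "(\<lambda>n. \<bar>x n\<bar> powr \<alpha> * measure (K (x n)) {z. z / x n - 1 > s}) \<longlonglongrightarrow> c * s powr (- \<alpha>)"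
    "(\<lambda>n. \<bar>x n\<bar> powr \<alpha> * measure (K (x n)) {z. - (z / x n - 1) > s}) \<longlonglongrightarrow> c * s powr (- \<alpha>)"
proof -
  define p where "p n = measure (K (x n)) {z. z / x n - 1 > s}" for n
  define m where "m n = measure (K (x n)) {z. - (z / x n - 1) > s}" for n
  have nz: "x n \<noteq> 0" for n using x(2)[of n] by auto
  have "(\<lambda>n. (\<bar>x n\<bar> * s) powr \<alpha> * p n) \<longlonglongrightarrow> c \<and> (\<lambda>n. (\<bar>x n\<bar> * s) powr \<alpha> * m n) \<longlonglongrightarrow> c"
    unfolding tendsto_iff
  proof safe
    fix e :: real assume "e > 0"
    then obtain Y where Y: "\<forall>y\<ge>Y. \<forall>x\<in>X. \<bar>x\<bar> \<ge> x0 \<longrightarrow>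
        \<bar>y powr \<alpha> * measure (K x) {z. z - x > y} - c\<bar> \<le> e / 2 \<and>
        \<bar>y powr \<alpha> * measure (K x) {z. x - z > y} - c\<bar> \<le> e / 2"
      using tail[of "e / 2"] by auto
    have "eventually (\<lambda>n. \<bar>x n\<bar> \<ge> Y / s) sequentially"
      using x(3) by (simp add: filterlim_at_top)
    then have "eventually (\<lambda>n. dist ((\<bar>x n\<bar> * s) powr \<alpha> * p n) c < e \<and> dist ((\<bar>x n\<bar> * s) powr \<alpha> * m n) c < e) sequentially"
    proof eventually_elim
      case (elim n)
      then have "Y \<le> \<bar>x n\<bar> * s" using \<open>s > 0\<close> by (simp add: field_simps)
      moreover have "x0 \<le> \<bar>x n\<bar>" using x(2)[of n] by simp
      ultimately have "\<bar>(\<bar>x n\<bar> * s) powr \<alpha> * measure (K (x n)) {z. z - x n > \<bar>x n\<bar> * s} - c\<bar> \<le> e / 2 \<and>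
        \<bar>(\<bar>x n\<bar> * s) powr \<alpha> * measure (K (x n)) {z. x n - z > \<bar>x n\<bar> * s} - c\<bar> \<le> e / 2"
        using Y x(1) by blast
      then show ?case
        unfolding p_def m_def tail_rescaled[OF nz] dist_real_def using \<open>e > 0\<close> by (auto split: if_splits)
    qed
    then show "eventually (\<lambda>n. dist ((\<bar>x n\<bar> * s) powr \<alpha> * p n) c < e) sequentially"
      "eventually (\<lambda>n. dist ((\<bar>x n\<bar> * s) powr \<alpha> * m n) c < e) sequentially"
      by (auto elim: eventually_mono)
  qed
  from tendsto_mult[OF conjunct1[OF this] tendsto_const[of "s powr (- \<alpha>)"]]
    tendsto_mult[OF conjunct2[OF this] tendsto_const[of "s powr (- \<alpha>)"]]
  show "(\<lambda>n. \<bar>x n\<bar> powr \<alpha> * p n) \<longlonglongrightarrow> c * s powr (- \<alpha>)" "(\<lambda>n. \<bar>x n\<bar> powr \<alpha> * m n) \<longlonglongrightarrow> c * s powr (- \<alpha>)"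
    using \<open>s > 0\<close> by (simp_all add: powr_mult powr_minus field_simps)
qed

lemma integrable_increment:
  assumes "x \<in> X" "\<bar>x\<bar> \<ge> x0"
  shows "integrable (K x) (\<lambda>z. z - x)"
proof -
  obtain C where C: "C > 0" "\<And>y. y > 0 \<Longrightarrow>
        y powr \<alpha> * measure (K x) {z. z - x > y} \<le> C \<and> y powr \<alpha> * measure (K x) {z. x - z > y} \<le> C"
    using tail_bound assms by metis
  interpret prob_space "K x" by (rule prob_space_K)
  have le: "measure (K x) S \<le> min 1 (C * s powr (- \<alpha>))" 
    if "s powr \<alpha> * measure (K x) S \<le> C" "s > 0" for s S
    using that by (auto simp: powr_minus field_simps)
  have I: "integrable (K x) (\<lambda>z. LINT s:{0<..<T z}|lborel. 1 :: real)"
    if [measurable]: "T \<in> borel_measurable borel" and T: "\<And>s. s > 0 \<Longrightarrow> s powr \<alpha> * measure (K x) {z. T z > s} \<le> C" for T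
  proof (rule layer_cake_integral(1))
    show "set_integrable lborel {0<..} (\<lambda>s. 1 * measure (K x) {z \<in> space (K x). s < T z})"
      using set_integrable_min_powr[OF \<alpha>(1) less_imp_le[OF C(1)]]
      unfolding set_integrable_def
    proof (rule Bochner_Integration.integrable_bound)
      have "measure (K x) {z. s < T z} \<le> \<bar>min 1 (C * s powr (- \<alpha>))\<bar>" if "s > 0" for s
        using le[OF T[OF that] that] by linarith
      then show "AE s in lborel. norm (indicator {0<..} s *\<^sub>R (1 * measure (K x) {z \<in> space (K x). s < T z}))
          \<le> norm (indicator {0<..} s *\<^sub>R min 1 (C * s powr (- \<alpha>)))"
        by (intro AE_I2) (auto simp: indicator_def)
    qed measurable
  qed (auto intro: prob_space_K)
  have eq: "(LINT s:{0<..<t}|lborel. 1 :: real) = max 0 t" for t :: real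
    by (cases "t \<ge> 0") (simp_all add: set_lebesgue_integral_def)
  have "integrable (K x) (\<lambda>z. max 0 (z - x) - max 0 (x - z))"
    using I[of "\<lambda>z. z - x"] I[of "\<lambda>z. x - z"] C(2) unfolding eq by (intro Bochner_Integration.integrable_diff) auto
  also have "(\<lambda>z. max 0 (z - x) - max 0 (x - z)) = (\<lambda>z. z - x)" by auto
  finally show ?thesis .
qed

lemma moment_ratio_expansion:
  assumes \<nu>: "0 < \<nu>" "\<nu> < \<alpha>" and x: "x \<in> X" "\<bar>x\<bar> \<ge> x0" "x \<noteq> 0"
  shows "integrable (K x) (\<lambda>z. \<bar>z / x\<bar> powr \<nu>)"
    "moment_ratio \<nu> x - 1 - \<nu> * (drift_K x / x) =
      \<nu> * ((LINT s:{0<..}|lborel. forward_kernel \<nu> s * measure (K x) {z. z / x - 1 > s}) -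
           (LINT s:{0<..}|lborel. backward_kernel \<nu> s * measure (K x) {z. - (z / x - 1) > s}))"
proof -
  obtain C where C: "C > 0" "\<And>y. y > 0 \<Longrightarrow>
        y powr \<alpha> * measure (K x) {z. z - x > y} \<le> C \<and> y powr \<alpha> * measure (K x) {z. x - z > y} \<le> C"
    using tail_bound x by metis
  have T: "measure (K x) {z. z / x - 1 > s} \<le> C * \<bar>x\<bar> powr (- \<alpha>) * s powr (- \<alpha>)"
    "measure (K x) {z. - (z / x - 1) > s} \<le> C * \<bar>x\<bar> powr (- \<alpha>) * s powr (- \<alpha>)" if "s > 0" for s
  proof -
    have "P \<le> C * \<bar>x\<bar> powr (- \<alpha>) * s powr (- \<alpha>)" if "(\<bar>x\<bar> * s) powr \<alpha> * P \<le> C" for P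
      using that \<open>s > 0\<close> x(3) by (simp add: powr_minus powr_mult field_simps)
    then show "measure (K x) {z. z / x - 1 > s} \<le> C * \<bar>x\<bar> powr (- \<alpha>) * s powr (- \<alpha>)"
      "measure (K x) {z. - (z / x - 1) > s} \<le> C * \<bar>x\<bar> powr (- \<alpha>) * s powr (- \<alpha>)"
      unfolding tail_rescaled[OF x(3)] using C(2)[of "\<bar>x\<bar> * s"] \<open>s > 0\<close> x(3) by auto
  qed
  have S: "set_integrable lborel {0<..} (\<lambda>s. k s * measure (K x) (S s))"
    if k: "set_integrable lborel {0<..} (\<lambda>s. k s * s powr (- \<alpha>))" and [measurable]: "k \<in> borel_measurable borel"
      "(\<lambda>s. measure (K x) (S s)) \<in> borel_measurable borel"
      and le: "\<And>s. s > 0 \<Longrightarrow> measure (K x) (S s) \<le> C * \<bar>x\<bar> powr (- \<alpha>) * s powr (- \<alpha>)" for k S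
  proof -
    have "set_integrable lborel {0<..} (\<lambda>s. (C * \<bar>x\<bar> powr (- \<alpha>)) * (k s * s powr (- \<alpha>)))"
      using k by (intro set_integrable_mult_right) auto
    then show ?thesis
      unfolding set_integrable_def
    proof (rule Bochner_Integration.integrable_bound)
      show "AE s in lborel. norm (indicat_real {0<..} s *\<^sub>R (k s * measure (K x) (S s)))
         \<le> norm (indicat_real {0<..} s *\<^sub>R (C * \<bar>x\<bar> powr - \<alpha> * (k s * s powr - \<alpha>)))"
        using mult_left_mono[OF le abs_ge_zero] C(1) by (auto simp: indicator_def abs_mult mult_ac)
    qed measurable
  qed
  note [measurable] = measurable_tail
  have drift: "(\<integral>z. z / x - 1 \<partial>K x) = drift_K x / x" "integrable (K x) (\<lambda>z. z / x - 1)"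
  proof -
    have *: "z / x - 1 = (z - x) / x" for z using x(3) by (simp add: field_simps)
    show "(\<integral>z. z / x - 1 \<partial>K x) = drift_K x / x" "integrable (K x) (\<lambda>z. z / x - 1)"
      unfolding * drift_K_def using integrable_increment[OF x(1,2)] by simp_all
  qed
  note E = moment_expansion[OF prob_space_K, of "\<lambda>z. z / x - 1" x \<nu>, simplified space_K, OF _ \<nu>(1) drift(2)]
  have F: "set_integrable lborel {0<..} (\<lambda>s. forward_kernel \<nu> s * measure (K x) {z \<in> UNIV. z / x - 1 > s})"
    by (intro S kernel_integrals \<alpha> \<nu>) (use T in simp_all)
  have G: "set_integrable lborel {0<..} (\<lambda>s. backward_kernel \<nu> s * measure (K x) {z \<in> UNIV. - (z / x - 1) > s})"
    by (intro S kernel_integrals \<alpha> \<nu>) (use T in simp_all)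
  show "integrable (K x) (\<lambda>z. \<bar>z / x\<bar> powr \<nu>)"
    using E(1)[OF _ F G] by simp
  show "moment_ratio \<nu> x - 1 - \<nu> * (drift_K x / x) =
      \<nu> * ((LINT s:{0<..}|lborel. forward_kernel \<nu> s * measure (K x) {z. z / x - 1 > s}) -
           (LINT s:{0<..}|lborel. backward_kernel \<nu> s * measure (K x) {z. - (z / x - 1) > s}))"
    using E(2)[OF _ F G] by (simp add: moment_ratio_def drift(1))
qed

text \<open>\<open>moment_ratio_expansion\<close> multiplied by
  \<open>\<bar>x\<bar> powr \<alpha>\<close>, with dominated convergence in the relative jump size.
  The drift stays on the left, since its own order is not yet fixed.\<close>

lemma moment_ratio_limit:
  assumes \<nu>: "0 < \<nu>" "\<nu> < \<alpha>"
  shows "((\<lambda>x. \<bar>x\<bar> powr \<alpha> * (moment_ratio \<nu> x - 1) - \<nu> * (\<bar>x\<bar> powr \<alpha> * (drift_K x / x))) \<longlongrightarrow>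
     - (c * \<nu> * nu_rhs \<alpha> \<nu>)) (to_infinity_in X)"
proof (rule tendsto_to_infinity_in_sequentially[where a = "max 0 x0"])
  fix x assume x: "\<And>n. x n \<in> X" "\<And>n. \<bar>x n\<bar> > max 0 x0" "filterlim (\<lambda>n. \<bar>x n\<bar>) at_top sequentially"
  have nz: "x n \<noteq> 0" "\<bar>x n\<bar> \<ge> x0" for n using x(2)[of n] by auto
  obtain C where C: "C > 0" "\<And>x y. x \<in> X \<Longrightarrow> \<bar>x\<bar> \<ge> x0 \<Longrightarrow> y > 0 \<Longrightarrow>
        y powr \<alpha> * measure (K x) {z. z - x > y} \<le> C \<and> y powr \<alpha> * measure (K x) {z. x - z > y} \<le> C"
    using tail_bound by metis
  have T: "\<bar>x n\<bar> powr \<alpha> * measure (K (x n)) {z. z / x n - 1 > s} \<le> C * s powr (- \<alpha>)"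
    "\<bar>x n\<bar> powr \<alpha> * measure (K (x n)) {z. - (z / x n - 1) > s} \<le> C * s powr (- \<alpha>)" if "s > 0" for s n
  proof -
    have "\<bar>x n\<bar> powr \<alpha> * P \<le> C * s powr (- \<alpha>)" if "(\<bar>x n\<bar> * s) powr \<alpha> * P \<le> C" for P
      using that \<open>s > 0\<close> by (simp add: powr_minus powr_mult field_simps)
    then show "\<bar>x n\<bar> powr \<alpha> * measure (K (x n)) {z. z / x n - 1 > s} \<le> C * s powr (- \<alpha>)"
      "\<bar>x n\<bar> powr \<alpha> * measure (K (x n)) {z. - (z / x n - 1) > s} \<le> C * s powr (- \<alpha>)"
      unfolding tail_rescaled[OF nz(1)]
      using C(2)[OF x(1)[of n] nz(2), of "\<bar>x n\<bar> * s"] \<open>s > 0\<close> nz(1)[of n] by auto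
  qed
  \<comment> \<open>Stated for a general kernel k so as to serve both directions; the dominating
    function is C times the absolute value of \<open>k s * s powr (- \<alpha>)\<close>.\<close>
  have L: "(\<lambda>n. \<bar>x n\<bar> powr \<alpha> * (LINT s:{0<..}|lborel. k s * measure (K (x n)) (S n s)))
      \<longlonglongrightarrow> c * (LINT s:{0<..}|lborel. k s * s powr (- \<alpha>))"
    if k: "set_integrable lborel {0<..} (\<lambda>s. k s * s powr (- \<alpha>))" and [measurable]: "k \<in> borel_measurable borel"
      "\<And>n. (\<lambda>s. measure (K (x n)) (S n s)) \<in> borel_measurable borel"
      and lim: "\<And>s. s > 0 \<Longrightarrow> (\<lambda>n. \<bar>x n\<bar> powr \<alpha> * measure (K (x n)) (S n s)) \<longlonglongrightarrow> c * s powr (- \<alpha>)"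
      and le: "\<And>s n. s > 0 \<Longrightarrow> \<bar>x n\<bar> powr \<alpha> * measure (K (x n)) (S n s) \<le> C * s powr (- \<alpha>)" for k S
  proof -
    have "(\<lambda>n. LINT s|lborel. indicator {0<..} s * (k s * (\<bar>x n\<bar> powr \<alpha> * measure (K (x n)) (S n s))))
      \<longlonglongrightarrow> (LINT s|lborel. indicator {0<..} s * (k s * (c * s powr (- \<alpha>))))"
    proof (rule integral_dominated_convergence)
      show "integrable lborel (\<lambda>s. C * norm (indicator {0<..} s *\<^sub>R (k s * s powr (- \<alpha>))))"
        using k unfolding set_integrable_def by (intro integrable_mult_right integrable_norm)
      show "AE s in lborel. (\<lambda>n. indicator {0<..} s * (k s * (\<bar>x n\<bar> powr \<alpha> * measure (K (x n)) (S n s))))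
         \<longlonglongrightarrow> indicator {0<..} s * (k s * (c * s powr (- \<alpha>)))"
        using lim by (intro AE_I2) (auto simp: indicator_def intro!: tendsto_mult_left)
      show "AE s in lborel. norm (indicator {0<..} s * (k s * (\<bar>x n\<bar> powr \<alpha> * measure (K (x n)) (S n s))))
         \<le> C * norm (indicator {0<..} s *\<^sub>R (k s * s powr (- \<alpha>)))" for n
        using mult_left_mono[OF le abs_ge_zero] C(1) by (auto simp: indicator_def abs_mult mult_ac)
    qed measurable
    then show ?thesis
      unfolding set_lebesgue_integral_def by (simp add: mult_ac flip: integral_mult_right_zero)
  qed
  have F: "(\<lambda>n. \<bar>x n\<bar> powr \<alpha> * (LINT s:{0<..}|lborel. forward_kernel \<nu> s * measure (K (x n)) {z. z / x n - 1 > s}))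
      \<longlonglongrightarrow> c * (LINT s:{0<..}|lborel. forward_kernel \<nu> s * s powr (- \<alpha>))"
    by (intro L kernel_integrals \<alpha> \<nu> rescaled_tail_limit x T measurable_tail) auto
  have G: "(\<lambda>n. \<bar>x n\<bar> powr \<alpha> * (LINT s:{0<..}|lborel. backward_kernel \<nu> s * measure (K (x n)) {z. - (z / x n - 1) > s}))
      \<longlonglongrightarrow> c * (LINT s:{0<..}|lborel. backward_kernel \<nu> s * s powr (- \<alpha>))"
    by (intro L kernel_integrals \<alpha> \<nu> rescaled_tail_limit x T measurable_tail) auto
  have "(\<lambda>n. \<nu> * (\<bar>x n\<bar> powr \<alpha> * (LINT s:{0<..}|lborel. forward_kernel \<nu> s * measure (K (x n)) {z. z / x n - 1 > s})
       - \<bar>x n\<bar> powr \<alpha> * (LINT s:{0<..}|lborel. backward_kernel \<nu> s * measure (K (x n)) {z. - (z / x n - 1) > s})))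
    \<longlonglongrightarrow> \<nu> * (c * (LINT s:{0<..}|lborel. forward_kernel \<nu> s * s powr (- \<alpha>))
       - c * (LINT s:{0<..}|lborel. backward_kernel \<nu> s * s powr (- \<alpha>)))"
    by (intro tendsto_intros F G)
  also have "\<nu> * (c * (LINT s:{0<..}|lborel. forward_kernel \<nu> s * s powr (- \<alpha>))
       - c * (LINT s:{0<..}|lborel. backward_kernel \<nu> s * s powr (- \<alpha>))) = - (c * \<nu> * nu_rhs \<alpha> \<nu>)"
    unfolding right_diff_distrib[symmetric] kernel_integrals(3)[OF \<alpha> \<nu>] by simp
  also have "(\<lambda>n. \<nu> * (\<bar>x n\<bar> powr \<alpha> * (LINT s:{0<..}|lborel. forward_kernel \<nu> s * measure (K (x n)) {z. z / x n - 1 > s})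
       - \<bar>x n\<bar> powr \<alpha> * (LINT s:{0<..}|lborel. backward_kernel \<nu> s * measure (K (x n)) {z. - (z / x n - 1) > s})))
    = (\<lambda>n. \<bar>x n\<bar> powr \<alpha> * (moment_ratio \<nu> (x n) - 1) - \<nu> * (\<bar>x n\<bar> powr \<alpha> * (drift_K (x n) / x n)))"
  proof
    fix n
    show "\<nu> * (\<bar>x n\<bar> powr \<alpha> * (LINT s:{0<..}|lborel. forward_kernel \<nu> s * measure (K (x n)) {z. z / x n - 1 > s})
       - \<bar>x n\<bar> powr \<alpha> * (LINT s:{0<..}|lborel. backward_kernel \<nu> s * measure (K (x n)) {z. - (z / x n - 1) > s}))
      = \<bar>x n\<bar> powr \<alpha> * (moment_ratio \<nu> (x n) - 1) - \<nu> * (\<bar>x n\<bar> powr \<alpha> * (drift_K (x n) / x n))"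
      using arg_cong[OF moment_ratio_expansion(2)[OF \<nu> x(1) nz(2,1), of n], of "\<lambda>t. \<bar>x n\<bar> powr \<alpha> * t"]
      by (simp only: right_diff_distrib mult_1_right) (simp add: mult_ac)
  qed
  finally show "(\<lambda>n. \<bar>x n\<bar> powr \<alpha> * (moment_ratio \<nu> (x n) - 1) - \<nu> * (\<bar>x n\<bar> powr \<alpha> * (drift_K (x n) / x n)))
    \<longlonglongrightarrow> - (c * \<nu> * nu_rhs \<alpha> \<nu>)" .
qed

end

section \<open>Survival probabilities\<close>

text \<open>\<open>\<beta>\<close> and \<open>\<kappa>\<close> are kept abstract, so that the same
  survival bounds serve all three regimes.\<close>

locale killed_chain = heavy_tailed_kernel +
  fixes \<beta> :: real and \<kappa> :: "real \<Rightarrow> real"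
  assumes X_borel: "X \<in> sets borel"
    and X_closed: "\<And>x. x \<in> X \<Longrightarrow> emeasure (K x) (UNIV - X) = 0"
    and \<beta>: "0 < \<beta>"
    and ratio_limit: "\<And>\<nu>. 0 < \<nu> \<Longrightarrow> \<nu> < \<alpha> \<Longrightarrow>
      ((\<lambda>x. \<bar>x\<bar> powr \<beta> * (moment_ratio \<nu> x - 1)) \<longlongrightarrow> \<kappa> \<nu>) (to_infinity_in X)"
begin

text \<open>The cylinder constrains all times from 0 to n inclusive, which makes this the
  probability that the hitting time exceeds n. It is real valued so that test functions of either
  sign can be compared with it.\<close>

definition survival :: "real \<Rightarrow> nat \<Rightarrow> real \<Rightarrow> real" where
  "survival a n x = enn2real (cyl K (\<lambda>_. {z. \<bar>z\<bar> > a}) n x)"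

lemma measurable_cyl [measurable]: "cyl K (\<lambda>_. {z. \<bar>z\<bar> > a}) n \<in> borel_measurable borel"
proof (induction n)
  case (Suc n)
  have [measurable]: "K \<in> borel \<rightarrow>\<^sub>M subprob_algebra borel"
    using K by (rule measurable_prob_algebraD)
  note [measurable] = Suc
  have "(\<lambda>x. \<integral>\<^sup>+ y. cyl K (\<lambda>_. {z. \<bar>z\<bar> > a}) n y \<partial>K x) \<in> borel_measurable borel"
    by (rule nn_integral_measurable_subprob_algebra2[where N = borel]) measurable
  then show ?case by simp
qed simp

lemma cyl_le_1: "cyl K (\<lambda>_. {z. \<bar>z\<bar> > a}) n x \<le> 1"
proof (induction n arbitrary: x)
  case (Suc n)
  interpret prob_space "K x" by (rule prob_space_K)
  have "(\<integral>\<^sup>+ y. cyl K (\<lambda>_. {z. \<bar>z\<bar> > a}) n y \<partial>K x) \<le> (\<integral>\<^sup>+ y. 1 \<partial>K x)"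
    by (intro nn_integral_mono Suc)
  then show ?case
    using emeasure_space_1 by (auto simp: indicator_def)
qed (simp add: indicator_def)

lemma ennreal_survival: "ennreal (survival a n x) = cyl K (\<lambda>_. {z. \<bar>z\<bar> > a}) n x"
  unfolding survival_def using cyl_le_1[of a n x] by (intro ennreal_enn2real) (auto simp: less_top[symmetric] top_unique)

lemma measurable_survival [measurable]: "survival a n \<in> borel_measurable borel"
  unfolding survival_def[abs_def] by measurable

lemma survival_nonneg [simp]: "0 \<le> survival a n x"
  and survival_le_1: "survival a n x \<le> 1"
  using cyl_le_1[of a n x] by (auto simp: survival_def enn2real_leI)

lemma integrable_survival: "integrable (K x) (survival a n)"
proof -
  interpret prob_space "K x" by (rule prob_space_K)
  show ?thesis
    by (rule integrable_const_bound[where B = 1]) (auto simp: survival_le_1)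
qed

lemma survival_0: "survival a 0 x = (if \<bar>x\<bar> > a then 1 else 0)"
  by (simp add: survival_def indicator_def)

lemma survival_inside: "\<bar>x\<bar> \<le> a \<Longrightarrow> survival a n x = 0"
  by (cases n) (simp_all add: survival_def indicator_def)

lemma survival_Suc:
  assumes "\<bar>x\<bar> > a"
  shows "survival a (Suc n) x = (\<integral>z. survival a n z \<partial>K x)"
proof -
  have "ennreal (survival a (Suc n) x) = (\<integral>\<^sup>+ z. ennreal (survival a n z) \<partial>K x)"
    using assms by (simp add: ennreal_survival)
  also have "\<dots> = ennreal (\<integral>z. survival a n z \<partial>K x)"
    by (rule nn_integral_eq_integral[OF integrable_survival]) auto
  finally show ?thesis by (simp add: integral_nonneg)
qed

lemma AE_X: "x \<in> X \<Longrightarrow> AE z in K x. z \<in> X"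
  by (rule AE_I[of _ _ "UNIV - X"]) (use X_closed X_borel in auto)

text \<open>Induction on n by the one-step recursion. Where \<open>G (Suc n) x\<close> is at least 1
  the claim is trivial, so the integral inequality is required only elsewhere.\<close>

lemma survival_le_supersolution:
  assumes "\<And>z n. z \<in> X \<Longrightarrow> \<bar>z\<bar> \<le> a \<Longrightarrow> 0 \<le> G n z"
    and "\<And>z. z \<in> X \<Longrightarrow> \<bar>z\<bar> > a \<Longrightarrow> 1 \<le> G 0 z"
    and "\<And>n x. x \<in> X \<Longrightarrow> \<bar>x\<bar> > a \<Longrightarrow> 1 \<le> G (Suc n) x \<or>
      (integrable (K x) (G n) \<and> (\<integral>z. G n z \<partial>K x) \<le> G (Suc n) x)"
    and "x \<in> X"
  shows "survival a n x \<le> G n x"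
  using \<open>x \<in> X\<close>
proof (induction n arbitrary: x)
  case 0
  then show ?case using assms(1,2) by (auto simp: survival_0)
next
  case (Suc n)
  show ?case
  proof (cases "\<bar>x\<bar> \<le> a")
    case True
    then show ?thesis using assms(1) Suc by (simp add: survival_inside)
  next
    case False
    from assms(3)[OF Suc.prems, of n] False
    consider "1 \<le> G (Suc n) x" | "integrable (K x) (G n)" "(\<integral>z. G n z \<partial>K x) \<le> G (Suc n) x" by auto
    then show ?thesis
    proof cases
      case 1
      then show ?thesis using survival_le_1[of a "Suc n" x] by linarith
    next
      case 2
      have "AE z in K x. survival a n z \<le> G n z"
        using AE_X[OF Suc.prems] by eventually_elim (rule Suc.IH)
      then have "(\<integral>z. survival a n z \<partial>K x) \<le> (\<integral>z. G n z \<partial>K x)"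
        by (intro integral_mono_AE integrable_survival 2)
      then show ?thesis using 2 False by (simp add: survival_Suc)
    qed
  qed
qed

text \<open>The dual comparison. The escape clause is now any lower bound already known; such a
  bound may hold only up to a time horizon, hence N.\<close>

lemma subsolution_le_survival:
  assumes "\<And>z n. z \<in> X \<Longrightarrow> \<bar>z\<bar> \<le> a \<Longrightarrow> G n z \<le> 0"
    and "\<And>z. z \<in> X \<Longrightarrow> \<bar>z\<bar> > a \<Longrightarrow> G 0 z \<le> 1"
    and "\<And>n x. n < N \<Longrightarrow> x \<in> X \<Longrightarrow> \<bar>x\<bar> > a \<Longrightarrow> G (Suc n) x \<le> survival a (Suc n) x \<or>
      (integrable (K x) (G n) \<and> G (Suc n) x \<le> (\<integral>z. G n z \<partial>K x))"
    and "x \<in> X" "n \<le> N"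
  shows "G n x \<le> survival a n x"
  using \<open>x \<in> X\<close> \<open>n \<le> N\<close>
proof (induction n arbitrary: x)
  case 0
  then show ?case using assms(1,2) by (auto simp: survival_0)
next
  case (Suc n)
  show ?case
  proof (cases "\<bar>x\<bar> \<le> a")
    case True
    then show ?thesis using assms(1) Suc by (simp add: survival_inside)
  next
    case False
    from assms(3)[of n x] Suc.prems False
    consider "G (Suc n) x \<le> survival a (Suc n) x" 
      | "integrable (K x) (G n)" "G (Suc n) x \<le> (\<integral>z. G n z \<partial>K x)" by auto
    then show ?thesis
    proof cases
      case 2
      have "AE z in K x. G n z \<le> survival a n z"
        using AE_X[OF Suc.prems(1)] by eventually_elim (use Suc in simp)
      then have "(\<integral>z. G n z \<partial>K x) \<le> (\<integral>z. survival a n z \<partial>K x)"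
        by (intro integral_mono_AE integrable_survival 2)
      then show ?thesis using 2 False by (simp add: survival_Suc)
    qed
  qed
qed

lemma power_moment:
  assumes \<nu>: "0 < \<nu>" "\<nu> < \<alpha>" and x: "x \<in> X" "\<bar>x\<bar> \<ge> x0" "x \<noteq> 0" and "y > 0"
  shows "integrable (K x) (\<lambda>z. (\<bar>z\<bar> / y) powr \<nu>)"
    "(\<integral>z. (\<bar>z\<bar> / y) powr \<nu> \<partial>K x) = (\<bar>x\<bar> / y) powr \<nu> * moment_ratio \<nu> x"
proof -
  have eq: "(\<lambda>z. (\<bar>z\<bar> / y) powr \<nu>) = (\<lambda>z. (\<bar>x\<bar> / y) powr \<nu> * \<bar>z / x\<bar> powr \<nu>)"
    using x(3) \<open>y > 0\<close> by (auto simp: powr_divide)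
  show "integrable (K x) (\<lambda>z. (\<bar>z\<bar> / y) powr \<nu>)"
    unfolding eq by (intro integrable_mult_right moment_ratio_expansion \<nu> x)
  show "(\<integral>z. (\<bar>z\<bar> / y) powr \<nu> \<partial>K x) = (\<bar>x\<bar> / y) powr \<nu> * moment_ratio \<nu> x"
    unfolding eq moment_ratio_def by simp
qed

lemma ratio_bounds:
  assumes \<nu>: "0 < \<nu>" "\<nu> < \<alpha>" and "l < \<kappa> \<nu>" "\<kappa> \<nu> < u"
  obtains a where "a \<ge> 1" "a \<ge> x0"
    "\<And>x. x \<in> X \<Longrightarrow> \<bar>x\<bar> > a \<Longrightarrow> l * \<bar>x\<bar> powr (- \<beta>) \<le> moment_ratio \<nu> x - 1 \<and> moment_ratio \<nu> x - 1 \<le> u * \<bar>x\<bar> powr (- \<beta>)"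
proof -
  have "eventually (\<lambda>x. l < \<bar>x\<bar> powr \<beta> * (moment_ratio \<nu> x - 1) \<and> \<bar>x\<bar> powr \<beta> * (moment_ratio \<nu> x - 1) < u) (to_infinity_in X)"
    using order_tendstoD[OF ratio_limit[OF \<nu>]] assms(3,4) by (intro eventually_conj) auto
  then obtain a where a: "\<And>x. x \<in> X \<Longrightarrow> \<bar>x\<bar> > a \<Longrightarrow>
      l < \<bar>x\<bar> powr \<beta> * (moment_ratio \<nu> x - 1) \<and> \<bar>x\<bar> powr \<beta> * (moment_ratio \<nu> x - 1) < u"
    unfolding eventually_to_infinity_in by blast
  show ?thesis
  proof (rule that[of "max a (max 1 x0)"])
    fix x assume "x \<in> X" "\<bar>x\<bar> > max a (max 1 x0)"
    then show "l * \<bar>x\<bar> powr (- \<beta>) \<le> moment_ratio \<nu> x - 1 \<and> moment_ratio \<nu> x - 1 \<le> u * \<bar>x\<bar> powr (- \<beta>)"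
      using a[of x] by (auto simp: powr_minus field_simps)
  qed auto
qed

text \<open>To survive n steps, the chain must get beyond y or stay below y throughout. The first
  summand exceeds 1 beyond y and is a supermartingale below; in the second, each step from below y
  costs at least the factor \<open>1 - \<epsilon> * y powr (- \<beta>)\<close>, as the relative
  decrease is stronger closer in.\<close>

lemma survival_upper_bound:
  assumes \<nu>: "0 < \<nu>" "\<nu> < \<alpha>" and neg: "\<kappa> \<nu> < 0"
  obtains a0 \<epsilon> where "\<epsilon> > 0" "a0 \<ge> 1"
    "\<And>a x y n. a \<ge> a0 \<Longrightarrow> x \<in> X \<Longrightarrow> y > 0 \<Longrightarrow> \<epsilon> * y powr (- \<beta>) \<le> 1 \<Longrightarrow>
      survival a n x \<le> (\<bar>x\<bar> / y) powr \<nu> + (1 - \<epsilon> * y powr (- \<beta>)) ^ n * \<bar>x\<bar> powr \<nu>"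
proof -
  \<comment> \<open>Half of the limit leaves the room needed to pass from a limit to an
    inequality.\<close>
  define \<epsilon> where "\<epsilon> = - \<kappa> \<nu> / 2"
  have "\<epsilon> > 0" "\<kappa> \<nu> < - \<epsilon>" using neg by (auto simp: \<epsilon>_def)
  obtain a0 where a0: "a0 \<ge> 1" "a0 \<ge> x0"
    "\<And>x. x \<in> X \<Longrightarrow> \<bar>x\<bar> > a0 \<Longrightarrow> moment_ratio \<nu> x - 1 \<le> - \<epsilon> * \<bar>x\<bar> powr (- \<beta>)"
  proof (rule ratio_bounds[OF \<nu>, of "\<kappa> \<nu> - 1" "- \<epsilon>"])
  qed (use \<open>\<kappa> \<nu> < - \<epsilon>\<close> in auto)
  show ?thesis
  proof (rule that[OF \<open>\<epsilon> > 0\<close> a0(1)])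
    fix a x y :: real and n :: nat
    assume a: "a \<ge> a0" and "x \<in> X" and y: "y > 0" "\<epsilon> * y powr (- \<beta>) \<le> 1"
    define \<rho> where "\<rho> = 1 - \<epsilon> * y powr (- \<beta>)"
    have \<rho>: "0 \<le> \<rho>" "\<rho> \<le> 1" using y \<open>\<epsilon> > 0\<close> by (auto simp: \<rho>_def)
    define G where "G n z = (\<bar>z\<bar> / y) powr \<nu> + \<rho> ^ n * (\<bar>z\<bar> / 1) powr \<nu>" for n z
    have "survival a n x \<le> G n x"
    proof (rule survival_le_supersolution[OF _ _ _ \<open>x \<in> X\<close>])
      fix z :: real and n :: nat
      assume "z \<in> X"
      show "0 \<le> G n z" using \<rho> by (auto simp: G_def)
    next
      fix z :: real
      assume "\<bar>z\<bar> > a"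
      then have "\<bar>z\<bar> \<ge> 1" using a a0(1) by linarith
      then have "1 \<le> \<bar>z\<bar> powr \<nu>" using \<nu> by (simp add: ge_one_powr_ge_zero)
      then show "1 \<le> G 0 z" by (simp add: G_def add_increasing)
    next
      fix n z
      assume z: "z \<in> X" "\<bar>z\<bar> > a"
      then have z': "\<bar>z\<bar> \<ge> x0" "z \<noteq> 0" "\<bar>z\<bar> > a0" using a a0 by auto
      show "1 \<le> G (Suc n) z \<or> (integrable (K z) (G n) \<and> (\<integral>w. G n w \<partial>K z) \<le> G (Suc n) z)"
      proof (cases "\<bar>z\<bar> \<ge> y")
        case True
        then have "1 \<le> (\<bar>z\<bar> / y) powr \<nu>" using \<nu> y by (intro ge_one_powr_ge_zero) auto
        moreover have "0 \<le> \<rho> ^ Suc n * (\<bar>z\<bar> / 1) powr \<nu>" using \<rho> by (intro mult_nonneg_nonneg zero_le_power) auto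
        ultimately show ?thesis unfolding G_def by linarith
      next
        case False
        note m = power_moment[OF \<nu> z(1) z'(1,2)]
        have I: "integrable (K z) (G n)"
          unfolding G_def[abs_def] using y by (intro Bochner_Integration.integrable_add integrable_mult_right m) auto
        have "(\<integral>w. G n w \<partial>K z) = (\<bar>z\<bar> / y) powr \<nu> * moment_ratio \<nu> z + \<rho> ^ n * ((\<bar>z\<bar> / 1) powr \<nu> * moment_ratio \<nu> z)"
          unfolding G_def[abs_def] using y m(1)[of y] m(1)[of 1] by (simp add: m(2) m(2)[of 1, simplified])
        also have "\<dots> \<le> (\<bar>z\<bar> / y) powr \<nu> * 1 + \<rho> ^ n * ((\<bar>z\<bar> / 1) powr \<nu> * \<rho>)"
        proof (intro add_mono mult_left_mono)
          have m1: "moment_ratio \<nu> z - 1 \<le> - \<epsilon> * \<bar>z\<bar> powr (- \<beta>)"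
            using a0(3)[OF z(1) z'(3)] .
          moreover have "0 \<le> \<epsilon> * \<bar>z\<bar> powr (- \<beta>)" using \<open>\<epsilon> > 0\<close> by simp
          ultimately show "moment_ratio \<nu> z \<le> 1" by linarith
          have "y powr (- \<beta>) \<le> \<bar>z\<bar> powr (- \<beta>)"
            using False \<beta> z' by (intro powr_mono2') auto
          then have "\<epsilon> * y powr (- \<beta>) \<le> \<epsilon> * \<bar>z\<bar> powr (- \<beta>)"
            using \<open>\<epsilon> > 0\<close> by simp
          then show "moment_ratio \<nu> z \<le> \<rho>" unfolding \<rho>_def using m1 by linarith
        qed (use \<rho> in auto)
        also have "\<dots> = G (Suc n) z" by (simp add: G_def)
        finally show ?thesis using I by blast
      qed
    qed
    then show "survival a n x \<le> (\<bar>x\<bar> / y) powr \<nu> + (1 - \<epsilon> * y powr (- \<beta>)) ^ n * \<bar>x\<bar> powr \<nu>"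
      by (simp add: G_def \<rho>_def)
  qed
qed

lemma survival_upper_rate:
  assumes \<nu>: "0 < \<nu>" "\<nu> < \<alpha>" and neg: "\<kappa> \<nu> < 0" and s: "0 < s" "s < \<nu> / \<beta>"
  shows "\<exists>a0. \<forall>a\<ge>a0. \<forall>x\<in>X. \<exists>C. eventually (\<lambda>n. survival a n x \<le> C * real n powr (- s)) sequentially"
proof -
  obtain a0 \<epsilon> where \<epsilon>: "\<epsilon> > 0" "a0 \<ge> 1" and bd:
    "\<And>a x y n. a \<ge> a0 \<Longrightarrow> x \<in> X \<Longrightarrow> y > 0 \<Longrightarrow> \<epsilon> * y powr (- \<beta>) \<le> 1 \<Longrightarrow>
      survival a n x \<le> (\<bar>x\<bar> / y) powr \<nu> + (1 - \<epsilon> * y powr (- \<beta>)) ^ n * \<bar>x\<bar> powr \<nu>"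
    using survival_upper_bound[OF assms(1-3)] by metis
  \<comment> \<open>With \<open>y = n powr r\<close> the first term of the bound has exactly the
    order \<open>n powr (- s)\<close>. As p < 1, the exponent
    \<open>n * y powr (- \<beta>) = n powr (1 - p)\<close> grows polynomially, so the second term is
    smaller than any power.\<close>
  define r where "r = s / \<nu>"
  define p where "p = r * \<beta>"
  have r: "0 < r" and p: "0 < p" "p < 1" using \<nu> s \<beta> by (auto simp: r_def p_def field_simps)
  have "eventually (\<lambda>n. survival a n x \<le> (2 * \<bar>x\<bar> powr \<nu>) * real n powr (- s)) sequentially"
    if "a \<ge> a0" "x \<in> X" for a x
  proof -
    have "eventually (\<lambda>n. \<epsilon> * real n powr (- p) \<le> 1) sequentially"
      using p \<epsilon> by real_asymp
    moreover have "eventually (\<lambda>n. exp (- \<epsilon> * real n powr (1 - p)) \<le> real n powr (- s)) sequentially"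
      using p \<epsilon> s by real_asymp
    moreover have "eventually (\<lambda>n. n > 0) sequentially" by (rule eventually_gt_at_top)
    ultimately show ?thesis
    proof eventually_elim
      case (elim n)
      define y where "y = real n powr r"
      have y: "y > 0" "y powr (- \<beta>) = real n powr (- p)" "y powr (- \<nu>) = real n powr (- s)"
        using elim \<nu> by (auto simp: y_def powr_powr p_def r_def)
      have "survival a n x \<le> (\<bar>x\<bar> / y) powr \<nu> + (1 - \<epsilon> * y powr (- \<beta>)) ^ n * \<bar>x\<bar> powr \<nu>"
        using elim y by (intro bd that) auto
      also have "(\<bar>x\<bar> / y) powr \<nu> = \<bar>x\<bar> powr \<nu> * real n powr (- s)"
        using y by (simp add: powr_divide powr_minus_divide flip: y(3))
      also have "(1 - \<epsilon> * y powr (- \<beta>)) ^ n \<le> exp (- (\<epsilon> * y powr (- \<beta>))) ^ n"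
        using elim exp_ge_add_one_self[of "- (\<epsilon> * y powr (- \<beta>))"] by (intro power_mono) (auto simp: y)
      also have "\<dots> = exp (- \<epsilon> * real n powr (1 - p))"
        using powr_mult_base[of "real n" "- p"] by (simp add: y(2) mult_ac flip: exp_of_nat_mult)
      also have "\<dots> \<le> real n powr (- s)" by (rule elim)
      finally show ?case by (simp add: mult_right_mono algebra_simps)
    qed
  qed
  then show ?thesis by blast
qed

text \<open>On the scale \<open>y\<close> the function \<open>8 (w - w\<^sup>2) - 1\<close> of \<open>w = (\<bar>z\<bar> / y) powr \<nu>\<close> plays the role of a bump
  function: it is positive only for \<open>1 / 8 < w < 1\<close>, and it equals \<open>1\<close> at \<open>w = 1 / 2\<close>.\<close>
lemma survival_from_far:
  shows "\<exists>a0. \<forall>a\<ge>a0. \<exists>C>0. \<exists>Y. \<forall>x\<in>X. \<bar>x\<bar> \<ge> Y \<longrightarrow> (\<forall>n. 1 - real n * C * \<bar>x\<bar> powr (- \<beta>) \<le> survival a n x)"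
proof -
  \<comment> \<open>The bump involves the exponents \<nu> and 2\<nu>, and both must lie below
    \<alpha>.\<close>
  define \<nu> where "\<nu> = \<alpha> / 3"
  have \<nu>: "0 < \<nu>" "\<nu> < \<alpha>" "0 < 2 * \<nu>" "2 * \<nu> < \<alpha>" using \<alpha> by (auto simp: \<nu>_def)
  define C1 where "C1 = \<bar>\<kappa> \<nu>\<bar> + 1"
  define C2 where "C2 = \<bar>\<kappa> (2 * \<nu>)\<bar> + 1"
  obtain a1 where a1: "a1 \<ge> 1" "a1 \<ge> x0" "\<And>x. x \<in> X \<Longrightarrow> \<bar>x\<bar> > a1 \<Longrightarrow> - C1 * \<bar>x\<bar> powr (- \<beta>) \<le> moment_ratio \<nu> x - 1"
  proof (rule ratio_bounds[OF \<nu>(1,2), of "- C1" C1])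
  qed (auto simp: C1_def)
  obtain a2 where a2: "\<And>x. x \<in> X \<Longrightarrow> \<bar>x\<bar> > a2 \<Longrightarrow> moment_ratio (2 * \<nu>) x - 1 \<le> C2 * \<bar>x\<bar> powr (- \<beta>)"
  proof (rule ratio_bounds[OF \<nu>(3,4), of "- C2" C2])
  qed (auto simp: C2_def)
  have C: "C1 > 0" "C2 > 0" by (auto simp: C1_def C2_def)
  \<comment> \<open>The factor 8 is that of the bump and C1 + C2 bounds the two relative increments.
    On the region w > 1/8 the state exceeds \<open>y / 8 powr (1 / \<nu>)\<close>, which gives the
    last factor.\<close>
  define D where "D = 8 * (C1 + C2) * 8 powr (\<beta> / \<nu>)"
  have "D > 0" using C by (simp add: D_def)
  have main: "1 - real n * D * \<bar>x\<bar> powr (- \<beta>) \<le> survival a n x"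
    if a: "a \<ge> max a1 a2" and x: "x \<in> X" "\<bar>x\<bar> \<ge> a * 8 powr (1 / \<nu>)" for a x n
  proof -
    have "a \<ge> 1" using a a1 by simp
    have "0 < a * 8 powr (1 / \<nu>)" using \<open>a \<ge> 1\<close> by simp
    then have xpos: "\<bar>x\<bar> > 0" using x(2) by linarith
    \<comment> \<open>This scale puts x at w = 1/2, the top of the bump.\<close>
    define y where "y = \<bar>x\<bar> * 2 powr (1 / \<nu>)"
    have "1 \<le> 2 powr (1 / \<nu>)" using \<nu> by (intro ge_one_powr_ge_zero) auto
    then have "\<bar>x\<bar> \<le> y"
      using mult_left_mono[of 1 "2 powr (1 / \<nu>)" "\<bar>x\<bar>"] by (simp add: y_def)
    then have y: "y > 0" "\<bar>x\<bar> \<le> y" "y \<ge> a * 8 powr (1 / \<nu>)"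
      using xpos x(2) by linarith+
    define F where "F z = 8 * ((\<bar>z\<bar> / y) powr \<nu> - (\<bar>z\<bar> / y) powr (2 * \<nu>)) - 1" for z
    \<comment> \<open>The mean of the bump drops by at most \<open>D * y powr (- \<beta>)\<close>
      per step, so a linear loss in n makes it a subsolution.\<close>
    define G where "G n z = F z - real n * (D * y powr (- \<beta>))" for n z
    have sq: "(\<bar>z\<bar> / y) powr (2 * \<nu>) = ((\<bar>z\<bar> / y) powr \<nu>)\<^sup>2" for z
      by (simp add: power2_eq_square flip: powr_add)
    have small: "F z \<le> 0" if "(\<bar>z\<bar> / y) powr \<nu> \<le> 1 / 8 \<or> 1 \<le> (\<bar>z\<bar> / y) powr \<nu>" for z
    proof -
      define w where "w = (\<bar>z\<bar> / y) powr \<nu>"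
      have "F z = 8 * (w - w\<^sup>2) - 1" by (simp add: F_def sq w_def)
      also have "\<dots> \<le> 0"
      proof (cases "w \<le> 1 / 8")
        case True
        have "8 * (w - v) - 1 \<le> 0" if "0 \<le> v" for v using True that by simp
        then show ?thesis by simp
      next
        case False
        then have "1 \<le> w" using that by (simp add: w_def)
        then have "w * 1 \<le> w * w" by (intro mult_left_mono) auto
        then show ?thesis by (simp add: power2_eq_square)
      qed
      finally show ?thesis .
    qed
    have le1: "F z \<le> 1" for z
    proof -
      define w where "w = (\<bar>z\<bar> / y) powr \<nu>"
      have "F z = 8 * (w - w\<^sup>2) - 1" by (simp add: F_def sq w_def)
      also have "\<dots> = 1 - 2 * (2 * w - 1)\<^sup>2" by (simp add: power2_eq_square algebra_simps)
      also have "\<dots> \<le> 1" by simp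
      finally show ?thesis .
    qed
    have inv8: "(8 powr (1 / \<nu>)) powr \<nu> = 8" using \<nu> by (simp add: powr_powr)
    have inside: "F z \<le> 0" if "\<bar>z\<bar> \<le> a" for z
    proof (rule small)
      have "\<bar>z\<bar> * 8 powr (1 / \<nu>) \<le> y"
        using that y(3) by (meson mult_right_mono order_trans powr_ge_zero)
      then have "\<bar>z\<bar> / y \<le> 1 / 8 powr (1 / \<nu>)" using y(1) by (simp add: field_simps)
      then have "(\<bar>z\<bar> / y) powr \<nu> \<le> (1 / 8 powr (1 / \<nu>)) powr \<nu>"
        using \<nu> y by (intro powr_mono2) auto
      then show "(\<bar>z\<bar> / y) powr \<nu> \<le> 1 / 8 \<or> 1 \<le> (\<bar>z\<bar> / y) powr \<nu>"
        by (simp add: powr_divide inv8)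
    qed
    have "G n x \<le> survival a n x"
    proof (rule subsolution_le_survival[OF _ _ _ x(1) order_refl])
      fix z n assume "\<bar>z\<bar> \<le> a"
      moreover have "0 \<le> real n * (D * y powr (- \<beta>))" using \<open>D > 0\<close> by simp
      ultimately show "G n z \<le> 0" using inside[of z] by (simp add: G_def)
    next
      show "G 0 z \<le> 1" for z using le1[of z] by (simp add: G_def)
    next
      fix n z assume z: "z \<in> X" "\<bar>z\<bar> > a"
      then have z': "\<bar>z\<bar> \<ge> x0" "z \<noteq> 0" "\<bar>z\<bar> > a1" "\<bar>z\<bar> > a2" using a a1 by auto
      define w where "w = (\<bar>z\<bar> / y) powr \<nu>"
      show "G (Suc n) z \<le> survival a (Suc n) z \<or> (integrable (K z) (G n) \<and> G (Suc n) z \<le> (\<integral>v. G n v \<partial>K z))"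
      proof (cases "w \<le> 1 / 8 \<or> 1 \<le> w")
        case True
        then have "F z \<le> 0" by (intro small) (simp add: w_def)
        moreover have "0 \<le> real (Suc n) * (D * y powr (- \<beta>))" using \<open>D > 0\<close> by simp
        moreover have "0 \<le> survival a (Suc n) z" by simp
        ultimately show ?thesis unfolding G_def by linarith
      next
        case False
        interpret prob_space "K z" by (rule prob_space_K)
        note m1 = power_moment[OF \<nu>(1,2) z(1) z'(1,2) y(1)]
        note m2 = power_moment[OF \<nu>(3,4) z(1) z'(1,2) y(1)]
        have I: "integrable (K z) (G n)"
          unfolding G_def[abs_def] F_def by (intro Bochner_Integration.integrable_diff integrable_mult_right m1 m2) auto
        have "(\<integral>v. G n v \<partial>K z) = 8 * (w * moment_ratio \<nu> z - w\<^sup>2 * moment_ratio (2 * \<nu>) z) - 1 - real n * (D * y powr (- \<beta>))"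
          unfolding G_def[abs_def] F_def using m1 m2 prob_space by (simp add: w_def sq)
        also have "\<dots> = G n z + 8 * (w * (moment_ratio \<nu> z - 1) - w\<^sup>2 * (moment_ratio (2 * \<nu>) z - 1))"
          unfolding G_def F_def w_def sq by (simp add: algebra_simps)
        finally have eq: "(\<integral>v. G n v \<partial>K z) = G n z + 8 * (w * (moment_ratio \<nu> z - 1) - w\<^sup>2 * (moment_ratio (2 * \<nu>) z - 1))" .
        have w: "0 \<le> w" "w \<le> 1" "1 / 8 < w" using False by auto
        define t where "t = \<bar>z\<bar> powr (- \<beta>)"
        have t: "0 \<le> t" by (simp add: t_def)
        have "w * (moment_ratio \<nu> z - 1) \<ge> w * (- C1 * t)"
          using a1(3)[OF z(1) z'(3)] w by (intro mult_left_mono) (auto simp: t_def)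
        moreover have "w * (C1 * t) \<le> 1 * (C1 * t)"
          using w C t by (intro mult_right_mono) auto
        moreover have "w\<^sup>2 * (moment_ratio (2 * \<nu>) z - 1) \<le> w\<^sup>2 * (C2 * t)"
          using a2[OF z(1) z'(4)] by (intro mult_left_mono) (auto simp: t_def)
        moreover have "w\<^sup>2 * (C2 * t) \<le> 1 * (C2 * t)"
          using w C t by (intro mult_right_mono power_le_one) auto
        ultimately have "w * (moment_ratio \<nu> z - 1) - w\<^sup>2 * (moment_ratio (2 * \<nu>) z - 1) \<ge> - ((C1 + C2) * t)"
          by (simp add: algebra_simps)
        moreover have "8 * ((C1 + C2) * t) \<le> D * y powr (- \<beta>)"
        proof -
          have "1 / 8 powr (1 / \<nu>) \<le> \<bar>z\<bar> / y"
          proof (rule ccontr)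
            assume "\<not> ?thesis"
            then have "(\<bar>z\<bar> / y) powr \<nu> \<le> (1 / 8 powr (1 / \<nu>)) powr \<nu>"
              using \<nu> y by (intro powr_mono2) auto
            then show False using w(3) by (simp add: powr_divide inv8 w_def)
          qed
          then have "y / 8 powr (1 / \<nu>) \<le> \<bar>z\<bar>" using y(1) by (simp add: field_simps)
          then have "t \<le> (y / 8 powr (1 / \<nu>)) powr (- \<beta>)"
            unfolding t_def using y(1) \<beta> by (intro powr_mono2') auto
          also have "\<dots> = y powr (- \<beta>) * 8 powr (\<beta> / \<nu>)"
            using y(1) by (simp add: powr_divide powr_powr powr_minus field_simps)
          finally have "(C1 + C2) * t \<le> (C1 + C2) * (y powr (- \<beta>) * 8 powr (\<beta> / \<nu>))"
            using C by (intro mult_left_mono) auto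
          moreover have "D * y powr (- \<beta>) = 8 * ((C1 + C2) * (y powr (- \<beta>) * 8 powr (\<beta> / \<nu>)))"
            by (simp only: D_def mult_ac)
          ultimately show ?thesis by linarith
        qed
        ultimately have "G (Suc n) z \<le> (\<integral>v. G n v \<partial>K z)"
          unfolding eq by (simp add: G_def algebra_simps)
        then show ?thesis using I by blast
      qed
    qed
    moreover have "F x = 1"
    proof -
      have half: "(\<bar>x\<bar> / y) powr \<nu> = 1 / 2"
        using xpos \<nu> by (simp add: y_def powr_divide powr_powr)
      show ?thesis unfolding F_def sq half by (simp add: power2_eq_square)
    qed
    moreover have "real n * (D * y powr (- \<beta>)) \<le> real n * (D * \<bar>x\<bar> powr (- \<beta>))"
      using \<open>D > 0\<close> y xpos \<beta> by (intro mult_left_mono powr_mono2') auto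
    ultimately show ?thesis by (simp add: G_def mult_ac)
  qed
  show ?thesis
    using main \<open>D > 0\<close> by (intro exI[of _ "max a1 a2"] allI impI exI[of _ D]) blast
qed

end

section \<open>Polynomial lower bounds for survival\<close>

context killed_chain begin

text \<open>The submartingale power \<nu> is unbounded; subtracting the larger power \<mu> keeps it
  below 1 and is harmless below a small multiple of the scale w. Beyond that multiple,
  \<open>survival_from_far\<close> already gives survival to time n with probability at least
  1/2.\<close>

lemma survival_lower_rate:
  assumes \<nu>: "0 < \<nu>" "\<nu> < \<mu>" "\<mu> < \<alpha>" and pos: "\<kappa> \<nu> > 0"
  shows "\<exists>a0. \<forall>a\<ge>a0. \<forall>x\<in>X. \<bar>x\<bar> > a \<longrightarrow>
    (\<exists>C>0. eventually (\<lambda>n. C * real n powr (- (\<nu> / \<beta>)) \<le> survival a n x) sequentially)"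
proof -
  have \<mu>: "0 < \<mu>" and \<nu>': "\<nu> < \<alpha>" using \<nu> by auto
  define e where "e = \<kappa> \<nu> / 2"
  have e: "e > 0" "e < \<kappa> \<nu>" using pos by (auto simp: e_def)
  define D where "D = \<bar>\<kappa> \<mu>\<bar> + 1"
  have "D > 0" by (simp add: D_def)
  obtain a1 where a1: "a1 \<ge> 1" "a1 \<ge> x0" "\<And>x. x \<in> X \<Longrightarrow> \<bar>x\<bar> > a1 \<Longrightarrow> e * \<bar>x\<bar> powr (- \<beta>) \<le> moment_ratio \<nu> x - 1"
  proof (rule ratio_bounds[OF \<nu>(1) \<nu>', of e "\<kappa> \<nu> + 1"])
  qed (use e in auto)
  obtain a2 where a2: "\<And>x. x \<in> X \<Longrightarrow> \<bar>x\<bar> > a2 \<Longrightarrow> moment_ratio \<mu> x - 1 \<le> D * \<bar>x\<bar> powr (- \<beta>)"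
  proof (rule ratio_bounds[OF \<mu> \<nu>(3), of "- D" D])
  qed (auto simp: D_def)
  obtain a3 where a3: "\<forall>a\<ge>a3. \<exists>C>0. \<exists>Y. \<forall>x\<in>X. \<bar>x\<bar> \<ge> Y \<longrightarrow> (\<forall>n. 1 - real n * C * \<bar>x\<bar> powr (- \<beta>) \<le> survival a n x)"
    using survival_from_far by blast
  \<comment> \<open>Below \<delta> times the scale, the gain e in the power \<nu> outweighs the loss
    D in the power \<mu>.\<close>
  define \<delta> where "\<delta> = (e / D) powr (1 / (\<mu> - \<nu>))"
  have \<delta>: "\<delta> > 0" "\<delta> powr (\<mu> - \<nu>) = e / D"
    using e \<open>D > 0\<close> \<nu> by (auto simp: \<delta>_def powr_powr)
  have main: "\<exists>C>0. eventually (\<lambda>n. C * real n powr (- (\<nu> / \<beta>)) \<le> survival a n x) sequentially"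
    if a: "a \<ge> max a1 (max a2 a3)" and x: "x \<in> X" "\<bar>x\<bar> > a" for a x
  proof -
    obtain C Y where C: "C > 0" "\<And>x n. x \<in> X \<Longrightarrow> \<bar>x\<bar> \<ge> Y \<Longrightarrow> 1 - real n * C * \<bar>x\<bar> powr (- \<beta>) \<le> survival a n x"
      using a3 a by (metis max.bounded_iff)
    have apos: "a > 0" using a a1 by simp
    \<comment> \<open>Chosen so that from distance \<open>\<delta> * y n\<close> the bound
      \<open>1 - n * C * (\<delta> * y n) powr (- \<beta>)\<close> equals 1/2.\<close>
    define y where "y n = (2 * C * real n) powr (1 / \<beta>) / \<delta>" for n
    have y\<beta>: "(\<delta> * y n) powr \<beta> = 2 * C * real n" for n
      using \<delta> \<beta> C by (simp add: y_def powr_powr)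
    define gap where "gap = \<bar>x\<bar> powr \<nu> - a powr \<nu>"
    have gap: "gap > 0" using x apos \<nu> by (auto simp: gap_def intro!: powr_less_mono2)
    define C' where "C' = gap / 4 * ((2 * C) powr (- (\<nu> / \<beta>)) * \<delta> powr \<nu>)"
    have "C' > 0" using gap C \<delta> by (auto simp: C'_def)
    have y_top: "filterlim y at_top sequentially"
      unfolding y_def using \<beta> C \<delta> by real_asymp
    have ev1: "eventually (\<lambda>n. y n \<ge> max 1 (Y / \<delta>)) sequentially"
      using y_top unfolding filterlim_at_top by blast
    have "((\<lambda>t. \<bar>x\<bar> powr \<mu> * t powr (\<nu> - \<mu>)) \<longlongrightarrow> 0) at_top"
      using \<nu> by real_asymp
    from filterlim_compose[OF this y_top]
    have ev2: "eventually (\<lambda>n. \<bar>x\<bar> powr \<mu> * y n powr (\<nu> - \<mu>) < gap / 2) sequentially"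
      by (rule order_tendstoD) (use gap in simp)
    have "eventually (\<lambda>n. C' * real n powr (- (\<nu> / \<beta>)) \<le> survival a n x) sequentially"
      using ev1 ev2 eventually_gt_at_top[of 0]
    proof eventually_elim
      case (elim n)
      define w where "w = y n"
      have w: "w > 0" "\<delta> * w \<ge> Y" "(\<delta> * w) powr \<beta> = 2 * C * real n"
        using elim \<delta> y\<beta>[of n] by (auto simp: w_def field_simps)
      \<comment> \<open>Subtracting the value of the first power at a makes G nonpositive on the
        killing set; the factor 1/2 fits it under the bound for distant states.\<close>
      define G where "G z = ((\<bar>z\<bar> / w) powr \<nu> - (\<bar>z\<bar> / w) powr \<mu> - (a / w) powr \<nu>) / 2" for z
      have arith: "(A - B - E) / 2 \<le> M / 2" if "A - E \<le> M" "0 \<le> B" for A B E M :: real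
        using that by simp
      have le_half: "G z \<le> 1 / 2" for z
      proof (cases "\<bar>z\<bar> / w \<le> 1")
        case True
        then have "(\<bar>z\<bar> / w) powr \<nu> \<le> 1" using w \<nu> by (intro powr_le1) auto
        then show ?thesis unfolding G_def by (intro arith) (auto intro: order_trans[rotated])
      next
        case False
        then have "(\<bar>z\<bar> / w) powr \<nu> \<le> (\<bar>z\<bar> / w) powr \<mu>" using \<nu> by (intro powr_mono) auto
        then have "G z \<le> - ((a / w) powr \<nu>) / 2"
          unfolding G_def by simp
        also have "\<dots> \<le> 1 / 2" using powr_ge_zero[of "a / w" \<nu>] by linarith
        finally show ?thesis .
      qed
      have "G x \<le> survival a n x"
      proof (rule subsolution_le_survival[OF _ _ _ x(1) order_refl, where G = "\<lambda>_. G"])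
        fix z :: real assume "\<bar>z\<bar> \<le> a"
        then have "(\<bar>z\<bar> / w) powr \<nu> \<le> (a / w) powr \<nu>"
          using w \<nu> by (intro powr_mono2 divide_right_mono) auto
        then show "G z \<le> 0"
          unfolding G_def
          using arith[of "(\<bar>z\<bar> / w) powr \<nu>" "(a / w) powr \<nu>" 0 "(\<bar>z\<bar> / w) powr \<mu>"] by simp
      next
        show "G z \<le> 1" for z using le_half[of z] by linarith
      next
        fix m z assume m: "m < n" and z: "z \<in> X" "\<bar>z\<bar> > a"
        show "G z \<le> survival a (Suc m) z \<or> (integrable (K z) G \<and> G z \<le> (\<integral>v. G v \<partial>K z))"
        proof (cases "\<bar>z\<bar> \<ge> \<delta> * w")
          case True
          have "\<bar>z\<bar> powr (- \<beta>) \<le> (\<delta> * w) powr (- \<beta>)"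
            using True \<delta> w \<beta> by (intro powr_mono2') auto
          also have "\<dots> = 1 / (2 * C * real n)"
            using w(3) by (simp add: powr_minus_divide)
          finally have "real (Suc m) * C * \<bar>z\<bar> powr (- \<beta>) \<le> real n * C * (1 / (2 * C * real n))"
            using m C by (intro mult_mono) auto
          also have "\<dots> = 1 / 2" using elim C by simp
          finally have "1 / 2 \<le> 1 - real (Suc m) * C * \<bar>z\<bar> powr (- \<beta>)" by simp
          also have "\<dots> \<le> survival a (Suc m) z"
            using True w z by (intro C(2)) auto
          finally show ?thesis using le_half[of z] by linarith
        next
          case False
          interpret prob_space "K z" by (rule prob_space_K)
          have z': "\<bar>z\<bar> \<ge> x0" "z \<noteq> 0" "\<bar>z\<bar> > a1" "\<bar>z\<bar> > a2" using a a1 z by auto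
          note m1 = power_moment[OF \<nu>(1) \<nu>' z(1) z'(1,2) w(1)]
          note m2 = power_moment[OF \<mu> \<nu>(3) z(1) z'(1,2) w(1)]
          define r where "r = \<bar>z\<bar> / w"
          have r: "0 < r" "r < \<delta>" using z' w False by (auto simp: r_def field_simps)
          define t where "t = \<bar>z\<bar> powr (- \<beta>)"
          have t: "0 \<le> t" by (simp add: t_def)
          have I: "integrable (K z) G"
            unfolding G_def[abs_def] by (intro Bochner_Integration.integrable_diff integrable_divide m1 m2) auto
          have "(\<integral>v. G v \<partial>K z) = (r powr \<nu> * moment_ratio \<nu> z - r powr \<mu> * moment_ratio \<mu> z - (a / w) powr \<nu>) / 2"
            unfolding G_def[abs_def] using m1 m2 prob_space by (simp add: r_def)
          also have "\<dots> = G z + (r powr \<nu> * (moment_ratio \<nu> z - 1) - r powr \<mu> * (moment_ratio \<mu> z - 1)) / 2"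
            by (simp add: G_def r_def field_simps)
          finally have eq: "(\<integral>v. G v \<partial>K z) = G z + (r powr \<nu> * (moment_ratio \<nu> z - 1) - r powr \<mu> * (moment_ratio \<mu> z - 1)) / 2" .
          have "r powr \<mu> * (moment_ratio \<mu> z - 1) \<le> r powr \<mu> * (D * t)"
            using a2[OF z(1) z'(4)] by (intro mult_left_mono) (auto simp: t_def)
          also have "\<dots> = r powr \<nu> * (r powr (\<mu> - \<nu>) * (D * t))"
            using r by (simp add: powr_diff)
          also have "\<dots> \<le> r powr \<nu> * (\<delta> powr (\<mu> - \<nu>) * (D * t))"
            using r \<nu> t \<open>D > 0\<close> by (intro mult_left_mono mult_right_mono powr_mono2) auto
          also have "\<dots> = r powr \<nu> * (e * t)" using \<delta> \<open>D > 0\<close> by simp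
          also have "\<dots> \<le> r powr \<nu> * (moment_ratio \<nu> z - 1)"
            using a1(3)[OF z(1) z'(3)] by (intro mult_left_mono) (auto simp: t_def)
          finally show ?thesis using I unfolding eq by simp
        qed
      qed
      moreover have "C' * real n powr (- (\<nu> / \<beta>)) \<le> G x"
      proof -
        have wn: "w powr (- \<nu>) = (2 * C) powr (- (\<nu> / \<beta>)) * \<delta> powr \<nu> * real n powr (- (\<nu> / \<beta>))"
          using \<delta> C \<beta> elim by (simp add: w_def y_def powr_divide powr_powr powr_mult powr_minus field_simps)
        have "G x = w powr (- \<nu>) * (gap - \<bar>x\<bar> powr \<mu> * w powr (\<nu> - \<mu>)) / 2"
          using w apos by (simp add: G_def gap_def powr_divide powr_minus powr_diff field_simps)
        also have "\<dots> \<ge> w powr (- \<nu>) * (gap / 2) / 2"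
          using elim(2) by (intro divide_right_mono mult_left_mono) (auto simp: w_def)
        finally show ?thesis by (simp add: wn C'_def mult_ac)
      qed
      ultimately show ?case by linarith
    qed
    then show ?thesis using \<open>C' > 0\<close> by blast
  qed
  then show ?thesis by blast
qed

text \<open>A jump beyond R has probability of order \<open>R powr (- \<alpha>)\<close>, and R of
  order \<open>n powr (1 / \<beta>)\<close> suffices for the remaining time. No sign of
  \<open>\<kappa>\<close> is assumed, so this also covers an inward drift that makes all powers
  supermartingales.\<close>

lemma survival_lower_rate_one_jump:
  shows "\<exists>a0. \<forall>a\<ge>a0. \<forall>x\<in>X. \<bar>x\<bar> > a \<longrightarrow>
    (\<exists>C>0. eventually (\<lambda>n. C * real n powr (- (\<alpha> / \<beta>)) \<le> survival a n x) sequentially)"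
proof -
  obtain a3 where a3: "\<forall>a\<ge>a3. \<exists>C>0. \<exists>Y. \<forall>x\<in>X. \<bar>x\<bar> \<ge> Y \<longrightarrow> (\<forall>n. 1 - real n * C * \<bar>x\<bar> powr (- \<beta>) \<le> survival a n x)"
    using survival_from_far by blast
  obtain Y' where Y': "\<forall>y\<ge>Y'. \<forall>x\<in>X. \<bar>x\<bar> \<ge> x0 \<longrightarrow>
        \<bar>y powr \<alpha> * measure (K x) {z. z - x > y} - c\<bar> \<le> c / 2 \<and>
        \<bar>y powr \<alpha> * measure (K x) {z. x - z > y} - c\<bar> \<le> c / 2"
    using tail[of "c / 2"] c by auto
  have main: "\<exists>C>0. eventually (\<lambda>n. C * real n powr (- (\<alpha> / \<beta>)) \<le> survival a n x) sequentially"
    if a: "a \<ge> max a3 x0" and x: "x \<in> X" "\<bar>x\<bar> > a" for a x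
  proof -
    obtain C Y where C: "C > 0" "\<And>x n. x \<in> X \<Longrightarrow> \<bar>x\<bar> \<ge> Y \<Longrightarrow> 1 - real n * C * \<bar>x\<bar> powr (- \<beta>) \<le> survival a n x"
      using a3 a by (metis max.bounded_iff)
    define R where "R n = (2 * C * real n) powr (1 / \<beta>)" for n
    have R\<beta>: "R n powr \<beta> = 2 * C * real n" for n
      using \<beta> C by (simp add: R_def powr_powr)
    define C' where "C' = c / 4 * (2 powr (- \<alpha>) * (2 * C) powr (- (\<alpha> / \<beta>)))"
    have "C' > 0" using c C by (auto simp: C'_def)
    have R_top: "filterlim R at_top sequentially"
      unfolding R_def using \<beta> C by real_asymp
    then have "eventually (\<lambda>n. R n \<ge> max 1 (max Y (max Y' \<bar>x\<bar>))) sequentially"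
      unfolding filterlim_at_top by blast
    then have "eventually (\<lambda>n. C' * real n powr (- (\<alpha> / \<beta>)) \<le> survival a n x) sequentially"
      using eventually_gt_at_top[of 0]
    proof eventually_elim
      case (elim n)
      \<comment> \<open>One step is spent on the jump, m steps remain.\<close>
      then obtain m where m: "n = Suc m" by (cases n) auto
      interpret prob_space "K x" by (rule prob_space_K)
      \<comment> \<open>The extra \<open>\<bar>x\<bar>\<close> ensures z > R n even for a negative
        starting point.\<close>
      define S where "S = {z. z - x > R n + \<bar>x\<bar>}"
      have R: "R n \<ge> 1" "R n \<ge> Y" "R n \<ge> Y'" "R n \<ge> \<bar>x\<bar>" using elim by auto
      have ind: "indicator S z / 2 \<le> survival a m z" if "z \<in> X" for z
      proof (cases "z \<in> S")
        case True
        then have zR: "\<bar>z\<bar> \<ge> R n" by (auto simp: S_def)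
        have "\<bar>z\<bar> powr (- \<beta>) \<le> R n powr (- \<beta>)"
          using zR R \<beta> by (intro powr_mono2') auto
        also have "\<dots> = 1 / (2 * C * real n)" by (simp add: powr_minus_divide R\<beta>)
        finally have "real m * C * \<bar>z\<bar> powr (- \<beta>) \<le> real n * C * (1 / (2 * C * real n))"
          using m C by (intro mult_mono) auto
        also have "\<dots> = 1 / 2" using elim C by simp
        finally have "1 / 2 \<le> 1 - real m * C * \<bar>z\<bar> powr (- \<beta>)" by simp
        also have "\<dots> \<le> survival a m z" using zR R that by (intro C(2)) auto
        finally show ?thesis using True by simp
      qed simp
      then have "AE z in K x. indicator S z / 2 \<le> survival a m z"
      proof -
        have "AE z in K x. z \<in> X \<longrightarrow> indicator S z / 2 \<le> survival a m z"
          using ind by (intro AE_I2) auto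
        with AE_X[OF x(1)] show ?thesis by eventually_elim blast
      qed
      moreover have S: "S \<in> sets (K x)" by (simp add: S_def)
      ultimately have "(\<integral>z. indicator S z / 2 \<partial>K x) \<le> (\<integral>z. survival a m z \<partial>K x)"
        by (intro integral_mono_AE integrable_survival integrable_divide integrable_real_indicator) 
           (auto simp: less_top[symmetric])
      also have "(\<integral>z. indicator S z / 2 \<partial>K x) = measure (K x) S / 2"
        using S by simp
      also have "(\<integral>z. survival a m z \<partial>K x) = survival a n x"
        using x by (simp add: m survival_Suc)
      finally have 1: "measure (K x) S / 2 \<le> survival a n x" .
      define T where "T = R n + \<bar>x\<bar>"
      have T: "T > 0" "T \<ge> Y'" "T \<le> 2 * R n" using R by (auto simp: T_def)
      have "\<bar>T powr \<alpha> * measure (K x) S - c\<bar> \<le> c / 2"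
        using Y' T x a unfolding S_def T_def[symmetric] by auto
      then have "c / 2 \<le> T powr \<alpha> * measure (K x) S" by linarith
      also have "\<dots> \<le> (2 * R n) powr \<alpha> * measure (K x) S"
        using T \<alpha> by (intro mult_right_mono powr_mono2) auto
      finally have "c / 2 * (2 * R n) powr (- \<alpha>) \<le> measure (K x) S"
        using R by (simp add: powr_minus field_simps)
      moreover have "(2 * R n) powr (- \<alpha>) = 2 powr (- \<alpha>) * (2 * C) powr (- (\<alpha> / \<beta>)) * real n powr (- (\<alpha> / \<beta>))"
        using C by (simp add: R_def powr_mult powr_powr)
      ultimately show ?case using 1 by (simp add: C'_def mult_ac)
    qed
    then show ?thesis using \<open>C' > 0\<close> by blast
  qed
  then show ?thesis by blast
qed

end

section \<open>Moments of the hitting time\<close>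

text \<open>A telescoping sum up to T; for infinite T it diverges because q > 0. It expresses the
  moment through events that the time exceeds n.\<close>

lemma suminf_powr_increments:
  fixes q :: real and T :: enat
  assumes "q > 0"
  shows "(\<Sum>n. ennreal (real (Suc n) powr q - real n powr q) * indicator {n. enat n < T} n) =
    (case T of enat m \<Rightarrow> ennreal (real m powr q) | \<infinity> \<Rightarrow> \<infinity>)"
proof -
  define d where "d n = real (Suc n) powr q - real n powr q" for n
  have d: "d n \<ge> 0" for n using assms by (auto simp: d_def intro!: powr_mono2)
  have sum: "(\<Sum>n<m. ennreal (d n)) = ennreal (real m powr q)" for m
  proof -
    have "(\<Sum>n<m. d n) = real m powr q"
      unfolding d_def using sum_lessThan_telescope[of "\<lambda>n. real n powr q" m] assms by simp
    then show ?thesis using d by (simp add: sum_ennreal)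
  qed
  show ?thesis
  proof (cases T)
    case (enat m)
    have "(\<Sum>n. ennreal (d n) * indicator {n. enat n < T} n) = (\<Sum>n<m. ennreal (d n) * indicator {n. enat n < T} n)"
      by (rule suminf_finite) (auto simp: enat indicator_def)
    also have "\<dots> = (\<Sum>n<m. ennreal (d n))"
      by (rule sum.cong) (auto simp: enat)
    finally show ?thesis unfolding d_def[symmetric] by (simp add: sum enat)
  next
    case infinity
    have "filterlim (\<lambda>m. real m powr q) at_top sequentially"
      using assms by real_asymp
    then have "(\<lambda>m. \<Sum>n<m. ennreal (d n)) \<longlonglongrightarrow> \<infinity>"
      unfolding sum by (simp add: ennreal_tendsto_top_eq_at_top)
    moreover have "(\<lambda>m. \<Sum>n<m. ennreal (d n)) \<longlonglongrightarrow> (\<Sum>n. ennreal (d n))"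
      by (intro summable_LIMSEQ) auto
    ultimately show ?thesis
      unfolding d_def[symmetric] using LIMSEQ_unique by (auto simp: infinity)
  qed
qed

text \<open>After summation by parts, only the cylinders that avoid the ball up to time n occur.
  This removes the probability space from the rest of the argument.\<close>

lemma tau_moment_eq_suminf:
  assumes chain: "markov_chain_from (P x) \<xi> K x" and "q > 0"
  shows "tau_moment P \<xi> a q x =
    (\<Sum>n. ennreal (real (Suc n) powr q - real n powr q) * cyl K (\<lambda>_. {z. \<bar>z\<bar> > a}) n x)"
proof -
  have [measurable]: "\<And>n. \<xi> n \<in> borel_measurable (P x)"
    and "\<And>n A. (\<forall>i. A i \<in> sets borel) \<Longrightarrow> emeasure (P x) {\<omega> \<in> space (P x). \<forall>i\<le>n. \<xi> i \<omega> \<in> A i} = cyl K A n x"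
    using chain by (auto simp: markov_chain_from_def)
  from this(2)[of "\<lambda>_. {z. \<bar>z\<bar> > a}"]
  have cyl: "\<And>n. emeasure (P x) {\<omega> \<in> space (P x). \<forall>i\<le>n. \<bar>\<xi> i \<omega>\<bar> > a} = cyl K (\<lambda>_. {z. \<bar>z\<bar> > a}) n x"
    by simp
  define d where "d n = real (Suc n) powr q - real n powr q" for n
  have gt: "enat n < hit_time a \<xi> \<omega> \<longleftrightarrow> (\<forall>i\<le>n. \<bar>\<xi> i \<omega>\<bar> > a)" for n \<omega>
  proof (cases "\<exists>m. \<bar>\<xi> m \<omega>\<bar> \<le> a")
    case True
    then have L: "\<bar>\<xi> (LEAST m. \<bar>\<xi> m \<omega>\<bar> \<le> a) \<omega>\<bar> \<le> a" by (rule LeastI_ex)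
    have "n < (LEAST m. \<bar>\<xi> m \<omega>\<bar> \<le> a) \<longleftrightarrow> (\<forall>i\<le>n. \<bar>\<xi> i \<omega>\<bar> > a)"
    proof
      assume "n < (LEAST m. \<bar>\<xi> m \<omega>\<bar> \<le> a)"
      then show "\<forall>i\<le>n. \<bar>\<xi> i \<omega>\<bar> > a"
        by (meson le_less_trans not_less not_less_Least)
    next
      assume "\<forall>i\<le>n. \<bar>\<xi> i \<omega>\<bar> > a"
      then show "n < (LEAST m. \<bar>\<xi> m \<omega>\<bar> \<le> a)" using L by (meson not_less)
    qed
    then show ?thesis using True by (simp add: hit_time_def)
  next
    case False
    then have "hit_time a \<xi> \<omega> = \<infinity>" by (simp add: hit_time_def)
    then show ?thesis using False by (auto simp: not_le)
  qed
  have "tau_moment P \<xi> a q x = (\<integral>\<^sup>+ \<omega>. (\<Sum>n. ennreal (d n) * indicator {\<omega> \<in> space (P x). \<forall>i\<le>n. \<bar>\<xi> i \<omega>\<bar> > a} \<omega>) \<partial>P x)"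
    unfolding tau_moment_def suminf_powr_increments[OF \<open>q > 0\<close>, symmetric] d_def[symmetric]
    by (intro nn_integral_cong suminf_cong) (auto simp: gt indicator_def)
  also have "\<dots> = (\<Sum>n. \<integral>\<^sup>+ \<omega>. ennreal (d n) * indicator {\<omega> \<in> space (P x). \<forall>i\<le>n. \<bar>\<xi> i \<omega>\<bar> > a} \<omega> \<partial>P x)"
    by (rule nn_integral_suminf) measurable
  also have "\<dots> = (\<Sum>n. ennreal (d n) * cyl K (\<lambda>_. {z. \<bar>z\<bar> > a}) n x)"
  proof (rule suminf_cong)
    fix n
    have [measurable]: "{\<omega> \<in> space (P x). \<forall>i\<le>n. \<bar>\<xi> i \<omega>\<bar> > a} \<in> sets (P x)" by measurable
    show "(\<integral>\<^sup>+ \<omega>. ennreal (d n) * indicator {\<omega> \<in> space (P x). \<forall>i\<le>n. \<bar>\<xi> i \<omega>\<bar> > a} \<omega> \<partial>P x) =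
        ennreal (d n) * cyl K (\<lambda>_. {z. \<bar>z\<bar> > a}) n x"
      using cyl[of n] by (simp add: nn_integral_cmult)
  qed
  finally show ?thesis by (simp add: d_def)
qed

lemma powr_increment_bounds:
  fixes q :: real
  assumes "q > 0"
  shows "(\<lambda>n. real (Suc n) powr q - real n powr q) \<in> \<Theta>(\<lambda>n. real n powr (q - 1))"
proof -
  have "(\<lambda>n. real (Suc n) powr q - real n powr q) \<sim>[sequentially] (\<lambda>n. q * real n powr (q - 1))"
    using assms by real_asymp
  then have "(\<lambda>n. real (Suc n) powr q - real n powr q) \<in> \<Theta>(\<lambda>n. q * real n powr (q - 1))"
    by (rule asymp_equiv_imp_bigtheta)
  then show ?thesis using assms by simp
qed

context killed_chain begin

lemma tau_moment_finite:
  assumes chain: "markov_chain_from (P x) \<xi> K x" and "q > 0" "q < s"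
    and up: "eventually (\<lambda>n. survival a n x \<le> C * real n powr (- s)) sequentially"
  shows "tau_moment P \<xi> a q x < \<infinity>"
proof -
  define d where "d n = real (Suc n) powr q - real n powr q" for n
  have d: "d n \<ge> 0" for n using assms by (auto simp: d_def intro!: powr_mono2)
  have "(\<lambda>n. survival a n x) \<in> O(\<lambda>n. real n powr (- s))"
    by (rule bigoI[of _ C]) (use up in \<open>auto elim!: eventually_mono\<close>)
  moreover have "d \<in> O(\<lambda>n. real n powr (q - 1))"
    using powr_increment_bounds[OF \<open>q > 0\<close>] unfolding d_def[abs_def] by (rule bigthetaD1)
  ultimately have "(\<lambda>n. d n * survival a n x) \<in> O(\<lambda>n. real n powr (q - 1) * real n powr (- s))"
    by (intro landau_o.big.mult)
  also have "(\<lambda>n. real n powr (q - 1) * real n powr (- s)) = (\<lambda>n. real n powr (q - 1 - s))"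
    by (simp flip: powr_add)
  finally have "summable (\<lambda>n. d n * survival a n x)"
    by (rule summable_comparison_test_bigo[rotated]) (use \<open>q < s\<close> in \<open>simp add: summable_real_powr_iff\<close>)
  then have "(\<Sum>n. ennreal (d n * survival a n x)) \<noteq> \<top>"
    using d by (intro ennreal_suminf_neq_top) auto
  then show ?thesis
    unfolding tau_moment_eq_suminf[where P = P and x = x, OF chain \<open>q > 0\<close>] d_def[symmetric] ennreal_survival[symmetric]
    using d by (simp add: ennreal_mult less_top)
qed

text \<open>The comparison series has exponent q - 1 - s. It diverges even for q = s, where it is
  harmonic; this yields the closed bound on q in the drift regime.\<close>

lemma tau_moment_infinite:
  assumes chain: "markov_chain_from (P x) \<xi> K x" and "q > 0" "s \<le> q" and "C > 0"
    and low: "eventually (\<lambda>n. C * real n powr (- s) \<le> survival a n x) sequentially"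
  shows "tau_moment P \<xi> a q x = \<infinity>"
proof (rule ccontr)
  define d where "d n = real (Suc n) powr q - real n powr q" for n
  have d: "d n \<ge> 0" for n using assms by (auto simp: d_def intro!: powr_mono2)
  assume "tau_moment P \<xi> a q x \<noteq> \<infinity>"
  then have "(\<Sum>n. ennreal (d n * survival a n x)) \<noteq> \<top>"
    unfolding tau_moment_eq_suminf[where P = P and x = x, OF chain \<open>q > 0\<close>] d_def[symmetric] ennreal_survival[symmetric]
    using d by (simp add: ennreal_mult)
  then have S: "summable (\<lambda>n. d n * survival a n x)"
    using d by (intro summable_suminf_not_top) auto
  have "(\<lambda>n. real n powr (- s)) \<in> O(\<lambda>n. survival a n x)"
    by (rule bigoI[of _ "1 / C"]) (use low \<open>C > 0\<close> in \<open>auto elim!: eventually_mono simp: field_simps\<close>)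
  moreover have "(\<lambda>n. real n powr (q - 1)) \<in> O(d)"
    using powr_increment_bounds[OF \<open>q > 0\<close>] unfolding d_def[abs_def] by (simp add: bigtheta_sym bigthetaD1)
  ultimately have "(\<lambda>n. real n powr (q - 1) * real n powr (- s)) \<in> O(\<lambda>n. d n * survival a n x)"
    by (intro landau_o.big.mult)
  then have "(\<lambda>n. real n powr (q - 1 - s)) \<in> O(\<lambda>n. d n * survival a n x)"
    by (simp flip: powr_add)
  from summable_comparison_test_bigo[OF _ this] have "summable (\<lambda>n. real n powr (q - 1 - s))"
    using S d by simp
  then show False using \<open>s \<le> q\<close> by (simp add: summable_real_powr_iff)
qed

text \<open>The moment exponents are read off from the sign of \<open>\<kappa>\<close>, which decides whether
  \<open>\<bar>x\<bar> powr \<nu>\<close> is a supermartingale or a submartingale far from the origin.\<close>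

lemma tau_moment_finite_of_neg:
  assumes chain: "\<forall>x\<in>X. markov_chain_from (P x) \<xi> K x" and "q > 0"
    and "0 < \<nu>" "\<nu> < \<alpha>" "\<kappa> \<nu> < 0" "q < \<nu> / \<beta>"
  shows "\<exists>a0. \<forall>a\<ge>a0. \<forall>x\<in>X. \<bar>x\<bar> > a \<longrightarrow> tau_moment P \<xi> a q x < \<infinity>"
proof -
  \<comment> \<open>\<open>survival_upper_rate\<close> gives every decay exponent below
    \<open>\<nu> / \<beta>\<close> but not that value itself.\<close>
  obtain s where s: "q < s" "s < \<nu> / \<beta>" using dense[OF assms(6)] by blast
  with assms(2) have "0 < s" by simp
  from survival_upper_rate[OF assms(3-5) this s(2)] obtain a0 where
    "\<forall>a\<ge>a0. \<forall>x\<in>X. \<exists>C. eventually (\<lambda>n. survival a n x \<le> C * real n powr (- s)) sequentially" by blast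
  then show ?thesis
    using tau_moment_finite[OF _ \<open>q > 0\<close> s(1)] chain by (intro exI[of _ a0]) blast
qed

lemma tau_moment_infinite_of_pos:
  assumes chain: "\<forall>x\<in>X. markov_chain_from (P x) \<xi> K x" and "q > 0"
    and "0 < \<nu>" "\<nu> < \<alpha>" "\<kappa> \<nu> > 0" "\<nu> / \<beta> \<le> q"
  shows "\<exists>a0. \<forall>a\<ge>a0. \<forall>x\<in>X. \<bar>x\<bar> > a \<longrightarrow> tau_moment P \<xi> a q x = \<infinity>"
proof -
  obtain \<mu> where \<mu>: "\<nu> < \<mu>" "\<mu> < \<alpha>" using dense[OF assms(4)] by blast
  from survival_lower_rate[OF assms(3) this assms(5)] obtain a0 where
    "\<forall>a\<ge>a0. \<forall>x\<in>X. \<bar>x\<bar> > a \<longrightarrow>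
      (\<exists>C>0. eventually (\<lambda>n. C * real n powr (- (\<nu> / \<beta>)) \<le> survival a n x) sequentially)" by blast
  then show ?thesis
    using tau_moment_infinite[OF _ \<open>q > 0\<close> assms(6)] chain by (intro exI[of _ a0]) blast
qed

lemma tau_moment_infinite_one_jump:
  assumes chain: "\<forall>x\<in>X. markov_chain_from (P x) \<xi> K x" and "q > 0" "\<alpha> / \<beta> \<le> q"
  shows "\<exists>a0. \<forall>a\<ge>a0. \<forall>x\<in>X. \<bar>x\<bar> > a \<longrightarrow> tau_moment P \<xi> a q x = \<infinity>"
proof -
  from survival_lower_rate_one_jump obtain a0 where
    "\<forall>a\<ge>a0. \<forall>x\<in>X. \<bar>x\<bar> > a \<longrightarrow>
      (\<exists>C>0. eventually (\<lambda>n. C * real n powr (- (\<alpha> / \<beta>)) \<le> survival a n x) sequentially)" by blast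
  then show ?thesis
    using tau_moment_infinite[OF _ \<open>q > 0\<close> assms(3)] chain by (intro exI[of _ a0]) blast
qed

text \<open>\<open>\<kappa>\<close> is convex because \<open>\<nu> \<mapsto> t powr \<nu>\<close> is, so no convexity property of the Gamma function is needed.\<close>
lemma \<kappa>_convex:
  assumes "\<not> bounded X" and \<nu>: "0 < \<nu>0" "\<nu>0 < \<nu>2" "\<nu>2 < \<alpha>" and l: "0 < l" "l < 1"
  shows "\<kappa> (l * \<nu>0 + (1 - l) * \<nu>2) \<le> l * \<kappa> \<nu>0 + (1 - l) * \<kappa> \<nu>2"
proof (rule tendsto_le)
  \<comment> \<open>Inequalities pass to the limit only along a proper filter, and properness is
    exactly unboundedness of X.\<close>
  show "to_infinity_in X \<noteq> bot"
  proof -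
    have "\<exists>x\<in>X. \<bar>x\<bar> > a" for a
      using assms(1) by (auto simp: bounded_iff not_le)
    then have "\<not> eventually (\<lambda>_. False) (to_infinity_in X)"
      by (auto simp: eventually_to_infinity_in)
    then show ?thesis by (simp add: trivial_limit_def)
  qed
next
  define \<nu>1 where "\<nu>1 = l * \<nu>0 + (1 - l) * \<nu>2"
  have \<nu>1: "0 < \<nu>1" "\<nu>1 < \<alpha>"
  proof -
    show "0 < \<nu>1" unfolding \<nu>1_def using \<nu> l by (intro add_pos_pos mult_pos_pos) auto
    have "\<nu>1 = \<nu>2 - l * (\<nu>2 - \<nu>0)" by (simp add: \<nu>1_def algebra_simps)
    moreover have "0 < l * (\<nu>2 - \<nu>0)" using \<nu> l by simp
    ultimately show "\<nu>1 < \<alpha>" using \<nu> by linarith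
  qed
  have \<nu>0: "\<nu>0 < \<alpha>" and \<nu>2: "0 < \<nu>2" using \<nu> by auto
  show "((\<lambda>x. \<bar>x\<bar> powr \<beta> * (moment_ratio (l * \<nu>0 + (1 - l) * \<nu>2) x - 1)) \<longlongrightarrow> \<kappa> (l * \<nu>0 + (1 - l) * \<nu>2)) (to_infinity_in X)"
    using ratio_limit[OF \<nu>1] by (simp add: \<nu>1_def)
  show "((\<lambda>x. l * (\<bar>x\<bar> powr \<beta> * (moment_ratio \<nu>0 x - 1)) + (1 - l) * (\<bar>x\<bar> powr \<beta> * (moment_ratio \<nu>2 x - 1)))
    \<longlongrightarrow> l * \<kappa> \<nu>0 + (1 - l) * \<kappa> \<nu>2) (to_infinity_in X)"
    by (intro tendsto_intros ratio_limit \<nu> \<nu>0 \<nu>2)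
  show "eventually (\<lambda>x. \<bar>x\<bar> powr \<beta> * (moment_ratio (l * \<nu>0 + (1 - l) * \<nu>2) x - 1) \<le>
    l * (\<bar>x\<bar> powr \<beta> * (moment_ratio \<nu>0 x - 1)) + (1 - l) * (\<bar>x\<bar> powr \<beta> * (moment_ratio \<nu>2 x - 1))) (to_infinity_in X)"
    unfolding eventually_to_infinity_in
  proof (intro exI[of _ "max 0 x0"] ballI impI)
    fix x assume x: "x \<in> X" "max 0 x0 < \<bar>x\<bar>"
    then have x': "\<bar>x\<bar> \<ge> x0" "x \<noteq> 0" by auto
    \<comment> \<open>Since \<open>t powr \<nu> = exp (\<nu> * ln t)\<close>, this is convexity of
      exp along the exponent.\<close>
    have conv: "t powr \<nu>1 \<le> l * t powr \<nu>0 + (1 - l) * t powr \<nu>2" if "t \<ge> 0" for t :: real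
    proof (cases "t = 0")
      case False
      then have t: "t > 0" using that by simp
      have "convex_on UNIV (exp :: real \<Rightarrow> real)" by (rule exp_convex)
      from convex_onD[OF this, of "1 - l" "\<nu>0 * ln t" "\<nu>2 * ln t"] l
      have "exp (l * (\<nu>0 * ln t) + (1 - l) * (\<nu>2 * ln t)) \<le> l * exp (\<nu>0 * ln t) + (1 - l) * exp (\<nu>2 * ln t)"
        by simp
      then show ?thesis using t by (simp add: powr_def \<nu>1_def algebra_simps)
    qed simp
    have I: "integrable (K x) (\<lambda>z. \<bar>z / x\<bar> powr \<nu>)" if "0 < \<nu>" "\<nu> < \<alpha>" for \<nu>
      using moment_ratio_expansion(1)[OF that x(1) x'] .
    have "moment_ratio \<nu>1 x \<le> (\<integral>z. l * \<bar>z / x\<bar> powr \<nu>0 + (1 - l) * \<bar>z / x\<bar> powr \<nu>2 \<partial>K x)"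
      unfolding moment_ratio_def
      by (intro integral_mono I \<nu>1 Bochner_Integration.integrable_add integrable_mult_right \<nu> \<nu>0 \<nu>2 conv) auto
    also have "\<dots> = l * moment_ratio \<nu>0 x + (1 - l) * moment_ratio \<nu>2 x"
      unfolding moment_ratio_def using I[OF \<nu>(1) \<nu>0] I[OF \<nu>2 \<nu>(3)] by simp
    finally have "\<bar>x\<bar> powr \<beta> * (moment_ratio \<nu>1 x - 1) \<le> \<bar>x\<bar> powr \<beta> * (l * moment_ratio \<nu>0 x + (1 - l) * moment_ratio \<nu>2 x - 1)"
      by (intro mult_left_mono) auto
    also have "\<dots> = l * (\<bar>x\<bar> powr \<beta> * (moment_ratio \<nu>0 x - 1)) + (1 - l) * (\<bar>x\<bar> powr \<beta> * (moment_ratio \<nu>2 x - 1))"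
      by (simp add: algebra_simps)
    finally show "\<bar>x\<bar> powr \<beta> * (moment_ratio (l * \<nu>0 + (1 - l) * \<nu>2) x - 1) \<le>
      l * (\<bar>x\<bar> powr \<beta> * (moment_ratio \<nu>0 x - 1)) + (1 - l) * (\<bar>x\<bar> powr \<beta> * (moment_ratio \<nu>2 x - 1))"
      by (simp add: \<nu>1_def)
  qed
qed

end

section \<open>The three regimes\<close>

context heavy_tailed_kernel begin

lemma filterlim_abs_to_infinity_in: "filterlim abs at_top (to_infinity_in X)"
  unfolding filterlim_at_top eventually_to_infinity_in by (metis less_imp_le)

lemma eventually_nonzero_to_infinity_in: "eventually (\<lambda>x. x \<noteq> 0) (to_infinity_in X)"
  unfolding eventually_to_infinity_in by (intro exI[of _ 0]) auto

lemma powr_tendsto_0_to_infinity_in: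
  assumes "s < 0"
  shows "((\<lambda>x. \<bar>x\<bar> powr s) \<longlongrightarrow> 0) (to_infinity_in X)"
proof -
  have "((\<lambda>t::real. t powr s) \<longlongrightarrow> 0) at_top"
    using assms by real_asymp
  from filterlim_compose[OF this filterlim_abs_to_infinity_in] show ?thesis by simp
qed

lemma drift_rescaled:
  assumes "x \<noteq> 0"
  shows "\<bar>x\<bar> powr s * (drift_K x / x) = \<bar>x\<bar> powr (s - 1 - \<gamma>) * (\<bar>x\<bar> powr \<gamma> * (sgn x * drift_K x))"
proof -
  have "\<bar>x\<bar> powr s = \<bar>x\<bar> powr (s - 1 - \<gamma>) * \<bar>x\<bar> powr \<gamma> * \<bar>x\<bar>"
    using assms by (simp add: powr_diff)
  moreover have "\<bar>x\<bar> * (drift_K x / x) = sgn x * drift_K x"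
    using assms by (simp add: sgn_if)
  ultimately show ?thesis by (metis mult.assoc)
qed

text \<open>On the scale \<open>\<bar>x\<bar> powr \<alpha>\<close> the drift contributes with order
  \<alpha> - 1 - \<gamma>: it has a limit b for equality and vanishes otherwise.\<close>

lemma ratio_limit_diffusive:
  assumes D: "((\<lambda>x. \<bar>x\<bar> powr \<gamma> * (sgn x * drift_K x)) \<longlongrightarrow> b) (to_infinity_in X)"
    and "\<alpha> - 1 \<le> \<gamma>" and \<nu>: "0 < \<nu>" "\<nu> < \<alpha>"
  shows "((\<lambda>x. \<bar>x\<bar> powr \<alpha> * (moment_ratio \<nu> x - 1)) \<longlongrightarrow>
    \<nu> * ((if \<gamma> = \<alpha> - 1 then b else 0) - c * nu_rhs \<alpha> \<nu>)) (to_infinity_in X)"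
proof -
  define b' where "b' = (if \<gamma> = \<alpha> - 1 then b else 0)"
  have "((\<lambda>x. \<bar>x\<bar> powr (\<alpha> - 1 - \<gamma>) * (\<bar>x\<bar> powr \<gamma> * (sgn x * drift_K x))) \<longlongrightarrow> b') (to_infinity_in X)"
  proof (cases "\<gamma> = \<alpha> - 1")
    case True
    have "eventually (\<lambda>x. \<bar>x\<bar> powr \<gamma> * (sgn x * drift_K x) = \<bar>x\<bar> powr (\<alpha> - 1 - \<gamma>) * (\<bar>x\<bar> powr \<gamma> * (sgn x * drift_K x))) (to_infinity_in X)"
      using eventually_nonzero_to_infinity_in by eventually_elim (simp add: True)
    from Lim_transform_eventually[OF D this] show ?thesis by (simp add: b'_def True)
  next
    case False
    then show ?thesis
      using tendsto_mult[OF powr_tendsto_0_to_infinity_in D, of "\<alpha> - 1 - \<gamma>"] assms(2) by (simp add: b'_def)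
  qed
  from tendsto_add[OF moment_ratio_limit[OF \<nu>] tendsto_mult[OF tendsto_const[of \<nu>] this]]
  have L: "((\<lambda>x. \<bar>x\<bar> powr \<alpha> * (moment_ratio \<nu> x - 1) - \<nu> * (\<bar>x\<bar> powr \<alpha> * (drift_K x / x)) +
       \<nu> * (\<bar>x\<bar> powr (\<alpha> - 1 - \<gamma>) * (\<bar>x\<bar> powr \<gamma> * (sgn x * drift_K x)))) \<longlongrightarrow>
    \<nu> * (b' - c * nu_rhs \<alpha> \<nu>)) (to_infinity_in X)"
    by (simp add: algebra_simps)
  have "eventually (\<lambda>x. \<bar>x\<bar> powr \<alpha> * (moment_ratio \<nu> x - 1) - \<nu> * (\<bar>x\<bar> powr \<alpha> * (drift_K x / x)) +
       \<nu> * (\<bar>x\<bar> powr (\<alpha> - 1 - \<gamma>) * (\<bar>x\<bar> powr \<gamma> * (sgn x * drift_K x)))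
     = \<bar>x\<bar> powr \<alpha> * (moment_ratio \<nu> x - 1)) (to_infinity_in X)"
    using eventually_nonzero_to_infinity_in
  proof eventually_elim
    case (elim x)
    show ?case unfolding drift_rescaled[OF elim, of \<alpha> \<gamma>] by simp
  qed
  from Lim_transform_eventually[OF L this] show ?thesis by (simp add: b'_def)
qed

text \<open>Here the jumps contribute a relative change of order
  \<open>\<bar>x\<bar> powr (- \<alpha>)\<close>, negligible against the drift of order
  \<open>\<bar>x\<bar> powr (- (\<gamma> + 1))\<close>.\<close>

lemma ratio_limit_drift:
  assumes D: "((\<lambda>x. \<bar>x\<bar> powr \<gamma> * (sgn x * drift_K x)) \<longlongrightarrow> b) (to_infinity_in X)"
    and "\<gamma> < \<alpha> - 1" and \<nu>: "0 < \<nu>" "\<nu> < \<alpha>"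
  shows "((\<lambda>x. \<bar>x\<bar> powr (\<gamma> + 1) * (moment_ratio \<nu> x - 1)) \<longlongrightarrow> \<nu> * b) (to_infinity_in X)"
proof -
  have "((\<lambda>x. \<bar>x\<bar> powr (\<gamma> + 1 - \<alpha>) * (\<bar>x\<bar> powr \<alpha> * (moment_ratio \<nu> x - 1) - \<nu> * (\<bar>x\<bar> powr \<alpha> * (drift_K x / x)))
      + \<nu> * (\<bar>x\<bar> powr \<gamma> * (sgn x * drift_K x))) \<longlongrightarrow> 0 * - (c * \<nu> * nu_rhs \<alpha> \<nu>) + \<nu> * b) (to_infinity_in X)"
    using assms(2) by (intro tendsto_intros powr_tendsto_0_to_infinity_in moment_ratio_limit D \<nu>) auto
  moreover have "eventually (\<lambda>x. \<bar>x\<bar> powr (\<gamma> + 1 - \<alpha>) * (\<bar>x\<bar> powr \<alpha> * (moment_ratio \<nu> x - 1) - \<nu> * (\<bar>x\<bar> powr \<alpha> * (drift_K x / x)))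
      + \<nu> * (\<bar>x\<bar> powr \<gamma> * (sgn x * drift_K x)) = \<bar>x\<bar> powr (\<gamma> + 1) * (moment_ratio \<nu> x - 1)) (to_infinity_in X)"
    using eventually_nonzero_to_infinity_in
  proof eventually_elim
    case (elim x)
    have p: "\<bar>x\<bar> powr (\<gamma> + 1 - \<alpha>) * (\<bar>x\<bar> powr \<alpha> * t) = \<bar>x\<bar> powr (\<gamma> + 1) * t" for t
      using elim by (simp flip: powr_add mult.assoc)
    have d: "\<bar>x\<bar> powr (\<gamma> + 1) * (drift_K x / x) = \<bar>x\<bar> powr \<gamma> * (sgn x * drift_K x)"
      using drift_rescaled[OF elim, of "\<gamma> + 1" \<gamma>] elim by simp
    show ?case
      unfolding right_diff_distrib mult.left_commute[of _ \<nu>] p d by simp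
  qed
  ultimately show ?thesis
    using Lim_transform_eventually by fastforce
qed

end

context killed_chain begin

text \<open>The limits of \<open>nu_rhs\<close> make \<open>\<kappa>\<close> negative near 0 and
  positive near \<alpha>, so it has a zero in between. By convexity a function that is negative
  somewhere to the left of a zero stays negative up to it and is positive after it.\<close>

lemma critical_exponent:
  assumes "\<not> bounded X" and \<kappa>: "\<And>\<nu>. \<kappa> \<nu> = \<nu> * (b - c * nu_rhs \<alpha> \<nu>)"
    and neg: "b + c * pi * cot (pi * \<alpha> / 2) < 0"
  obtains \<nu>s where "0 < \<nu>s" "\<nu>s < \<alpha>" "\<And>\<nu>. 0 < \<nu> \<Longrightarrow> \<nu> < \<alpha> \<Longrightarrow> nu_eq \<alpha> b c \<nu> \<longleftrightarrow> \<nu> = \<nu>s"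
    "\<And>\<nu>. 0 < \<nu> \<Longrightarrow> \<nu> < \<nu>s \<Longrightarrow> \<kappa> \<nu> < 0" "\<And>\<nu>. \<nu>s < \<nu> \<Longrightarrow> \<nu> < \<alpha> \<Longrightarrow> \<kappa> \<nu> > 0"
proof -
  have nu_eq: "nu_eq \<alpha> b c \<nu> \<longleftrightarrow> b / c = nu_rhs \<alpha> \<nu>" for \<nu>
    by (simp add: nu_eq_def nu_rhs_def)
  have k0: "\<kappa> \<nu> = 0 \<longleftrightarrow> b / c = nu_rhs \<alpha> \<nu>" if "0 < \<nu>" for \<nu>
    using that c by (auto simp: \<kappa> field_simps)
  have "b / c < - (pi * cot (pi * \<alpha> / 2))"
    using neg c by (simp add: field_simps)
  from order_tendstoD(1)[OF tendsto_nu_rhs_0[OF \<alpha>] this]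
  obtain \<eta> where \<eta>: "\<eta> > 0" "\<And>\<nu>. 0 < \<nu> \<Longrightarrow> \<nu> < \<eta> \<Longrightarrow> b / c < nu_rhs \<alpha> \<nu>"
    by (auto simp: eventually_at_right[of 0 1])
  have \<kappa>_small: "\<kappa> \<nu> < 0" if "0 < \<nu>" "\<nu> < \<eta>" for \<nu>
    using \<eta>(2)[OF that] that c by (auto simp: \<kappa> field_simps intro!: mult_pos_neg)
  have "eventually (\<lambda>\<nu>. nu_rhs \<alpha> \<nu> < b / c) (at_left \<alpha>)"
    using filterlim_nu_rhs_at_left[OF \<alpha>] by (simp add: filterlim_at_bot_dense)
  then obtain \<zeta> where \<zeta>: "\<zeta> < \<alpha>" "\<And>\<nu>. \<zeta> < \<nu> \<Longrightarrow> \<nu> < \<alpha> \<Longrightarrow> nu_rhs \<alpha> \<nu> < b / c"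
    using \<alpha> by (auto simp: eventually_at_left[of 0 \<alpha>])
  obtain p where p: "0 < p" "p < min \<eta> \<alpha>" using dense[of 0 "min \<eta> \<alpha>"] \<eta> \<alpha> by auto
  obtain r where r: "max p \<zeta> < r" "r < \<alpha>" using dense[of "max p \<zeta>" \<alpha>] p \<zeta> by auto
  have "continuous_on {p..r} (nu_rhs \<alpha>)"
    by (rule continuous_on_subset[OF continuous_on_nu_rhs[OF \<alpha>]]) (use p r in auto)
  then obtain \<nu>s where s: "p \<le> \<nu>s" "\<nu>s \<le> r" "nu_rhs \<alpha> \<nu>s = b / c"
    using IVT2'[of "nu_rhs \<alpha>" r "b / c" p] p r \<eta>(2)[of p] \<zeta>(2)[of r] by fastforce
  have s': "0 < \<nu>s" "\<nu>s < \<alpha>" "\<kappa> \<nu>s = 0" using s p r k0[of \<nu>s] by auto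
  have below: "\<kappa> \<nu> < 0" if \<nu>: "0 < \<nu>" "\<nu> < \<nu>s" for \<nu>
  proof (cases "\<nu> < \<eta>")
    case True
    then show ?thesis using \<kappa>_small \<nu> by blast
  next
    case False
    obtain u where u: "0 < u" "u < min \<eta> \<nu>" using dense[of 0 "min \<eta> \<nu>"] \<eta> \<nu> by auto
    \<comment> \<open>The weight that places \<nu> between u, where \<open>\<kappa>\<close> is
      negative, and the zero.\<close>
    define l where "l = (\<nu>s - \<nu>) / (\<nu>s - u)"
    have l: "0 < l" "l < 1" using u \<nu> by (auto simp: l_def)
    have "l * (\<nu>s - u) = \<nu>s - \<nu>" using u \<nu> by (simp add: l_def)
    then have "l * u + (1 - l) * \<nu>s = \<nu>" by (simp add: algebra_simps)
    then have "\<kappa> \<nu> \<le> l * \<kappa> u + (1 - l) * \<kappa> \<nu>s"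
      using \<kappa>_convex[OF assms(1) u(1) _ s'(2) l] u \<nu> by simp
    moreover have "l * \<kappa> u < 0" using l \<kappa>_small[of u] u by (intro mult_pos_neg) auto
    ultimately show ?thesis using s' by simp
  qed
  have above: "\<kappa> \<nu> > 0" if \<nu>: "\<nu>s < \<nu>" "\<nu> < \<alpha>" for \<nu>
  proof -
    obtain u where u: "0 < u" "u < \<nu>s" using dense[OF s'(1)] by blast
    \<comment> \<open>Now the zero lies between u and \<nu>, so a negative value at u forces a
      positive one at \<nu>.\<close>
    define l where "l = (\<nu> - \<nu>s) / (\<nu> - u)"
    have l: "0 < l" "l < 1" using u \<nu> by (auto simp: l_def)
    have "l * (\<nu> - u) = \<nu> - \<nu>s" using u \<nu> by (simp add: l_def)
    then have "l * u + (1 - l) * \<nu> = \<nu>s" by (simp add: algebra_simps)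
    then have "\<kappa> \<nu>s \<le> l * \<kappa> u + (1 - l) * \<kappa> \<nu>"
      using \<kappa>_convex[OF assms(1) u(1) _ \<nu>(2) l] u \<nu> by simp
    moreover have "l * \<kappa> u < 0" using l below[OF u] by (intro mult_pos_neg) auto
    ultimately have "0 < (1 - l) * \<kappa> \<nu>" using s' by linarith
    then show ?thesis using l by (simp add: zero_less_mult_iff)
  qed
  show ?thesis
  proof (rule that[OF s'(1,2) _ below above])
    fix \<nu> assume \<nu>: "0 < \<nu>" "\<nu> < \<alpha>"
    show "nu_eq \<alpha> b c \<nu> \<longleftrightarrow> \<nu> = \<nu>s"
      using below[of \<nu>] above[of \<nu>] k0[OF \<nu>(1)] \<nu> s' s(3) unfolding nu_eq
      by (cases \<nu> \<nu>s rule: linorder_cases) auto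
  qed
qed

end

section \<open>From the process to its transition kernel\<close>

lemma chain_first_step:
  assumes chain: "markov_chain_from M \<xi> K x" and K: "K \<in> measurable borel (prob_algebra borel)"
  shows "AE \<omega> in M. \<xi> 0 \<omega> = x" "distr M borel (\<xi> 1) = K x"
proof -
  have [measurable]: "\<And>n. \<xi> n \<in> borel_measurable M" and "prob_space M"
    and cyl: "\<And>n A. (\<And>i. A i \<in> sets borel) \<Longrightarrow> emeasure M {\<omega> \<in> space M. \<forall>i\<le>n. \<xi> i \<omega> \<in> A i} = cyl K A n x"
    using chain by (auto simp: markov_chain_from_def)
  interpret prob_space M by fact
  have "emeasure M {\<omega> \<in> space M. \<xi> 0 \<omega> = x} = 1"
    using cyl[of "\<lambda>_. {x}" 0] by simp
  then have "prob {\<omega> \<in> space M. \<xi> 0 \<omega> = x} = 1"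
    by (simp add: measure_def)
  then show "AE \<omega> in M. \<xi> 0 \<omega> = x"
    by (subst (asm) prob_Collect_eq_1) auto
  have sets: "sets (K x) = sets borel"
    using measurable_space[OF K, of x] by (auto simp: space_prob_algebra)
  show "distr M borel (\<xi> 1) = K x"
  proof (rule measure_eqI)
    fix A assume "A \<in> sets (distr M borel (\<xi> 1))"
    then have A [measurable]: "A \<in> sets borel" by simp
    have "emeasure (distr M borel (\<xi> 1)) A = emeasure M {\<omega> \<in> space M. \<forall>i\<le>1. \<xi> i \<omega> \<in> (if i = 1 then A else UNIV)}"
      by (subst emeasure_distr) (auto intro!: arg_cong[where f = "emeasure M"] simp: le_Suc_eq)
    also have "\<dots> = cyl K (\<lambda>i. if i = 1 then A else UNIV) 1 x"
      by (rule cyl) auto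
    also have "\<dots> = emeasure (K x) A"
      using A sets by simp
    finally show "emeasure (distr M borel (\<xi> 1)) A = emeasure (K x) A" .
  qed (simp add: sets)
qed

text \<open>Positive and negative parts are never below 0, so the agreement of the tails is stated
  for \<open>0 \<le> y\<close>.\<close>

lemma measure_increment_eq:
  assumes chain: "markov_chain_from M \<xi> K x" and K: "K \<in> measurable borel (prob_algebra borel)" and "0 \<le> y"
  shows "measure M {\<omega> \<in> space M. pospart (theta \<xi> \<omega>) > y} = measure (K x) {z. z - x > y}"
    "measure M {\<omega> \<in> space M. negpart (theta \<xi> \<omega>) > y} = measure (K x) {z. x - z > y}"
proof -
  have [measurable]: "\<And>n. \<xi> n \<in> borel_measurable M"
    using chain by (auto simp: markov_chain_from_def)
  note first = chain_first_step[OF chain K]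
  have *: "measure M {\<omega> \<in> space M. Q (theta \<xi> \<omega>)} = measure (K x) {z. Q (z - x)}"
    if [measurable]: "Measurable.pred borel Q" for Q :: "real \<Rightarrow> bool"
  proof -
    have "measure (K x) {z. Q (z - x)} = measure M {\<omega> \<in> space M. Q (\<xi> 1 \<omega> - x)}"
      unfolding first(2)[symmetric] by (subst measure_distr) (auto intro!: arg_cong[where f = "measure M"])
    also have "\<dots> = measure M {\<omega> \<in> space M. Q (theta \<xi> \<omega>)}"
    proof (rule measure_eq_AE)
      show "AE \<omega> in M. \<omega> \<in> {\<omega> \<in> space M. Q (\<xi> 1 \<omega> - x)} \<longleftrightarrow> \<omega> \<in> {\<omega> \<in> space M. Q (theta \<xi> \<omega>)}"
        using first(1) by eventually_elim (auto simp: theta_def)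
    qed (unfold theta_def, measurable)
    finally show ?thesis by simp
  qed
  have "pospart t > y \<longleftrightarrow> t > y" "negpart t > y \<longleftrightarrow> - t > y" for t
    using \<open>0 \<le> y\<close> by (auto simp: pospart_def negpart_def)
  then show "measure M {\<omega> \<in> space M. pospart (theta \<xi> \<omega>) > y} = measure (K x) {z. z - x > y}"
    "measure M {\<omega> \<in> space M. negpart (theta \<xi> \<omega>) > y} = measure (K x) {z. x - z > y}"
    using *[of "\<lambda>t. t > y"] *[of "\<lambda>t. - t > y"] by simp_all
qed

lemma drift_eq:
  assumes chain: "markov_chain_from (P x) \<xi> K x" and K: "K \<in> measurable borel (prob_algebra borel)"
  shows "drift P \<xi> x = (\<integral>z. z - x \<partial>K x)"
proof -
  have [measurable]: "\<And>n. \<xi> n \<in> borel_measurable (P x)"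
    using chain by (auto simp: markov_chain_from_def)
  note first = chain_first_step[OF chain K]
  have "(\<integral>z. z - x \<partial>K x) = (\<integral>\<omega>. \<xi> 1 \<omega> - x \<partial>P x)"
    unfolding first(2)[symmetric] by (rule integral_distr) measurable
  also have "\<dots> = drift P \<xi> x"
    unfolding drift_def theta_def
  proof (rule integral_cong_AE)
    show "AE \<omega> in P x. \<xi> 1 \<omega> - x = \<xi> 1 \<omega> - \<xi> 0 \<omega>"
      using first(1) by eventually_elim simp
  qed measurable
  finally show ?thesis by simp
qed

lemma Tbal_imp_heavy_tailed_kernel:
  assumes K: "K \<in> measurable borel (prob_algebra borel)"
    and chain: "\<forall>x\<in>X. markov_chain_from (P x) \<xi> K x" and T: "Tbal X P \<xi> \<alpha> c"
  shows "\<exists>x0. heavy_tailed_kernel X K \<alpha> c x0"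
proof -
  obtain x0 where x0: "\<forall>\<epsilon>>0. \<exists>Y. \<forall>y\<ge>Y. \<forall>x\<in>X. \<bar>x\<bar> \<ge> x0 \<longrightarrow>
        \<bar>y powr \<alpha> * measure (P x) {\<omega> \<in> space (P x). pospart (theta \<xi> \<omega>) > y} - c\<bar> \<le> \<epsilon> \<and>
        \<bar>y powr \<alpha> * measure (P x) {\<omega> \<in> space (P x). negpart (theta \<xi> \<omega>) > y} - c\<bar> \<le> \<epsilon>"
    using T unfolding Tbal_def by blast
  have "heavy_tailed_kernel X K \<alpha> c x0"
  proof
    fix \<epsilon> :: real assume "0 < \<epsilon>"
    then obtain Y where Y: "\<forall>y\<ge>Y. \<forall>x\<in>X. \<bar>x\<bar> \<ge> x0 \<longrightarrow>
        \<bar>y powr \<alpha> * measure (P x) {\<omega> \<in> space (P x). pospart (theta \<xi> \<omega>) > y} - c\<bar> \<le> \<epsilon> \<and>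
        \<bar>y powr \<alpha> * measure (P x) {\<omega> \<in> space (P x). negpart (theta \<xi> \<omega>) > y} - c\<bar> \<le> \<epsilon>"
      using x0 by blast
    show "\<exists>Y. \<forall>y\<ge>Y. \<forall>x\<in>X. x0 \<le> \<bar>x\<bar> \<longrightarrow>
        \<bar>y powr \<alpha> * measure (K x) {z. y < z - x} - c\<bar> \<le> \<epsilon> \<and>
        \<bar>y powr \<alpha> * measure (K x) {z. y < x - z} - c\<bar> \<le> \<epsilon>"
    \<comment> \<open>The threshold is raised to 0 because the tails of process and kernel are
      identified for nonnegative y only.\<close>
    proof (intro exI[of _ "max 0 Y"] allI impI ballI)
      fix y x assume y: "max 0 Y \<le> y" and x: "x \<in> X" "x0 \<le> \<bar>x\<bar>"
      have "markov_chain_from (P x) \<xi> K x" "0 \<le> y" using chain x y by auto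
      note m = measure_increment_eq[OF this(1) K this(2)]
      show "\<bar>y powr \<alpha> * measure (K x) {z. y < z - x} - c\<bar> \<le> \<epsilon> \<and>
        \<bar>y powr \<alpha> * measure (K x) {z. y < x - z} - c\<bar> \<le> \<epsilon>"
        unfolding m[symmetric] using Y x y by simp
    qed
  qed (use K T in \<open>auto simp: Tbal_def\<close>)
  then show ?thesis ..
qed

text \<open>The factor \<open>sgn x\<close> absorbs the minus sign at the negative end: both limits
  say that the drift away from the origin has the same leading coefficient b.\<close>

lemma Dprime_imp_tendsto:
  assumes D: "Dprime X P \<xi> \<gamma> b" and d: "\<And>x. x \<in> X \<Longrightarrow> drift P \<xi> x = d x"
  shows "((\<lambda>x. \<bar>x\<bar> powr \<gamma> * (sgn x * d x)) \<longlongrightarrow> b) (to_infinity_in X)"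
  unfolding tendsto_iff
proof (intro allI impI)
  fix e :: real assume "e > 0"
  then have "eventually (\<lambda>x. dist (x powr \<gamma> * drift P \<xi> x) b < e) (inf at_top (principal X))"
    "eventually (\<lambda>x. dist (- (\<bar>x\<bar> powr \<gamma> * drift P \<xi> x)) b < e) (inf at_bot (principal X))"
    using D by (auto simp: Dprime_def tendsto_iff)
  then obtain N1 N2 where N: "\<And>x. x \<ge> N1 \<Longrightarrow> x \<in> X \<Longrightarrow> dist (x powr \<gamma> * drift P \<xi> x) b < e"
    "\<And>x. x \<le> N2 \<Longrightarrow> x \<in> X \<Longrightarrow> dist (- (\<bar>x\<bar> powr \<gamma> * drift P \<xi> x)) b < e"
    unfolding eventually_inf_principal eventually_at_top_linorder eventually_at_bot_linorder by blast
  show "eventually (\<lambda>x. dist (\<bar>x\<bar> powr \<gamma> * (sgn x * d x)) b < e) (to_infinity_in X)"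
    unfolding eventually_to_infinity_in
  proof (intro exI[of _ "max \<bar>N1\<bar> \<bar>N2\<bar>"] ballI impI)
    fix x assume x: "x \<in> X" "max \<bar>N1\<bar> \<bar>N2\<bar> < \<bar>x\<bar>"
    show "dist (\<bar>x\<bar> powr \<gamma> * (sgn x * d x)) b < e"
    proof (cases "x > 0")
      case True
      then show ?thesis using N(1)[of x] x d[OF x(1)] by auto
    next
      case False
      then have "x < 0" "x \<le> N2" using x by auto
      then show ?thesis using N(2)[of x] x d[OF x(1)] by auto
    qed
  qed
qed

text \<open>A and B depend on neither a nor x, so each case may bring its own radius. This matters
  because the radius depends on the auxiliary exponent chosen for q.\<close>

lemma conj_cases_outside_ball:
  fixes X :: "real set"
  assumes "A \<Longrightarrow> \<exists>a0. \<forall>a\<ge>a0. \<forall>x\<in>X. \<bar>x\<bar> > a \<longrightarrow> Q a x"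
    and "B \<Longrightarrow> \<exists>a0. \<forall>a\<ge>a0. \<forall>x\<in>X. \<bar>x\<bar> > a \<longrightarrow> R a x"
  shows "\<exists>a0::real. \<forall>a\<ge>a0. \<forall>x\<in>X. \<bar>x\<bar> > a \<longrightarrow> (A \<longrightarrow> Q a x) \<and> (B \<longrightarrow> R a x)"
proof -
  obtain a1 where "A \<longrightarrow> (\<forall>a\<ge>a1. \<forall>x\<in>X. \<bar>x\<bar> > a \<longrightarrow> Q a x)" using assms(1) by blast
  moreover obtain a2 where "B \<longrightarrow> (\<forall>a\<ge>a2. \<forall>x\<in>X. \<bar>x\<bar> > a \<longrightarrow> R a x)" using assms(2) by blast
  ultimately show ?thesis by (intro exI[of _ "max a1 a2"]) auto
qed

theorem theorem2p8:
  fixes X :: "real set" and K :: "real \<Rightarrow> real measure"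
    and P :: "real \<Rightarrow> 'w measure" and \<xi> :: "nat \<Rightarrow> 'w \<Rightarrow> real"
    and \<alpha> c \<gamma> b q :: real
  assumes X: "X \<in> sets borel" "infinite X" "\<not> bounded X"
    and K: "K \<in> measurable borel (prob_algebra borel)"
      "\<forall>x\<in>X. emeasure (K x) (UNIV - X) = 0"
    and chain: "\<forall>x\<in>X. markov_chain_from (P x) \<xi> K x"
    and T: "Tbal X P \<xi> \<alpha> c"
    and D: "Dprime X P \<xi> \<gamma> b"
    and q: "q > 0"
  shows
    "(\<gamma> > \<alpha> - 1 \<longrightarrow>
        (\<exists>a0. \<forall>a\<ge>a0. \<forall>x\<in>X. \<bar>x\<bar> > a \<longrightarrow>
           (q < 1 - 1 / \<alpha> \<longrightarrow> tau_moment P \<xi> a q x < \<infinity>) \<and>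
           (q > 1 - 1 / \<alpha> \<longrightarrow> tau_moment P \<xi> a q x = \<infinity>)))
   \<and> (\<gamma> = \<alpha> - 1 \<and> b + c * pi * cot (pi * \<alpha> / 2) < 0 \<longrightarrow>
        (\<exists>!\<nu>. 0 < \<nu> \<and> \<nu> < \<alpha> \<and> nu_eq \<alpha> b c \<nu>) \<and>
        (let \<nu>s = (THE \<nu>. 0 < \<nu> \<and> \<nu> < \<alpha> \<and> nu_eq \<alpha> b c \<nu>) in
         \<exists>a0. \<forall>a\<ge>a0. \<forall>x\<in>X. \<bar>x\<bar> > a \<longrightarrow>
           (q < \<nu>s / \<alpha> \<longrightarrow> tau_moment P \<xi> a q x < \<infinity>) \<and>
           (q > \<nu>s / \<alpha> \<longrightarrow> tau_moment P \<xi> a q x = \<infinity>)))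
   \<and> (\<gamma> < \<alpha> - 1 \<and> b < 0 \<longrightarrow>
        (\<exists>a0. \<forall>a\<ge>a0. \<forall>x\<in>X. \<bar>x\<bar> > a \<longrightarrow>
           (q < \<alpha> / (\<gamma> + 1) \<longrightarrow> tau_moment P \<xi> a q x < \<infinity>) \<and>
           (q \<ge> \<alpha> / (\<gamma> + 1) \<longrightarrow> tau_moment P \<xi> a q x = \<infinity>)))"
proof -
  have X_closed: "emeasure (K x) (UNIV - X) = 0" if "x \<in> X" for x
    using K(2) that by blast
  obtain x0 where "heavy_tailed_kernel X K \<alpha> c x0"
    using Tbal_imp_heavy_tailed_kernel[OF K(1) chain T] by blast
  then interpret heavy_tailed_kernel X K \<alpha> c x0 .
  have \<gamma>: "0 \<le> \<gamma>" using D by (simp add: Dprime_def)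
  have drift: "((\<lambda>x. \<bar>x\<bar> powr \<gamma> * (sgn x * drift_K x)) \<longlongrightarrow> b) (to_infinity_in X)"
    using chain by (intro Dprime_imp_tendsto[OF D]) (auto simp: drift_K_def drift_eq[OF _ K])
  have i: "\<exists>a0. \<forall>a\<ge>a0. \<forall>x\<in>X. \<bar>x\<bar> > a \<longrightarrow>
           (q < 1 - 1 / \<alpha> \<longrightarrow> tau_moment P \<xi> a q x < \<infinity>) \<and>
           (q > 1 - 1 / \<alpha> \<longrightarrow> tau_moment P \<xi> a q x = \<infinity>)" if "\<gamma> > \<alpha> - 1"
  proof -
    interpret k: killed_chain X K \<alpha> c x0 \<alpha> "\<lambda>\<nu>. \<nu> * (0 - c * nu_rhs \<alpha> \<nu>)"
      by unfold_locales (use X(1) X_closed \<alpha> ratio_limit_diffusive[OF drift] that in auto)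
    have eq: "1 - 1 / \<alpha> = (\<alpha> - 1) / \<alpha>" using \<alpha> by (simp add: field_simps)
    show ?thesis unfolding eq
    proof (rule conj_cases_outside_ball)
      assume "q < (\<alpha> - 1) / \<alpha>"
      then have "q * \<alpha> < \<alpha> - 1" using \<alpha> by (simp add: field_simps)
      then obtain \<nu> where \<nu>: "q * \<alpha> < \<nu>" "\<nu> < \<alpha> - 1" using dense by blast
      moreover have "0 < q * \<alpha>" using q \<alpha> by simp
      ultimately have "0 < \<nu>" "\<nu> < \<alpha>" "q < \<nu> / \<alpha>" using \<alpha> by (auto simp: field_simps)
      then show "\<exists>a0. \<forall>a\<ge>a0. \<forall>x\<in>X. \<bar>x\<bar> > a \<longrightarrow> tau_moment P \<xi> a q x < \<infinity>"
        using nu_rhs_sign(1)[OF \<alpha>, of \<nu>] \<nu> c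
        by (intro k.tau_moment_finite_of_neg[OF chain q, of \<nu>]) (auto intro!: mult_pos_pos)
    next
      assume "q > (\<alpha> - 1) / \<alpha>"
      \<comment> \<open>The minimum keeps the auxiliary exponent below \<alpha> when q is at least
        1.\<close>
      then have "\<alpha> - 1 < min \<alpha> (q * \<alpha>)" using \<alpha> by (simp add: field_simps)
      then obtain \<nu> where \<nu>: "\<alpha> - 1 < \<nu>" "\<nu> < min \<alpha> (q * \<alpha>)" using dense by blast
      then have "0 < \<nu>" "\<nu> < \<alpha>" "\<nu> / \<alpha> \<le> q" using \<alpha> by (auto simp: field_simps)
      then show "\<exists>a0. \<forall>a\<ge>a0. \<forall>x\<in>X. \<bar>x\<bar> > a \<longrightarrow> tau_moment P \<xi> a q x = \<infinity>"
        using nu_rhs_sign(2)[OF \<alpha>, of \<nu>] \<nu> c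
        by (intro k.tau_moment_infinite_of_pos[OF chain q, of \<nu>]) (auto intro!: mult_pos_neg)
    qed
  qed
  have ii: "(\<exists>!\<nu>. 0 < \<nu> \<and> \<nu> < \<alpha> \<and> nu_eq \<alpha> b c \<nu>) \<and>
        (let \<nu>s = (THE \<nu>. 0 < \<nu> \<and> \<nu> < \<alpha> \<and> nu_eq \<alpha> b c \<nu>) in
         \<exists>a0. \<forall>a\<ge>a0. \<forall>x\<in>X. \<bar>x\<bar> > a \<longrightarrow>
           (q < \<nu>s / \<alpha> \<longrightarrow> tau_moment P \<xi> a q x < \<infinity>) \<and>
           (q > \<nu>s / \<alpha> \<longrightarrow> tau_moment P \<xi> a q x = \<infinity>))"
    if crit: "\<gamma> = \<alpha> - 1" "b + c * pi * cot (pi * \<alpha> / 2) < 0"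
  proof -
    interpret k: killed_chain X K \<alpha> c x0 \<alpha> "\<lambda>\<nu>. \<nu> * (b - c * nu_rhs \<alpha> \<nu>)"
      by unfold_locales (use X(1) X_closed \<alpha> ratio_limit_diffusive[OF drift] that(1) in auto)
    obtain \<nu>s where s: "0 < \<nu>s" "\<nu>s < \<alpha>" and
      eq: "\<And>\<nu>. 0 < \<nu> \<Longrightarrow> \<nu> < \<alpha> \<Longrightarrow> nu_eq \<alpha> b c \<nu> \<longleftrightarrow> \<nu> = \<nu>s" and
      below: "\<And>\<nu>. 0 < \<nu> \<Longrightarrow> \<nu> < \<nu>s \<Longrightarrow> \<nu> * (b - c * nu_rhs \<alpha> \<nu>) < 0" and
      above: "\<And>\<nu>. \<nu>s < \<nu> \<Longrightarrow> \<nu> < \<alpha> \<Longrightarrow> \<nu> * (b - c * nu_rhs \<alpha> \<nu>) > 0"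
      using k.critical_exponent[OF X(3) refl crit(2)] by blast
    \<comment> \<open>In this form the simplifier resolves both the unique existence and the
      definite description.\<close>
    have iff: "0 < \<nu> \<and> \<nu> < \<alpha> \<and> nu_eq \<alpha> b c \<nu> \<longleftrightarrow> \<nu> = \<nu>s" for \<nu> using eq s by blast
    have "\<exists>a0. \<forall>a\<ge>a0. \<forall>x\<in>X. \<bar>x\<bar> > a \<longrightarrow>
           (q < \<nu>s / \<alpha> \<longrightarrow> tau_moment P \<xi> a q x < \<infinity>) \<and>
           (q > \<nu>s / \<alpha> \<longrightarrow> tau_moment P \<xi> a q x = \<infinity>)"
    proof (rule conj_cases_outside_ball)
      assume "q < \<nu>s / \<alpha>"
      then have "q * \<alpha> < \<nu>s" using \<alpha> by (simp add: field_simps)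
      then obtain \<nu> where \<nu>: "q * \<alpha> < \<nu>" "\<nu> < \<nu>s" using dense by blast
      moreover have "0 < q * \<alpha>" using q \<alpha> by simp
      ultimately have "0 < \<nu>" "\<nu> < \<alpha>" "q < \<nu> / \<alpha>" using \<alpha> s by (auto simp: field_simps)
      then show "\<exists>a0. \<forall>a\<ge>a0. \<forall>x\<in>X. \<bar>x\<bar> > a \<longrightarrow> tau_moment P \<xi> a q x < \<infinity>"
        using below \<nu> by (intro k.tau_moment_finite_of_neg[OF chain q, of \<nu>]) auto
    next
      assume "q > \<nu>s / \<alpha>"
      then have "\<nu>s < min \<alpha> (q * \<alpha>)" using \<alpha> s by (simp add: field_simps)
      then obtain \<nu> where \<nu>: "\<nu>s < \<nu>" "\<nu> < min \<alpha> (q * \<alpha>)" using dense by blast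
      then have "0 < \<nu>" "\<nu> < \<alpha>" "\<nu> / \<alpha> \<le> q" using \<alpha> s by (auto simp: field_simps)
      then show "\<exists>a0. \<forall>a\<ge>a0. \<forall>x\<in>X. \<bar>x\<bar> > a \<longrightarrow> tau_moment P \<xi> a q x = \<infinity>"
        using above \<nu> by (intro k.tau_moment_infinite_of_pos[OF chain q, of \<nu>]) auto
    qed
    then show ?thesis by (simp add: iff)
  qed
  have iii: "\<exists>a0. \<forall>a\<ge>a0. \<forall>x\<in>X. \<bar>x\<bar> > a \<longrightarrow>
           (q < \<alpha> / (\<gamma> + 1) \<longrightarrow> tau_moment P \<xi> a q x < \<infinity>) \<and>
           (q \<ge> \<alpha> / (\<gamma> + 1) \<longrightarrow> tau_moment P \<xi> a q x = \<infinity>)" if "\<gamma> < \<alpha> - 1" "b < 0"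
  proof -
    \<comment> \<open>Since b < 0, every exponent below \<alpha> gives a supermartingale; the
      threshold comes from the range of admissible exponents and not from a zero of
      \<open>\<kappa>\<close>.\<close>
    interpret k: killed_chain X K \<alpha> c x0 "\<gamma> + 1" "\<lambda>\<nu>. \<nu> * b"
      by unfold_locales (use X(1) X_closed \<gamma> ratio_limit_drift[OF drift] that(1) in auto)
    show ?thesis
    proof (rule conj_cases_outside_ball)
      assume "q < \<alpha> / (\<gamma> + 1)"
      then have "q * (\<gamma> + 1) < \<alpha>" using \<gamma> by (simp add: field_simps)
      then obtain \<nu> where \<nu>: "q * (\<gamma> + 1) < \<nu>" "\<nu> < \<alpha>" using dense by blast
      moreover have "0 < q * (\<gamma> + 1)" using q \<gamma> by simp
      ultimately have "0 < \<nu>" "q < \<nu> / (\<gamma> + 1)" using \<gamma> by (auto simp: field_simps)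
      then show "\<exists>a0. \<forall>a\<ge>a0. \<forall>x\<in>X. \<bar>x\<bar> > a \<longrightarrow> tau_moment P \<xi> a q x < \<infinity>"
        using \<nu> that by (intro k.tau_moment_finite_of_neg[OF chain q, of \<nu>]) (auto intro!: mult_pos_neg)
    next
      assume "q \<ge> \<alpha> / (\<gamma> + 1)"
      then show "\<exists>a0. \<forall>a\<ge>a0. \<forall>x\<in>X. \<bar>x\<bar> > a \<longrightarrow> tau_moment P \<xi> a q x = \<infinity>"
        by (rule k.tau_moment_infinite_one_jump[OF chain q])
    qed
  qed
  show ?thesis using i ii iii by blast
qed

end
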